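(* Let $\Omega\subset\mathbb{R}^n$ be a bounded domain with smooth boundary and $0\in\Omega$. Assume that $f\in C^1([0,\infty))$ satisfies $f(0)=0$ and $\inf_{v\ge R} f(v)>0$ for each $R>0$. Let $p>1$ and $a,b,\kappa\in(0,\infty)$ be arbitrary. Consider the problem $$u_t=-au+u^pf(v)\quad (x\in\overline\Omega,\ t\in[0,T_{max})),$$ $$v_t=\Delta v-bv-u^pf(v)+\kappa\quad (x\in\Omega,\ t\in[0,T_{max})),$$ $$\frac{\partial v}{\partial n}=0\ \text{ on }\partial\Omega\times[0,T_{max}),\qquad u(x,0)=u_0(x),\quad v(x,0)=v_0(x)\ \text{ for }x\in\Omega.$$ There exist numbers $\alpha\in(0,1)$, $\varepsilon>0$ and $R_0>0$ (depending on the parameters of this problem) such that if the initial conditions $u_0,v_0\in C(\overline\Omega)$ satisfy $$0<u_0(x)<\Big(u_0(0)^{1-p}+2\varepsilon^{-(p-1)}|x|^{\alpha}\Big)^{-\frac1{p-1}}\qquad\text{for all }x\in\Omega\setminus\{0\},$$ $$u_0(0)\ge\left(\frac{a}{(1-e^{(1-p)a})F_0}\right)^{\frac1{p-1}},\qquad\text{where } F_0=\inf_{v\ge R_0}f(v),$$ $$v_0(x)\equiv\bar v_0>R_0>0\qquad\text{for all }x\in\Omega,$$ where $\bar v_0$ is a constant, then the corresponding solution $(u,v)$ of the problem blows up at a certain time $T_{max}\le 1$. Moreover, the following uniform estimates are valid: $$0<u(x,t)<\varepsilon|x|^{-\frac{\alpha}{p-1}}\quad\text{and}\quad v(x,t)\ge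 R_0\qquad\text{for all }(x,t)\in\Omega\times[0,T_{max}).$$
   Context: For nonnegative $u_0,v_0\in C(\overline\Omega)$ the problem has a unique nonnegative solution $(u,v)$ on a maximal time interval of existence $[0,T_{max})$. "Blows up at time $T_{max}$" means $T_{max}<\infty$, in which case $\sup_{t\in[0,T_{max})}\|u(\cdot,t)\|_{\infty}=\infty$. At $x=0$ the expression $\varepsilon|x|^{-\alpha/(p-1)}$ is read as $+\infty$. $\partial/\partial n$ denotes the normal derivative on $\partial\Omega$.
   Formalization: The number ε may depend on the constant initial value v̄₀ (α and R₀ do not): a single ε for all v̄₀ > R₀ is impossible, since for large u₀(0) and v̄₀ close to R₀ the solution v drops below R₀ near the origin. *)

theory Defs
  imports "HOL-Analysis.Analysis"
begin

text \<open>Meant for open \<open>U\<close>.\<close>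

primrec Ck_on :: "nat \<Rightarrow> ('a::euclidean_space \<Rightarrow> real) \<Rightarrow> 'a set \<Rightarrow> bool" where
  "Ck_on 0 g U \<longleftrightarrow> continuous_on U g"
| "Ck_on (Suc k) g U \<longleftrightarrow>
     (\<exists>G. (\<forall>x\<in>U. GDERIV g x :> G x) \<and> (\<forall>i\<in>Basis. Ck_on k (\<lambda>x. G x \<bullet> i) U))"

definition smooth_on :: "('a::euclidean_space \<Rightarrow> real) \<Rightarrow> 'a set \<Rightarrow> bool" where
  "smooth_on g U \<longleftrightarrow> (\<forall>k. Ck_on k g U)"

text \<open>Near the boundary point \<open>q\<close> the set \<open>\<Omega>\<close> is the sublevel set \<open>{\<rho> < 0}\<close> of a smooth
  function whose gradient \<open>G\<close> does not vanish, so that \<open>\<partial>\<Omega>\<close> is locally the smooth hypersurface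
  \<open>{\<rho> = 0}\<close> with \<open>\<Omega>\<close> on one side of it, and \<open>G q / |G q|\<close> is the outer unit normal.\<close>

definition boundary_chart ::
    "'a::euclidean_space set \<Rightarrow> 'a \<Rightarrow> 'a set \<Rightarrow> ('a \<Rightarrow> real) \<Rightarrow> ('a \<Rightarrow> 'a) \<Rightarrow> bool" where
  "boundary_chart \<Omega> q U \<rho> G \<longleftrightarrow>
     open U \<and> q \<in> U \<and> smooth_on \<rho> U \<and>
     (\<forall>x\<in>U. GDERIV \<rho> x :> G x \<and> G x \<noteq> 0) \<and> \<Omega> \<inter> U = {x\<in>U. \<rho> x < 0}"

definition smooth_boundary :: "'a::euclidean_space set \<Rightarrow> bool" where
  "smooth_boundary \<Omega> \<longleftrightarrow> (\<forall>q\<in>frontier \<Omega>. \<exists>U \<rho> G. boundary_chart \<Omega> q U \<rho> G)"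

definition outer_unit_normal :: "'a::euclidean_space set \<Rightarrow> 'a \<Rightarrow> 'a \<Rightarrow> bool" where
  "outer_unit_normal \<Omega> q n \<longleftrightarrow>
     (\<exists>U \<rho> G. boundary_chart \<Omega> q U \<rho> G \<and> n = G q /\<^sub>R norm (G q))"

definition C1_halfline :: "(real \<Rightarrow> real) \<Rightarrow> bool" where
  "C1_halfline f \<longleftrightarrow>
     (\<exists>f'. (\<forall>v\<ge>0. (f has_real_derivative f' v) (at v within {0..})) \<and> continuous_on {0..} f')"

text \<open>The infimum is taken in the extended reals because the real-valued \<open>Inf\<close> of a set that is
  unbounded below is unspecified.\<close>

definition admissible_nonlinearity :: "(real \<Rightarrow> real) \<Rightarrow> bool" where
  "admissible_nonlinearity f \<longleftrightarrow>
     C1_halfline f \<and> f 0 = 0 \<and> (\<forall>R>0. (INF v\<in>{R..}. ereal (f v)) > 0)"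

definition laplacian :: "('a::euclidean_space \<Rightarrow> real) \<Rightarrow> 'a \<Rightarrow> real" where
  "laplacian g x = (\<Sum>i\<in>Basis. (deriv ^^ 2) (\<lambda>s. g (x + s *\<^sub>R i)) 0)"

definition test_function :: "('a::euclidean_space \<Rightarrow> real) \<Rightarrow> 'a set \<Rightarrow> bool" where
  "test_function \<phi> W \<longleftrightarrow>
     smooth_on \<phi> UNIV \<and> (\<exists>K. compact K \<and> K \<subseteq> W \<and> (\<forall>z. z \<notin> K \<longrightarrow> \<phi> z = 0))"

text \<open>\<open>w\<^sub>t = \<Delta>w + h\<close> in the sense of distributions on \<open>\<Omega> \<times> I\<close>, for continuous \<open>w\<close> and \<open>h\<close>.\<close>

definition heat_equation_distributional ::
    "'a::euclidean_space set \<Rightarrow> real set \<Rightarrow> ('a \<Rightarrow> real \<Rightarrow> real) \<Rightarrow> ('a \<Rightarrow> real \<Rightarrow> real) \<Rightarrow> bool" where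
  "heat_equation_distributional \<Omega> I w h \<longleftrightarrow>
     (\<forall>\<phi>. test_function \<phi> (\<Omega> \<times> I) \<longrightarrow>
        - (LINT (x, t) : \<Omega> \<times> I | lborel. w x t * deriv (\<lambda>s. \<phi> (x, s)) t) =
          (LINT (x, t) : \<Omega> \<times> I | lborel.
             w x t * laplacian (\<lambda>y. \<phi> (y, t)) x + h x t * \<phi> (x, t)))"

text \<open>\<open>\<nabla>w(\<cdot>,t)\<close> extends continuously to the closure of \<open>\<Omega>\<close> (jointly in time), and the normal
  component of the extension vanishes on the boundary.\<close>

definition neumann_condition ::
    "'a::euclidean_space set \<Rightarrow> real set \<Rightarrow> ('a \<Rightarrow> real \<Rightarrow> real) \<Rightarrow> bool" where
  "neumann_condition \<Omega> I w \<longleftrightarrow>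
     (\<exists>D. continuous_on (closure \<Omega> \<times> I) (\<lambda>(x, t). D x t) \<and>
          (\<forall>x\<in>\<Omega>. \<forall>t\<in>I. GDERIV (\<lambda>y. w y t) x :> D x t) \<and>
          (\<forall>q\<in>frontier \<Omega>. \<forall>t\<in>I. \<forall>n. outer_unit_normal \<Omega> q n \<longrightarrow> D q t \<bullet> n = 0))"

text \<open>Nonnegative solutions on \<open>[0,T)\<close>, where \<open>T\<close> may be infinite. The function \<open>u\<close> solves its
  ordinary differential equation pointwise, at \<open>t = 0\<close> with the one-sided derivative. For data that
  are merely continuous, \<open>u(\<cdot>,t)\<close> and hence the source term in the equation for \<open>v\<close> are merely
  continuous in \<open>x\<close>, so \<open>v\<^sub>t\<close> and \<open>\<Delta>v\<close> need not exist pointwise, while \<open>v\<close> does have a continuous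
  spatial gradient up to the boundary for \<open>t > 0\<close>. Therefore the equation for \<open>v\<close> is imposed in the
  sense of distributions and the Neumann condition pointwise for \<open>t > 0\<close>.\<close>

definition rd_ode_solution ::
    "'a::euclidean_space set \<Rightarrow> (real \<Rightarrow> real) \<Rightarrow> real \<Rightarrow> real \<Rightarrow> real \<Rightarrow> real \<Rightarrow>
     ('a \<Rightarrow> real) \<Rightarrow> ('a \<Rightarrow> real) \<Rightarrow> ereal \<Rightarrow> ('a \<Rightarrow> real \<Rightarrow> real) \<Rightarrow> ('a \<Rightarrow> real \<Rightarrow> real) \<Rightarrow> bool" where
  "rd_ode_solution \<Omega> f p a b \<kappa> u0 v0 T u v \<longleftrightarrow>
     (let J = {t. 0 \<le> t \<and> ereal t < T}; I = {t. 0 < t \<and> ereal t < T} in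
      0 < T \<and>
      continuous_on (closure \<Omega> \<times> J) (\<lambda>(x, t). u x t) \<and>
      continuous_on (closure \<Omega> \<times> J) (\<lambda>(x, t). v x t) \<and>
      (\<forall>x\<in>closure \<Omega>. \<forall>t\<in>J. u x t \<ge> 0 \<and> v x t \<ge> 0) \<and>
      (\<forall>x\<in>closure \<Omega>. \<forall>t\<in>J.
         (u x has_real_derivative - a * u x t + u x t powr p * f (v x t)) (at t within J)) \<and>
      heat_equation_distributional \<Omega> I v (\<lambda>x t. - b * v x t - u x t powr p * f (v x t) + \<kappa>) \<and>
      neumann_condition \<Omega> I v \<and>
      (\<forall>x\<in>\<Omega>. u x 0 = u0 x \<and> v x 0 = v0 x))"

text \<open>\<open>[0,T)\<close> is the maximal interval of existence: the solution cannot be continued to a larger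
  one. Blow-up at time \<open>T\<close> means that \<open>T\<close> is finite; that \<open>sup |u(\<cdot>,t)|\<close> is then infinite is the
  continuation criterion of the local theory and not part of the definition.

  In the theorem the number \<open>\<epsilon>\<close> may depend on the constant initial value of \<open>v\<close>. It cannot be
  chosen uniformly for all constants \<open>c > R0\<close>: if \<open>u0 0\<close> is large, \<open>v\<close> decreases near the origin
  at first, at a rate that stays bounded away from \<open>0\<close> as \<open>c\<close> tends to \<open>R0\<close>, so that the estimate
  \<open>v \<ge> R0\<close> would fail for \<open>c\<close> close to \<open>R0\<close>.\<close>

definition maximal_rd_ode_solution ::
    "'a::euclidean_space set \<Rightarrow> (real \<Rightarrow> real) \<Rightarrow> real \<Rightarrow> real \<Rightarrow> real \<Rightarrow> real \<Rightarrow>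
     ('a \<Rightarrow> real) \<Rightarrow> ('a \<Rightarrow> real) \<Rightarrow> ereal \<Rightarrow> ('a \<Rightarrow> real \<Rightarrow> real) \<Rightarrow> ('a \<Rightarrow> real \<Rightarrow> real) \<Rightarrow> bool" where
  "maximal_rd_ode_solution \<Omega> f p a b \<kappa> u0 v0 T u v \<longleftrightarrow>
     rd_ode_solution \<Omega> f p a b \<kappa> u0 v0 T u v \<and>
     \<not> (\<exists>T' u' v'. T < T' \<and> rd_ode_solution \<Omega> f p a b \<kappa> u0 v0 T' u' v' \<and>
          (\<forall>x\<in>closure \<Omega>. \<forall>t. 0 \<le> t \<and> ereal t < T \<longrightarrow> u' x t = u x t \<and> v' x t = v x t))"

end

theory Submission
  imports Defs
begin

text \<open>Take \<open>\<alpha> = (p - 1) / (2p)\<close> and \<open>R\<^sub>0 = \<kappa> / (2b)\<close>. As long as \<open>u \<le> \<epsilon> |x|\<^bsup>-\<alpha>/(p-1)\<^esup>\<close>, the reaction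
  term is at most a multiple of \<open>\<epsilon>\<^sup>p |x|\<^bsup>-1/2\<^esup>\<close>, which is dominated by \<open>|x\<^sub>i|\<^bsup>-1/2\<^esup>\<close> for each coordinate and
  can therefore be absorbed by one-dimensional barriers. They yield \<open>v \<ge> R\<^sub>0\<close> and, by reflection in
  coordinate hyperplanes, a bound \<open>|v(x,t) - v(0,t)| \<le> C |x|\<^sup>\<alpha>\<close> with \<open>C\<close> independent of \<open>\<epsilon>\<close>. Since \<open>u\<^bsup>1-p\<^esup>\<close>
  solves a linear equation in \<open>t\<close>, comparing it at \<open>x\<close> with its positive value at \<open>0\<close> improves the
  bound on \<open>u\<close> by a factor below one, so the bound propagates for all times up to one; and
  \<open>u(0,t)\<^bsup>1-p\<^esup>\<close> would be nonpositive at \<open>t = 1\<close>.\<close>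

subsection \<open>Smooth functions and bumps\<close>


text \<open>The value of \<alpha> gives \<alpha> p / (p - 1) = 1/2 in every dimension. As a function
  of one coordinate, |s|^(-1/2) is integrable, and its second antiderivative, a multiple of
  |s|^(3/2), has bounded slope on bounded sets; hence elementary barriers suffice and no heat kernel
  is needed. The obstacle is regularity. Since u(.,t) is merely continuous, v solves its equation
  only in the sense of distributions, and derivatives of v cannot be inspected at a maximum. Local
  mollification supplies nearby classical solutions, and the maximum argument is applied to them
  with small errors. The second difficulty is a circle: the estimates of v presuppose the bound on u
  with \<epsilon>, while \<epsilon> must be small compared with the constants in those estimates.
  For \<epsilon> \<le> 1 the constants can be fixed before \<epsilon>, and they do not depend on the
  level at which the singularity is truncated. The number R0 is half the equilibrium \<kappa>/b.
  Below \<kappa>/b the term -bv + \<kappa> pushes v upwards, so only the reaction can lower v, and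
  by at most a multiple of \<epsilon>^p.\<close>

lemma GDERIV_unique:
  assumes "GDERIV g x :> D" "GDERIV g x :> E"
  shows "D = E"
proof -
  have "(\<lambda>h. h \<bullet> D) = (\<lambda>h. h \<bullet> E)"
    using assms unfolding gderiv_def by (rule has_derivative_unique)
  then show ?thesis
    by (metis inner_commute vector_eq_rdot)
qed

lemma GDERIV_line:
  assumes "GDERIV g (x + s *\<^sub>R e) :> D"
  shows "((\<lambda>s. g (x + s *\<^sub>R e)) has_real_derivative D \<bullet> e) (at s)"
proof -
  have "((\<lambda>s. x + s *\<^sub>R e) has_derivative (\<lambda>h. h *\<^sub>R e)) (at s)"
    by (auto intro!: derivative_eq_intros)
  from diff_chain_at[OF this assms[unfolded gderiv_def]] show ?thesis
    unfolding has_field_derivative_def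
    by (simp add: o_def mult.commute[of _ "D \<bullet> e"] inner_commute[of e D])
qed

lemma GDERIV_cong_open:
  assumes "GDERIV g x :> D" "open U" "x \<in> U" "\<And>y. y \<in> U \<Longrightarrow> g y = h y"
  shows "GDERIV h x :> D"
  using assms unfolding gderiv_def
  by (metis has_derivative_transform_within_open)

section \<open>Closure properties of the classes \<open>Ck_on\<close>\<close>

lemma Ck_on_Suc_imp: "Ck_on (Suc k) g U \<Longrightarrow> Ck_on k g U"
proof (induction k arbitrary: g)
  case 0
  then obtain G where "\<forall>x\<in>U. (g has_derivative (\<lambda>h. h \<bullet> G x)) (at x)"
    by (auto simp: gderiv_def)
  then have "\<forall>x\<in>U. isCont g x"
    by (meson has_derivative_continuous)
  then show ?case
    by (simp add: continuous_at_imp_continuous_on)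
next
  case (Suc k)
  then obtain G where "\<forall>x\<in>U. GDERIV g x :> G x" "\<forall>i\<in>Basis. Ck_on (Suc k) (\<lambda>x. G x \<bullet> i) U"
    using Ck_on.simps(2) by blast
  with Suc.IH show ?case
    unfolding Ck_on.simps(2)[of k g] by blast
qed

lemma Ck_on_continuous: "Ck_on k g U \<Longrightarrow> continuous_on U g"
proof (induction k)
  case (Suc k)
  then show ?case using Ck_on_Suc_imp by blast
qed simp

lemma Ck_on_cong:
  assumes "open U" "\<And>x. x \<in> U \<Longrightarrow> g x = h x" "Ck_on k g U"
  shows "Ck_on k h U"
proof (cases k)
  case 0
  then show ?thesis using assms by (auto cong: continuous_on_cong)
next
  case (Suc j)
  then show ?thesis using assms unfolding Suc Ck_on.simps(2) by (meson GDERIV_cong_open)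
qed

lemma Ck_on_const: "Ck_on k (\<lambda>x. c) U"
proof (induction k arbitrary: c)
  case (Suc k)
  then show ?case by (auto intro!: exI[of _ "\<lambda>_. 0"] simp: GDERIV_const)
qed simp

lemma Ck_on_add:
  "Ck_on k g U \<Longrightarrow> Ck_on k h U \<Longrightarrow> Ck_on k (\<lambda>x. g x + h x) U"
proof (induction k arbitrary: g h)
  case (Suc k)
  obtain G where G: "\<forall>x\<in>U. GDERIV g x :> G x" "\<forall>i\<in>Basis. Ck_on k (\<lambda>x. G x \<bullet> i) U"
    using Suc.prems(1) by auto
  obtain H where H: "\<forall>x\<in>U. GDERIV h x :> H x" "\<forall>i\<in>Basis. Ck_on k (\<lambda>x. H x \<bullet> i) U"
    using Suc.prems(2) by auto
  show ?case unfolding Ck_on.simps(2)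
    using G H Suc.IH
    by (intro exI[of _ "\<lambda>x. G x + H x"]) (auto intro: GDERIV_add simp: inner_add_left)
qed (auto intro: continuous_intros)

lemma Ck_on_mult:
  "Ck_on k g U \<Longrightarrow> Ck_on k h U \<Longrightarrow> Ck_on k (\<lambda>x. g x * h x) U"
proof (induction k arbitrary: g h)
  case (Suc k)
  obtain G where G: "\<forall>x\<in>U. GDERIV g x :> G x" "\<forall>i\<in>Basis. Ck_on k (\<lambda>x. G x \<bullet> i) U"
    using Suc.prems(1) by auto
  obtain H where H: "\<forall>x\<in>U. GDERIV h x :> H x" "\<forall>i\<in>Basis. Ck_on k (\<lambda>x. H x \<bullet> i) U"
    using Suc.prems(2) by auto
  have "Ck_on k g U" "Ck_on k h U"
    using Suc.prems Ck_on_Suc_imp by blast+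
  then show ?case unfolding Ck_on.simps(2)
    using G H Suc.IH
    by (intro exI[of _ "\<lambda>x. g x *\<^sub>R H x + h x *\<^sub>R G x"])
       (auto intro!: GDERIV_mult Ck_on_add simp: inner_add_left)
qed (auto intro: continuous_intros)

lemma Ck_on_sum:
  "finite I \<Longrightarrow> (\<And>i. i \<in> I \<Longrightarrow> Ck_on k (g i) U) \<Longrightarrow> Ck_on k (\<lambda>x. \<Sum>i\<in>I. g i x) U"
  by (induction I rule: finite_induct) (auto intro: Ck_on_const Ck_on_add)

text \<open>By uniqueness the two gradients agree on the overlap, so they paste to one field, and
  the induction hypothesis applies to its components. This is how a cut-off local function is
  extended by zero.\<close>

lemma Ck_on_Un:
  assumes "open U" "open V"
  shows "Ck_on k g U \<Longrightarrow> Ck_on k g V \<Longrightarrow> Ck_on k g (U \<union> V)"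
proof (induction k arbitrary: g)
  case 0
  then show ?case using assms by (auto intro: continuous_on_open_Un)
next
  case (Suc k)
  obtain G where G: "\<forall>x\<in>U. GDERIV g x :> G x" "\<forall>i\<in>Basis. Ck_on k (\<lambda>x. G x \<bullet> i) U"
    using Suc.prems(1) by auto
  obtain H where H: "\<forall>x\<in>V. GDERIV g x :> H x" "\<forall>i\<in>Basis. Ck_on k (\<lambda>x. H x \<bullet> i) V"
    using Suc.prems(2) by auto
  define K where "K x = (if x \<in> U then G x else H x)" for x
  have KU: "K x = G x" if "x \<in> U" for x
    using that by (simp add: K_def)
  have KV: "K x = H x" if "x \<in> V" for x
    using that G H GDERIV_unique by (fastforce simp: K_def)
  have "Ck_on k (\<lambda>x. K x \<bullet> i) (U \<union> V)" if "i \<in> Basis" for i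
  proof (rule Suc.IH)
    show "Ck_on k (\<lambda>x. K x \<bullet> i) U"
      by (rule Ck_on_cong[OF \<open>open U\<close> _ G(2)[rule_format, OF that]]) (simp add: KU)
    show "Ck_on k (\<lambda>x. K x \<bullet> i) V"
      by (rule Ck_on_cong[OF \<open>open V\<close> _ H(2)[rule_format, OF that]]) (simp add: KV)
  qed
  moreover have "GDERIV g x :> K x" if "x \<in> U \<union> V" for x
    using that G(1) H(1) KU KV by auto
  ultimately show ?case unfolding Ck_on.simps(2) by blast
qed

lemma Ck_on_inner: "Ck_on k (\<lambda>x. x \<bullet> c) U"
proof (cases k)
  case (Suc j)
  have "GDERIV (\<lambda>x. x \<bullet> c) x :> c" for x
    unfolding gderiv_def by (auto intro!: derivative_eq_intros)
  then show ?thesis unfolding Suc Ck_on.simps(2)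
    by (intro exI[of _ "\<lambda>_. c"]) (auto intro: Ck_on_const)
qed (auto intro: continuous_intros)

lemma GDERIV_norm_power2: "GDERIV (\<lambda>x. (norm (x - q))\<^sup>2) x :> 2 *\<^sub>R (x - q)"
  unfolding gderiv_def power2_norm_eq_inner
  by (auto intro!: derivative_eq_intros simp: inner_commute fun_eq_iff)

lemma Ck_on_norm_power2: "Ck_on k (\<lambda>x. (norm (x - q))\<^sup>2) U"
proof (cases k)
  case (Suc j)
  have "Ck_on j (\<lambda>x. (2 *\<^sub>R (x - q)) \<bullet> i) U" for i
    using Ck_on_add[OF Ck_on_mult[OF Ck_on_const[of j 2] Ck_on_inner[of j i]]
        Ck_on_const[of j "- 2 * (q \<bullet> i)"]]
    by (simp add: inner_diff_left algebra_simps)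
  then show ?thesis unfolding Suc Ck_on.simps(2)
    by (intro exI[of _ "\<lambda>x. 2 *\<^sub>R (x - q)"] conjI ballI GDERIV_norm_power2)
qed (auto intro!: continuous_intros)

text \<open>The family \<open>flat k\<close> is closed under differentiation up to linear combinations, which gives
  smoothness of \<open>flat 0\<close> without polynomials.\<close>

definition flat :: "nat \<Rightarrow> real \<Rightarrow> real" where
  "flat k r = (if r > 0 then exp (- inverse r) * inverse r ^ k else 0)"

lemma flat_nonneg: "flat k r \<ge> 0"
  by (simp add: flat_def)

lemma flat_tendsto_0: "(flat k \<longlongrightarrow> 0) (at 0)"
proof -
  have "((\<lambda>y::real. y ^ k / exp y) \<longlongrightarrow> 0) at_top"
    by (rule tendsto_power_div_exp_0)
  then have "((\<lambda>r::real. inverse r ^ k / exp (inverse r)) \<longlongrightarrow> 0) (at_right 0)"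
    by (rule filterlim_compose) (rule filterlim_inverse_at_top_right)
  moreover have "\<forall>\<^sub>F r in at_right 0. inverse r ^ k / exp (inverse r) = flat k (r::real)"
    by (auto simp: eventually_at_filter flat_def exp_minus divide_inverse)
  ultimately have "(flat k \<longlongrightarrow> 0) (at_right 0)"
    by (rule Lim_transform_eventually)
  moreover have "(flat k \<longlongrightarrow> 0) (at_left 0)"
    by (rule Lim_transform_eventually[OF tendsto_const]) (auto simp: eventually_at_filter flat_def)
  ultimately show ?thesis
    using filterlim_at_split by blast
qed

lemma flat_derivative:
  "(flat k has_real_derivative flat (k + 2) r - real k * flat (k + 1) r) (at r)"
proof -
  consider "r > 0" | "r < 0" | "r = 0" by linarith
  then show ?thesis
  proof cases
    case 1
    have "((\<lambda>r. exp (- inverse r) * inverse r ^ k) has_real_derivative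
      flat (k + 2) r - real k * flat (k + 1) r) (at r)"
    proof (cases k)
      case 0
      then show ?thesis
        using 1 by (auto intro!: derivative_eq_intros simp: flat_def power2_eq_square)
    next
      case (Suc j)
      have "((\<lambda>r. exp (- inverse r) * inverse r ^ Suc j) has_real_derivative
          exp (- inverse r) * (inverse r)\<^sup>2 * inverse r ^ Suc j
          + exp (- inverse r) * (real (Suc j) * inverse r ^ j * - (inverse r)\<^sup>2)) (at r)"
        using 1 by (auto intro!: derivative_eq_intros simp: power2_eq_square simp del: power_Suc)
      then show ?thesis
        using 1 by (simp add: Suc flat_def power2_eq_square algebra_simps)
    qed
    then show ?thesis
      by (rule has_field_derivative_transform_within_open[of _ _ _ "{0<..}"])
         (use 1 in \<open>auto simp: flat_def\<close>)
  next
    case 2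
    have "((\<lambda>r. 0) has_real_derivative flat (k + 2) r - real k * flat (k + 1) r) (at r)"
      using 2 by (simp add: flat_def)
    then show ?thesis
      by (rule has_field_derivative_transform_within_open[of _ _ _ "{..<0}"])
         (use 2 in \<open>auto simp: flat_def\<close>)
  next
    case 3
    \<comment> \<open>At 0 the difference quotient of \<open>flat k\<close> is
      \<open>flat (k + 1)\<close>, which tends to 0.\<close>
    have "\<forall>\<^sub>F h in at 0. flat (k + 1) h = (flat k (0 + h) - flat k 0) / h"
      by (auto simp: eventually_at_filter flat_def divide_inverse)
    from Lim_transform_eventually[OF flat_tendsto_0 this]
    show ?thesis using 3 by (simp add: DERIV_def flat_def)
  qed
qed

lemma flat_continuous: "continuous_on A (flat k)"
  using flat_derivative by (meson DERIV_isCont continuous_at_imp_continuous_on)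

text \<open>The index \<open>k\<close> stays arbitrary in the induction on \<open>n\<close>, because
  one differentiation turns \<open>flat k\<close> into a combination of \<open>flat (k + 1)\<close>
  and \<open>flat (k + 2)\<close>.\<close>

lemma Ck_on_flat:
  assumes "\<And>k. Ck_on k g U"
  shows "Ck_on n (\<lambda>x. flat k (g x)) U"
proof (induction n arbitrary: k)
  case 0
  show ?case
    using Ck_on_continuous[OF assms] continuous_on_compose2[OF flat_continuous[of UNIV]] by auto
next
  case (Suc n)
  obtain G where G: "\<forall>x\<in>U. GDERIV g x :> G x" "\<forall>i\<in>Basis. Ck_on n (\<lambda>x. G x \<bullet> i) U"
    using assms[of "Suc n"] by auto
  let ?d = "\<lambda>x. flat (k + 2) (g x) - real k * flat (k + 1) (g x)"
  have "GDERIV (\<lambda>x. flat k (g x)) x :> ?d x *\<^sub>R G x" if "x \<in> U" for x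
    by (rule GDERIV_DERIV_compose) (use that G in \<open>auto intro: flat_derivative[simplified]\<close>)
  moreover have "Ck_on n (\<lambda>x. (?d x *\<^sub>R G x) \<bullet> i) U" if "i \<in> Basis" for i
    using Ck_on_mult[OF Ck_on_add[OF Suc.IH[of "k + 2"]
          Ck_on_mult[OF Ck_on_const[of n "- real k"] Suc.IH[of "k + 1"]]] G(2)[rule_format, OF that]]
    by simp
  ultimately show ?case unfolding Ck_on.simps(2)
    by (intro exI[of _ "\<lambda>x. ?d x *\<^sub>R G x"] conjI ballI)
qed

text \<open>The squared norm keeps the function smooth at its centre. Its mass is not normalised
  here but divided out in \<open>mollify\<close>.\<close>

definition bump :: "real \<Rightarrow> 'a::euclidean_space \<Rightarrow> 'a \<Rightarrow> real" where
  "bump r q x = flat 0 (r\<^sup>2 - (norm (x - q))\<^sup>2)"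

lemma Ck_on_bump: "Ck_on k (bump r q) U"
proof -
  have "Ck_on k (\<lambda>x. r\<^sup>2 + (- 1) * (norm (x - q))\<^sup>2) U" for k
    by (intro Ck_on_add Ck_on_const Ck_on_mult Ck_on_norm_power2)
  from Ck_on_flat[OF this] show ?thesis
    by (simp add: bump_def[abs_def])
qed

lemma bump_pos: "r > 0 \<Longrightarrow> x \<in> ball q r \<Longrightarrow> bump r q x > 0"
  by (simp add: bump_def flat_def dist_norm norm_minus_commute power_strict_mono)

lemma bump_eq_0: "r > 0 \<Longrightarrow> x \<notin> ball q r \<Longrightarrow> bump r q x = 0"
  by (simp add: bump_def flat_def dist_norm norm_minus_commute not_less power_mono)

lemma bump_nonneg: "bump r q x \<ge> 0"
  by (simp add: bump_def flat_nonneg)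

subsection \<open>Mollification of distributional solutions\<close>


text \<open>A relation rather than a value: unlike \<open>(deriv ^^ 2)\<close> it asserts that the
  second derivative at 0 exists, so it can be added, scaled and tested at a maximum.\<close>

definition has_D2 :: "(real \<Rightarrow> real) \<Rightarrow> real \<Rightarrow> bool" where
  "has_D2 \<phi> d \<longleftrightarrow> (\<exists>\<phi>'. (\<forall>\<^sub>F s in nhds 0. (\<phi> has_real_derivative \<phi>' s) (at s)) \<and>
     (\<phi>' has_real_derivative d) (at 0))"

definition has_laplacian :: "('a::euclidean_space \<Rightarrow> real) \<Rightarrow> 'a \<Rightarrow> real \<Rightarrow> bool" where
  "has_laplacian g x L \<longleftrightarrow>
     (\<exists>d. (\<forall>i\<in>Basis. has_D2 (\<lambda>s. g (x + s *\<^sub>R i)) (d i)) \<and> L = (\<Sum>i\<in>Basis. d i))"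

definition classical_heat ::
    "('a::euclidean_space \<times> real \<Rightarrow> real) \<Rightarrow> ('a \<times> real \<Rightarrow> real) \<Rightarrow> 'a \<times> real \<Rightarrow> bool" where
  "classical_heat w h z \<longleftrightarrow>
     (\<exists>L. has_laplacian (\<lambda>y. w (y, snd z)) (fst z) L \<and>
       ((\<lambda>s. w (fst z, s)) has_real_derivative L + h z) (at (snd z)))"

text \<open>Continuity of \<open>w'\<close> lets it attain a maximum on a compact set; there
  \<open>h'\<close> is compared with \<open>h\<close> only pointwise.\<close>

definition heat_approximable ::
    "('a::euclidean_space \<times> real) set \<Rightarrow> ('a \<times> real \<Rightarrow> real) \<Rightarrow> ('a \<times> real \<Rightarrow> real) \<Rightarrow> bool" where
  "heat_approximable K w h \<longleftrightarrow> (\<forall>e>0. \<exists>w' h'. continuous_on K w' \<and>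
     (\<forall>y\<in>K. \<bar>w' y - w y\<bar> < e \<and> \<bar>h' y - h y\<bar> < e \<and> classical_heat w' h' y))"

text \<open>The notion of weak solution used for the comparison principle: locally uniform limits of
  classical solutions. Unlike the distributional formulation it is immediately stable under
  differences and coordinate reflections.\<close>

definition approx_heat ::
    "('a::euclidean_space \<times> real) set \<Rightarrow> ('a \<times> real \<Rightarrow> real) \<Rightarrow> ('a \<times> real \<Rightarrow> real) \<Rightarrow> bool" where
  "approx_heat U w h \<longleftrightarrow>
     (\<forall>z\<in>U. \<exists>r>0. cball z r \<subseteq> U \<and> heat_approximable (cball z r) w h)"

text \<open>\<open>bump1\<close> and \<open>bump2\<close> are the first and second derivatives of
  \<open>bump r q\<close> in direction \<open>e\<close>, computed from the derivative
  \<open>flat 2\<close> of \<open>flat 0\<close> and the derivative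
  \<open>flat 4 - 2 * flat 3\<close> of \<open>flat 2\<close>.\<close>

definition bump1 :: "real \<Rightarrow> 'a::euclidean_space \<Rightarrow> 'a \<Rightarrow> 'a \<Rightarrow> real" where
  "bump1 r e q x = flat 2 (r\<^sup>2 - (norm (x - q))\<^sup>2) * (- 2 * ((x - q) \<bullet> e))"

definition bump2 :: "real \<Rightarrow> 'a::euclidean_space \<Rightarrow> 'a \<Rightarrow> 'a \<Rightarrow> real" where
  "bump2 r e q x =
     (flat 4 (r\<^sup>2 - (norm (x - q))\<^sup>2) - 2 * flat 3 (r\<^sup>2 - (norm (x - q))\<^sup>2)) *
       (- 2 * ((x - q) \<bullet> e))\<^sup>2 + flat 2 (r\<^sup>2 - (norm (x - q))\<^sup>2) * (- 2 * (e \<bullet> e))"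

text \<open>Exchanging centre and argument converts derivatives in the integration variable, which
  the weak equation provides, into derivatives in the centre, which a mollified function needs. Even
  orders are symmetric, the first order changes sign.\<close>

lemma bump_commute: "bump r q x = bump r x q"
  by (simp add: bump_def norm_minus_commute)

lemma bump1_commute: "bump1 r e q x = - bump1 r e x q"
  by (simp add: bump1_def norm_minus_commute[of x q] inner_diff_left algebra_simps)

lemma bump2_commute: "bump2 r e q x = bump2 r e x q"
proof -
  have "(- 2 * ((x - q) \<bullet> e))\<^sup>2 = (- 2 * ((q - x) \<bullet> e))\<^sup>2"
    by (simp add: inner_diff_left power2_eq_square algebra_simps)
  then show ?thesis
    by (simp add: bump2_def norm_minus_commute[of x q])
qed

lemma bump_line_derivative:
  "((\<lambda>s. bump r q (x + s *\<^sub>R e)) has_real_derivative bump1 r e q (x + s *\<^sub>R e)) (at s)"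
proof -
  have 1: "((\<lambda>s. r\<^sup>2 - (norm (x + s *\<^sub>R e - q))\<^sup>2) has_real_derivative
      - 2 * ((x + s *\<^sub>R e - q) \<bullet> e)) (at s)"
    using DERIV_diff[OF DERIV_const[of "r\<^sup>2"] GDERIV_line[OF GDERIV_norm_power2]]
    by simp
  have 2: "(flat 0 has_real_derivative flat 2 y) (at y)" for y
    using flat_derivative[of 0 y] by (simp add: numeral_2_eq_2)
  show ?thesis
    using DERIV_chain2[OF 2 1] by (simp add: bump_def bump1_def)
qed

lemma bump1_line_derivative:
  "((\<lambda>s. bump1 r e q (x + s *\<^sub>R e)) has_real_derivative bump2 r e q (x + s *\<^sub>R e)) (at s)"
proof -
  have 1: "((\<lambda>s. r\<^sup>2 - (norm (x + s *\<^sub>R e - q))\<^sup>2) has_real_derivative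
      - 2 * ((x + s *\<^sub>R e - q) \<bullet> e)) (at s)"
    using DERIV_diff[OF DERIV_const[of "r\<^sup>2"] GDERIV_line[OF GDERIV_norm_power2]]
    by simp
  have 2: "(flat 2 has_real_derivative flat 4 y - 2 * flat 3 y) (at y)" for y
    using flat_derivative[of 2 y] by (simp add: numeral_eq_Suc)
  have 3: "((\<lambda>s. - 2 * ((x + s *\<^sub>R e - q) \<bullet> e)) has_real_derivative - 2 * (e \<bullet> e)) (at s)"
    by (auto intro!: derivative_eq_intros simp: inner_add_left inner_diff_left)
  show ?thesis
    using DERIV_mult[OF DERIV_chain2[OF 2 1] 3]
    by (simp add: bump1_def[abs_def] bump2_def power2_eq_square algebra_simps)
qed

lemma continuous_bump [continuous_intros]:
  "continuous_on A f \<Longrightarrow> continuous_on A g \<Longrightarrow> continuous_on A (\<lambda>x. bump r (f x) (g x))"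
  "continuous_on A f \<Longrightarrow> continuous_on A g \<Longrightarrow> continuous_on A (\<lambda>x. bump1 r e (f x) (g x))"
  "continuous_on A f \<Longrightarrow> continuous_on A g \<Longrightarrow> continuous_on A (\<lambda>x. bump2 r e (f x) (g x))"
  unfolding bump_def bump1_def bump2_def
  by (intro continuous_intros continuous_on_compose2[OF flat_continuous[of UNIV]]; simp)+

lemma bump12_eq_0:
  assumes "r > 0" "x \<notin> ball q r"
  shows "bump1 r e q x = 0" "bump2 r e q x = 0"
proof -
  have "r\<^sup>2 \<le> (norm (x - q))\<^sup>2"
    using assms by (simp add: dist_norm norm_minus_commute not_less power_mono)
  then show "bump1 r e q x = 0" "bump2 r e q x = 0"
    by (simp_all add: bump1_def bump2_def flat_def)
qed

lemma test_function_bump: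
  assumes "r > 0" "cball q r \<subseteq> W"
  shows "test_function (bump r q) W"
  unfolding test_function_def smooth_on_def
  using assms by (auto intro!: Ck_on_bump bump_eq_0 exI[of _ "cball q r"])

lemma deriv_bump_time:
  "deriv (\<lambda>s. bump r q (y, s)) t = bump1 r (0, 1) q (y, t)"
  using bump_line_derivative[of r q "(y, 0)" "(0, 1)" t]
  by (intro DERIV_imp_deriv) simp

lemma laplacian_bump:
  "laplacian (\<lambda>y. bump r q (y, t)) x = (\<Sum>i\<in>Basis. bump2 r (i, 0) q (x, t))"
proof -
  have "(deriv ^^ 2) (\<lambda>s. bump r q (x + s *\<^sub>R i, t)) 0 = bump2 r (i, 0) q (x, t)" for i
  proof -
    have "deriv (\<lambda>s. bump r q (x + s *\<^sub>R i, t)) = (\<lambda>s. bump1 r (i, 0) q (x + s *\<^sub>R i, t))"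
      using bump_line_derivative[of r q "(x, t)" "(i, 0)"]
      by (intro ext DERIV_imp_deriv) simp
    moreover have "deriv (\<lambda>s. bump1 r (i, 0) q (x + s *\<^sub>R i, t)) 0 = bump2 r (i, 0) q (x, t)"
      using bump1_line_derivative[of r "(i, 0)" q "(x, t)" 0]
      by (intro DERIV_imp_deriv) simp
    ultimately show ?thesis
      by (simp add: numeral_2_eq_2)
  qed
  then show ?thesis
    by (simp add: laplacian_def)
qed

text \<open>Trades the Lebesgue integrals of the weak formulation for integrals over a box, where
  differentiation under the integral sign is carried out.\<close>

lemma set_integral_supported_cbox:
  fixes g :: "'a::euclidean_space \<Rightarrow> real"
  assumes "cbox a b \<subseteq> U" "continuous_on (cbox a b) g" "\<And>z. z \<notin> cbox a b \<Longrightarrow> g z = 0"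
  shows "(LINT z:U|lborel. g z) = integral (cbox a b) g"
proof -
  have "(LINT z:U|lborel. g z) = (LINT z:cbox a b|lborel. g z)"
    unfolding set_lebesgue_integral_def
    using assms by (intro Bochner_Integration.integral_cong) (auto simp: indicator_def)
  also have "\<dots> = integral (cbox a b) g"
    using borel_integrable_compact[OF compact_cbox assms(2)]
    by (intro set_borel_integral_eq_integral) (simp add: set_integrable_def)
  finally show ?thesis .
qed

text \<open>Translation invariance of Lebesgue measure: one constant normalises the bumps at all
  centres.\<close>

lemma integral_bump_eq:
  fixes q :: "'a::euclidean_space"
  assumes "r > 0" "cball q r \<subseteq> cbox a b"
  shows "integral (cbox a b) (bump r q) = (LINT z|lborel. bump r (0::'a) z)"
proof -
  have "integral (cbox a b) (bump r q) = (LINT z|lborel. bump r q z)"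
  proof -
    have "bump r q z = 0" if "z \<notin> cbox a b" for z
      using that assms ball_subset_cball by (intro bump_eq_0) blast+
    then show ?thesis
      using set_integral_supported_cbox[of a b UNIV "bump r q"]
      by (simp add: set_lebesgue_integral_def continuous_intros)
  qed
  also have "\<dots> = (LINT z|distr lborel borel ((+) q). bump r q z)"
    by (simp add: lborel_distr_plus)
  also have "\<dots> = (LINT z|lborel. bump r q (q + z))"
    by (intro integral_distr) (auto intro!: borel_measurable_continuous_onI continuous_intros)
  finally show ?thesis
    by (simp add: bump_def)
qed

text \<open>A nonnegative continuous function with integral 0 over a box vanishes on it, but the
  bump is positive at its centre.\<close>

lemma integral_bump_pos:
  assumes "r > 0"
  shows "(LINT z|lborel. bump r (0::'a::euclidean_space) z) > 0"
proof -
  obtain a b :: 'a where ab: "cball 0 r \<subseteq> cbox a b"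
    using bounded_subset_cbox_symmetric[OF bounded_cball] by metis
  have b: "box a b \<noteq> {}"
  proof -
    have "interior (cball 0 r) \<subseteq> box a b"
      using interior_mono[OF ab] by simp
    moreover have "(0::'a) \<in> interior (cball 0 r)"
      using assms by simp
    ultimately show ?thesis
      by blast
  qed
  have "integral (cbox a b) (bump r (0::'a)) \<noteq> 0"
  proof
    assume "integral (cbox a b) (bump r (0::'a)) = 0"
    then have "(bump r (0::'a) has_integral 0) (cbox a b)"
      using integrable_integral[OF integrable_continuous[of a b "bump r (0::'a)"]]
      by (simp add: continuous_intros)
    then have "bump r (0::'a) 0 = 0"
      using b ab assms
      by (intro has_integral_0_cbox_imp_0[of a b "bump r 0"])
         (auto intro!: continuous_intros bump_nonneg simp: subset_iff)
    with bump_pos[OF assms, of 0 "0::'a"] assms show False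
      by simp
  qed
  moreover have "integral (cbox a b) (bump r (0::'a)) \<ge> 0"
    by (intro integral_nonneg integrable_continuous continuous_intros) (rule bump_nonneg)
  ultimately have "integral (cbox a b) (bump r (0::'a)) > 0"
    by (simp add: less_le)
  then show ?thesis
    by (simp only: integral_bump_eq[OF assms ab])
qed

lemma DERIV_integral_parameter:
  fixes W :: "'a::euclidean_space \<Rightarrow> real" and P Q :: "real \<Rightarrow> 'a \<Rightarrow> real"
  assumes W: "continuous_on (cbox a b) W"
    and P: "\<And>s z. ((\<lambda>s. P s z) has_real_derivative Q s z) (at s)"
    and cP: "continuous_on UNIV (\<lambda>(s, z). P s z)"
    and cQ: "continuous_on UNIV (\<lambda>(s, z). Q s z)"
  shows "((\<lambda>s. integral (cbox a b) (\<lambda>z. W z * P s z)) has_real_derivative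
           integral (cbox a b) (\<lambda>z. W z * Q s z)) (at s)"
proof (rule leibniz_rule_field_derivative[where U = UNIV, simplified])
  show "((\<lambda>s. W z * P s z) has_real_derivative W z * Q s z) (at s)" for s z
    by (rule DERIV_cmult[OF P])
  show "(\<lambda>z. W z * P s z) integrable_on cbox a b" for s
  proof (intro integrable_continuous continuous_on_mult W)
    have "continuous_on (cbox a b) (\<lambda>z. (s, z))"
      by (intro continuous_intros)
    then show "continuous_on (cbox a b) (P s)"
      using continuous_on_compose2[OF cP, of "cbox a b" "\<lambda>z. (s, z)"] by simp
  qed
  show "continuous_on (UNIV \<times> cbox a b) (\<lambda>(s, z). W z * Q s z)"
    using continuous_on_subset[OF cQ, of "UNIV \<times> cbox a b"]
      continuous_on_compose2[OF W continuous_on_snd[OF continuous_on_id], of "UNIV \<times> cbox a b"]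
    by (auto simp: split_def intro!: continuous_intros)
qed

definition mollify :: "'a::euclidean_space \<Rightarrow> 'a \<Rightarrow> real \<Rightarrow> real \<Rightarrow> ('a \<Rightarrow> real) \<Rightarrow> 'a \<Rightarrow> real" where
  "mollify a b c r W z = integral (cbox a b) (\<lambda>y. W y * bump r z y) / c"

text \<open>The mollified value is an average of \<open>W\<close> with nonnegative weights supported
  where \<open>W\<close> differs from \<open>W z\<close> by at most \<open>e\<close>.\<close>

lemma mollification_error:
  fixes W :: "'a::euclidean_space \<Rightarrow> real"
  assumes W: "continuous_on (cbox a b) W" and r: "r > 0" "cball z r \<subseteq> cbox a b"
    and c: "c = (LINT z|lborel. bump r (0::'a) z)"
    and d: "\<And>y. y \<in> cbox a b \<Longrightarrow> dist y z < r \<Longrightarrow> \<bar>W y - W z\<bar> \<le> e"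
  shows "\<bar>integral (cbox a b) (\<lambda>y. W y * bump r z y) / c - W z\<bar> \<le> e"
proof -
  have cpos: "c > 0"
    using integral_bump_pos[OF r(1)] c by simp
  have int: "(\<lambda>y. W y * bump r z y) integrable_on cbox a b" "bump r z integrable_on cbox a b"
    by (auto intro!: integrable_continuous continuous_intros W)
  have cb: "integral (cbox a b) (bump r z) = c"
    using integral_bump_eq[OF r] c by simp
  have "integral (cbox a b) (\<lambda>y. (W y - W z) * bump r z y)
      = integral (cbox a b) (\<lambda>y. W y * bump r z y) - W z * c"
    using integral_diff[OF int(1) integrable_on_cmult_left[OF int(2), of "W z"]]
    by (simp add: left_diff_distrib cb)
  moreover have "norm (integral (cbox a b) (\<lambda>y. (W y - W z) * bump r z y))
      \<le> integral (cbox a b) (\<lambda>y. e * bump r z y)"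
  proof (rule integral_norm_bound_integral)
    show "(\<lambda>y. (W y - W z) * bump r z y) integrable_on cbox a b"
      by (auto intro!: integrable_continuous continuous_intros W)
    show "(\<lambda>y. e * bump r z y) integrable_on cbox a b"
      by (auto intro!: integrable_continuous continuous_intros)
    show "norm ((W y - W z) * bump r z y) \<le> e * bump r z y" if "y \<in> cbox a b" for y
    proof (cases "dist y z < r")
      case True
      then show ?thesis
        using d[OF that True] bump_nonneg[of r z y] by (simp add: abs_mult mult_right_mono)
    next
      case False
      then show ?thesis
        using bump_eq_0[OF r(1), of y z] by (simp add: dist_commute)
    qed
  qed
  ultimately have "\<bar>integral (cbox a b) (\<lambda>y. W y * bump r z y) - W z * c\<bar> \<le> e * c"
    by (simp add: cb)
  then have "\<bar>(integral (cbox a b) (\<lambda>y. W y * bump r z y) - W z * c) / c\<bar> \<le> e"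
    using cpos by (simp add: abs_div divide_le_eq)
  then show ?thesis
    using cpos by (simp add: diff_divide_distrib)
qed

text \<open>The weak equation is tested with the bump centred at \<open>z\<close>. When the
  derivatives are moved to the centre, the sign change of \<open>bump1\<close> cancels the minus
  sign of the weak formulation, while the second derivatives keep their sign.\<close>

lemma mollification_classical_heat:
  fixes w h :: "'a::euclidean_space \<Rightarrow> real \<Rightarrow> real"
  assumes eq: "heat_equation_distributional \<Omega> I w h"
    and ab: "cbox a b \<subseteq> \<Omega> \<times> I"
    and W: "continuous_on (cbox a b) (\<lambda>(x, t). w x t)"
    and Hc: "continuous_on (cbox a b) (\<lambda>(x, t). h x t)"
    and r: "r > 0" "cball z r \<subseteq> cbox a b"
  shows "classical_heat (mollify a b c r (\<lambda>(x, t). w x t)) (mollify a b c r (\<lambda>(x, t). h x t)) z"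
proof -
  define V where "V = (\<lambda>(x, t). w x t)"
  define K where "K = (\<lambda>(x, t). h x t)"
  have cV: "continuous_on (cbox a b) V" and cK: "continuous_on (cbox a b) K"
    using W Hc by (simp_all add: V_def K_def)
  let ?J = "\<lambda>g. integral (cbox a b) (\<lambda>y. V y * g y)"
  obtain x t where z: "z = (x, t)" by (cases z)
  have d1: "((\<lambda>s. ?J (bump r (z + s *\<^sub>R e))) has_real_derivative ?J (\<lambda>y. bump1 r e y (z + s *\<^sub>R e))) (at s)"
    for z e s
    by (rule DERIV_integral_parameter[OF cV])
       (use bump_line_derivative[of r _ z e] in
         \<open>auto simp: bump_commute[of r "z + _ *\<^sub>R e"] split_def intro!: continuous_intros\<close>)
  have d2: "((\<lambda>s. ?J (\<lambda>y. bump1 r e y (z + s *\<^sub>R e))) has_real_derivative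
      ?J (\<lambda>y. bump2 r e y (z + s *\<^sub>R e))) (at s)" for z e s
    by (rule DERIV_integral_parameter[OF cV])
       (auto intro!: continuous_intros bump1_line_derivative simp: split_def)
  have D2: "has_D2 (\<lambda>s. ?J (bump r (z + s *\<^sub>R e)) / c) (?J (\<lambda>y. bump2 r e y z) / c)" for e
    unfolding has_D2_def
    using DERIV_cdivide[OF d1[of z e], of c] DERIV_cdivide[OF d2[of e z 0], of c]
    by (intro exI[of _ "\<lambda>s. ?J (\<lambda>y. bump1 r e y (z + s *\<^sub>R e)) / c"]) simp
  have time: "((\<lambda>s. ?J (bump r (x, s)) / c) has_real_derivative ?J (\<lambda>y. bump1 r (0, 1) y z) / c) (at t)"
    using DERIV_cdivide[OF d1[of "(x, 0)" "(0, 1)" t], of c] by (simp add: z)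
  have zero: "bump r z y = 0" "bump1 r e z y = 0" "bump2 r e z y = 0" if "y \<notin> cbox a b" for y e
  proof -
    have "y \<notin> ball z r" using r that ball_subset_cball by blast
    then show "bump r z y = 0" "bump1 r e z y = 0" "bump2 r e z y = 0"
      using r by (simp_all add: bump_eq_0 bump12_eq_0)
  qed
  have "test_function (bump r z) (\<Omega> \<times> I)"
    using test_function_bump[OF r(1)] r(2) ab by blast
  then have "- (LINT (x, t) : \<Omega> \<times> I | lborel. w x t * deriv (\<lambda>s. bump r z (x, s)) t) =
          (LINT (x, t) : \<Omega> \<times> I | lborel.
             w x t * laplacian (\<lambda>y. bump r z (y, t)) x + h x t * bump r z (x, t))"
    using eq unfolding heat_equation_distributional_def by blast
  then have "- (LINT y : \<Omega> \<times> I | lborel. V y * bump1 r (0, 1) z y) =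
      (LINT y : \<Omega> \<times> I | lborel. V y * (\<Sum>i\<in>Basis. bump2 r (i, 0) z y) + K y * bump r z y)"
    by (simp add: deriv_bump_time laplacian_bump V_def K_def split_def)
  also have "(LINT y : \<Omega> \<times> I | lborel. V y * bump1 r (0, 1) z y) = ?J (bump1 r (0, 1) z)"
    by (rule set_integral_supported_cbox[OF ab]) (auto intro!: continuous_intros cV simp: zero)
  also have "(LINT y : \<Omega> \<times> I | lborel. V y * (\<Sum>i\<in>Basis. bump2 r (i, 0) z y) + K y * bump r z y)
     = integral (cbox a b) (\<lambda>y. V y * (\<Sum>i\<in>Basis. bump2 r (i, 0) z y) + K y * bump r z y)"
    by (rule set_integral_supported_cbox[OF ab]) (auto intro!: continuous_intros cV cK simp: zero)
  also have "\<dots> = (\<Sum>i\<in>Basis. ?J (bump2 r (i, 0) z)) + integral (cbox a b) (\<lambda>y. K y * bump r z y)"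
    by (simp add: sum_distrib_left, subst integral_add)
       (auto intro!: integrable_continuous continuous_intros cV cK integral_sum)
  also have "- ?J (bump1 r (0, 1) z) = ?J (\<lambda>y. bump1 r (0, 1) y z)"
    by (simp add: bump1_commute[of r _ z])
  also have "(\<lambda>i. ?J (bump2 r (i, 0) z)) = (\<lambda>i. ?J (\<lambda>y. bump2 r (i, 0) y z))"
    by (simp add: bump2_commute[of r _ z])
  finally have key: "?J (\<lambda>y. bump1 r (0, 1) y z) / c =
      (\<Sum>i\<in>Basis. ?J (\<lambda>y. bump2 r (i, 0) y z) / c) + integral (cbox a b) (\<lambda>y. K y * bump r z y) / c"
    by (simp add: add_divide_distrib sum_divide_distrib)
  have "has_D2 (\<lambda>s. ?J (bump r (x + s *\<^sub>R i, t)) / c) (?J (\<lambda>y. bump2 r (i, 0) y z) / c)" for i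
    using D2[of "(i, 0)"] by (simp add: z)
  then have "has_laplacian (\<lambda>y. ?J (bump r (y, t)) / c) x (\<Sum>i\<in>Basis. ?J (\<lambda>y. bump2 r (i, 0) y z) / c)"
    unfolding has_laplacian_def
    by (intro exI[of _ "\<lambda>i. ?J (\<lambda>y. bump2 r (i, 0) y z) / c"]) simp
  then have "classical_heat (\<lambda>z. ?J (bump r z) / c) (\<lambda>z. integral (cbox a b) (\<lambda>y. K y * bump r z y) / c) z"
    unfolding classical_heat_def using time key by (auto simp: z)
  then show ?thesis by (simp add: V_def K_def mollify_def[abs_def])
qed

lemma mollification_uniform:
  fixes W :: "'a::euclidean_space \<Rightarrow> real"
  assumes W: "continuous_on (cbox a b) W" and e: "e > 0"
  obtains d where "d > 0" "\<And>r z. 0 < r \<Longrightarrow> r \<le> d \<Longrightarrow> cball z r \<subseteq> cbox a b \<Longrightarrow>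
    \<bar>mollify a b (LINT z|lborel. bump r (0::'a) z) r W z - W z\<bar> < e"
proof -
  obtain d where d: "d > 0" "\<And>x y. x \<in> cbox a b \<Longrightarrow> y \<in> cbox a b \<Longrightarrow> dist y x < d \<Longrightarrow>
      dist (W y) (W x) < e / 2"
    using compact_uniformly_continuous[OF W compact_cbox, unfolded uniformly_continuous_on_def,
        rule_format, of "e / 2"] \<open>e > 0\<close> half_gt_zero by blast
  have "\<bar>mollify a b (LINT z|lborel. bump r (0::'a) z) r W z - W z\<bar> < e"
    if r: "0 < r" "r \<le> d" "cball z r \<subseteq> cbox a b" for r z
  proof -
    have "z \<in> cbox a b" using r by auto
    then have "\<bar>mollify a b (LINT z|lborel. bump r (0::'a) z) r W z - W z\<bar> \<le> e / 2"
      unfolding mollify_def using d(2)[of z] r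
      by (intro mollification_error[OF W r(1,3) refl]) (fastforce simp: dist_real_def)
    then show ?thesis using e by simp
  qed
  with d(1) show thesis by (rule that)
qed

lemma distributional_imp_approx_heat:
  fixes w h :: "'a::euclidean_space \<Rightarrow> real \<Rightarrow> real"
  assumes eq: "heat_equation_distributional \<Omega> I w h" and "open \<Omega>" "open I"
    and W: "continuous_on (\<Omega> \<times> I) (\<lambda>(x, t). w x t)"
    and Hc: "continuous_on (\<Omega> \<times> I) (\<lambda>(x, t). h x t)"
  shows "approx_heat (\<Omega> \<times> I) (\<lambda>(x, t). w x t) (\<lambda>(x, t). h x t)"
  unfolding approx_heat_def
proof
  let ?W = "\<lambda>(x, t). w x t" and ?H = "\<lambda>(x, t). h x t"
  fix z assume z: "z \<in> \<Omega> \<times> I"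
  have "open (\<Omega> \<times> I)" using assms by (simp add: open_Times)
  then obtain a b where ab: "cbox a b \<subseteq> \<Omega> \<times> I" "z \<in> box a b"
    using open_contains_cbox z by metis
  obtain r where r: "r > 0" "cball z r \<subseteq> box a b"
    using ab(2) open_contains_cball open_box by metis
  have sub: "cball y (r / 2) \<subseteq> cbox a b" if "y \<in> cball z (r / 2)" for y
  proof
    fix u assume "u \<in> cball y (r / 2)"
    with that have "dist z u \<le> r"
      using dist_triangle[of z u y] by simp
    then show "u \<in> cbox a b"
      using r(2) box_subset_cbox[of a b] by auto
  qed
  have cW: "continuous_on (cbox a b) ?W" and cH: "continuous_on (cbox a b) ?H"
    using W Hc ab continuous_on_subset by blast+
  have "heat_approximable (cball z (r / 2)) ?W ?H"
    unfolding heat_approximable_def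
  proof (intro allI impI)
    fix e :: real assume e: "e > 0"
    obtain d1 where d1: "d1 > 0" "\<And>r z. 0 < r \<Longrightarrow> r \<le> d1 \<Longrightarrow> cball z r \<subseteq> cbox a b \<Longrightarrow>
        \<bar>mollify a b (LINT z|lborel. bump r (0::'a \<times> real) z) r ?W z - ?W z\<bar> < e"
      using mollification_uniform[OF cW e] by metis
    obtain d2 where d2: "d2 > 0" "\<And>r z. 0 < r \<Longrightarrow> r \<le> d2 \<Longrightarrow> cball z r \<subseteq> cbox a b \<Longrightarrow>
        \<bar>mollify a b (LINT z|lborel. bump r (0::'a \<times> real) z) r ?H z - ?H z\<bar> < e"
      using mollification_uniform[OF cH e] by metis
    \<comment> \<open>The bound \<open>r / 2\<close> keeps the supports of all bumps centred in the
      half ball inside the box; \<open>d1\<close> and \<open>d2\<close> control the errors of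
      \<open>w\<close> and \<open>h\<close>.\<close>
    define \<eta> where "\<eta> = min (r / 2) (min d1 d2)"
    have \<eta>: "\<eta> > 0" "\<eta> \<le> r / 2" "\<eta> \<le> d1" "\<eta> \<le> d2"
      using r d1(1) d2(1) by (auto simp: \<eta>_def)
    define c where "c = (LINT z|lborel. bump \<eta> (0::'a \<times> real) z)"
    have c: "c > 0" using integral_bump_pos[OF \<eta>(1)] by (simp add: c_def)
    have "continuous_on (cball z (r / 2)) (\<lambda>z. integral (cbox a b) (\<lambda>y. ?W y * bump \<eta> z y))"
      using continuous_on_compose2[OF cW continuous_on_snd[OF continuous_on_id],
          of "cball z (r / 2) \<times> cbox a b"]
      by (intro integral_continuous_on_param) (auto simp: split_def intro!: continuous_intros)
    then have cm: "continuous_on (cball z (r / 2)) (mollify a b c \<eta> ?W)"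
      unfolding mollify_def[abs_def] using c by (auto intro!: continuous_intros)
    have s: "cball y \<eta> \<subseteq> cbox a b" if "y \<in> cball z (r / 2)" for y
      using sub[OF that] \<eta>(2) by (meson order_trans subset_cball)
    show "\<exists>w' h'. continuous_on (cball z (r / 2)) w' \<and> (\<forall>y\<in>cball z (r / 2).
        \<bar>w' y - ?W y\<bar> < e \<and> \<bar>h' y - ?H y\<bar> < e \<and> classical_heat w' h' y)"
      using cm d1(2)[OF \<eta>(1,3) s] d2(2)[OF \<eta>(1,4) s]
        mollification_classical_heat[OF eq ab(1) cW cH \<eta>(1) s]
      by (intro exI[of _ "mollify a b c \<eta> ?W"] exI[of _ "mollify a b c \<eta> ?H"]) (simp add: c_def)
  qed
  moreover have "cball z (r / 2) \<subseteq> \<Omega> \<times> I"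
    using sub[of z] r ab(1) by auto
  ultimately show "\<exists>r>0. cball z r \<subseteq> \<Omega> \<times> I \<and> heat_approximable (cball z r) ?W ?H"
    using r(1) by (intro exI[of _ "r / 2"]) simp
qed

subsection \<open>Comparison principle\<close>


lemma has_D2_add:
  assumes "has_D2 f d" "has_D2 g e"
  shows "has_D2 (\<lambda>s. f s + g s) (d + e)"
proof -
  obtain f' where f: "\<forall>\<^sub>F s in nhds 0. (f has_real_derivative f' s) (at s)"
    "(f' has_real_derivative d) (at 0)"
    using assms(1) by (auto simp: has_D2_def)
  obtain g' where g: "\<forall>\<^sub>F s in nhds 0. (g has_real_derivative g' s) (at s)"
    "(g' has_real_derivative e) (at 0)"
    using assms(2) by (auto simp: has_D2_def)
  have "\<forall>\<^sub>F s in nhds 0. ((\<lambda>s. f s + g s) has_real_derivative f' s + g' s) (at s)"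
    using f(1) g(1) by eventually_elim (rule DERIV_add)
  then show ?thesis
    unfolding has_D2_def using DERIV_add[OF f(2) g(2)]
    by (intro exI[of _ "\<lambda>s. f' s + g' s"] conjI)
qed

lemma has_D2_cmult:
  assumes "has_D2 f d"
  shows "has_D2 (\<lambda>s. c * f s) (c * d)"
proof -
  obtain f' where f: "\<forall>\<^sub>F s in nhds 0. (f has_real_derivative f' s) (at s)"
    "(f' has_real_derivative d) (at 0)"
    using assms(1) by (auto simp: has_D2_def)
  have "\<forall>\<^sub>F s in nhds 0. ((\<lambda>s. c * f s) has_real_derivative c * f' s) (at s)"
    using f(1) by eventually_elim (rule DERIV_cmult)
  then show ?thesis
    unfolding has_D2_def using DERIV_cmult[OF f(2)]
    by (intro exI[of _ "\<lambda>s. c * f' s"] conjI)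
qed

lemma has_D2I:
  assumes "\<And>s. (f has_real_derivative f' s) (at s)" "(f' has_real_derivative d) (at 0)"
  shows "has_D2 f d"
  unfolding has_D2_def using assms by (intro exI[of _ f'] conjI always_eventually allI)

lemma has_D2_const: "has_D2 (\<lambda>s. c) 0"
  by (rule has_D2I[of _ "\<lambda>_. 0"]) auto

lemma has_D2_norm_power2: "has_D2 (\<lambda>s. (norm (z + s *\<^sub>R e - q))\<^sup>2) (2 * (e \<bullet> e))"
proof (rule has_D2I)
  show "((\<lambda>s. (norm (z + s *\<^sub>R e - q))\<^sup>2) has_real_derivative (2 *\<^sub>R (z + s *\<^sub>R e - q)) \<bullet> e) (at s)" for s
    by (rule GDERIV_line[OF GDERIV_norm_power2])
  show "((\<lambda>s. (2 *\<^sub>R (z + s *\<^sub>R e - q)) \<bullet> e) has_real_derivative 2 * (e \<bullet> e)) (at 0)"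
    unfolding inner_scaleR_left inner_add_left inner_diff_left
    by (auto intro!: derivative_eq_intros)
qed

text \<open>If \<open>d > 0\<close>, then \<open>f'\<close>, which vanishes at 0, is positive just
  to the right of 0, and the mean value theorem makes \<open>f\<close> exceed \<open>f 0\<close>
  there.\<close>

lemma has_D2_local_max:
  assumes "has_D2 f d" "\<delta> > 0" "\<And>s. \<bar>s\<bar> < \<delta> \<Longrightarrow> f s \<le> f 0"
  shows "d \<le> 0"
proof (rule ccontr)
  assume "\<not> d \<le> 0"
  then have d: "d > 0" by simp
  obtain f' where f: "\<forall>\<^sub>F s in nhds 0. (f has_real_derivative f' s) (at s)"
    "(f' has_real_derivative d) (at 0)"
    using assms(1) by (auto simp: has_D2_def)
  obtain r where r: "r > 0" "\<And>s. \<bar>s\<bar> < r \<Longrightarrow> (f has_real_derivative f' s) (at s)"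
    using f(1) by (auto simp: eventually_nhds_metric dist_real_def)
  have "f' 0 = 0"
    by (rule DERIV_local_max[OF r(2) assms(2)]) (use r(1) assms(3) in auto)
  obtain k where k: "k > 0" "\<And>h. 0 < h \<Longrightarrow> h < k \<Longrightarrow> f' 0 < f' (0 + h)"
    using DERIV_pos_inc_right[OF f(2) d] by blast
  define s where "s = min (min \<delta> r) k / 2"
  have s: "s > 0" "s < \<delta>" "s < r" "\<And>h. 0 < h \<Longrightarrow> h \<le> s \<Longrightarrow> f' h > 0"
  proof -
    show "s > 0" "s < \<delta>" "s < r"
      using assms(2) r(1) k(1) by (simp_all add: s_def)
    show "f' h > 0" if "0 < h" "h \<le> s" for h
    proof -
      have "h < k" using that k(1) assms(2) r(1) by (simp add: s_def)
      with k(2)[OF that(1)] \<open>f' 0 = 0\<close> show ?thesis by simp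
    qed
  qed
  have "\<exists>z>0. z < s \<and> f s - f 0 = (s - 0) * f' z"
    using s r by (intro MVT2) auto
  then obtain z where z: "0 < z" "z < s" "f s - f 0 = s * f' z" by auto
  have "s * f' z > 0"
    using s(1) s(4)[of z] z by simp
  with assms(3)[of s] s z show False by simp
qed

lemma has_laplacian_add:
  assumes "has_laplacian f x L" "has_laplacian g x M"
  shows "has_laplacian (\<lambda>y. f y + g y) x (L + M)"
proof -
  obtain d where d: "\<forall>i\<in>Basis. has_D2 (\<lambda>s. f (x + s *\<^sub>R i)) (d i)" "L = (\<Sum>i\<in>Basis. d i)"
    using assms(1) by (auto simp: has_laplacian_def)
  obtain e where e: "\<forall>i\<in>Basis. has_D2 (\<lambda>s. g (x + s *\<^sub>R i)) (e i)" "M = (\<Sum>i\<in>Basis. e i)"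
    using assms(2) by (auto simp: has_laplacian_def)
  show ?thesis unfolding has_laplacian_def
    using d e by (intro exI[of _ "\<lambda>i. d i + e i"]) (auto simp: sum.distrib intro: has_D2_add)
qed

lemma has_laplacian_cmult:
  assumes "has_laplacian f x L"
  shows "has_laplacian (\<lambda>y. c * f y) x (c * L)"
proof -
  obtain d where d: "\<forall>i\<in>Basis. has_D2 (\<lambda>s. f (x + s *\<^sub>R i)) (d i)" "L = (\<Sum>i\<in>Basis. d i)"
    using assms(1) by (auto simp: has_laplacian_def)
  show ?thesis unfolding has_laplacian_def
    using d by (intro exI[of _ "\<lambda>i. c * d i"]) (auto simp: sum_distrib_left intro: has_D2_cmult)
qed

lemma has_laplacian_const: "has_laplacian (\<lambda>y. c) x 0"
  unfolding has_laplacian_def by (intro exI[of _ "\<lambda>i. 0"]) (auto intro: has_D2_const)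

lemma has_laplacian_norm_power2:
  "has_laplacian (\<lambda>x. (norm (x - q))\<^sup>2) (x::'a::euclidean_space) (2 * real DIM('a))"
  unfolding has_laplacian_def
  by (intro exI[of _ "\<lambda>i. 2 * (i \<bullet> i)"] conjI ballI has_D2_norm_power2) simp

lemma classical_heat_add:
  "classical_heat v h z \<Longrightarrow> classical_heat w k z \<Longrightarrow>
     classical_heat (\<lambda>z. v z + w z) (\<lambda>z. h z + k z) z"
  unfolding classical_heat_def
proof (elim exE conjE)
  fix L M
  assume *: "has_laplacian (\<lambda>y. v (y, snd z)) (fst z) L"
    "has_laplacian (\<lambda>y. w (y, snd z)) (fst z) M"
    and d: "((\<lambda>s. v (fst z, s)) has_real_derivative L + h z) (at (snd z))"
    "((\<lambda>s. w (fst z, s)) has_real_derivative M + k z) (at (snd z))"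
  have "L + h z + (M + k z) = L + M + (h z + k z)" by simp
  note d' = DERIV_add[OF d, unfolded this]
  show "\<exists>L. has_laplacian (\<lambda>y. v (y, snd z) + w (y, snd z)) (fst z) L \<and>
    ((\<lambda>s. v (fst z, s) + w (fst z, s)) has_real_derivative L + (h z + k z)) (at (snd z))"
    by (intro exI[of _ "L + M"] conjI has_laplacian_add * d')
qed

lemma classical_heat_cmult:
  "classical_heat v h z \<Longrightarrow> classical_heat (\<lambda>z. c * v z) (\<lambda>z. c * h z) z"
  unfolding classical_heat_def
proof (elim exE conjE)
  fix L
  assume *: "has_laplacian (\<lambda>y. v (y, snd z)) (fst z) L"
    and d: "((\<lambda>s. v (fst z, s)) has_real_derivative L + h z) (at (snd z))"
  show "\<exists>L. has_laplacian (\<lambda>y. c * v (y, snd z)) (fst z) L \<and>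
    ((\<lambda>s. c * v (fst z, s)) has_real_derivative L + c * h z) (at (snd z))"
    by (intro exI[of _ "c * L"] conjI has_laplacian_cmult * DERIV_cmult[OF d, of c, unfolded distrib_left])
qed

lemma classical_heat_time:
  assumes "(g has_real_derivative g' (snd z)) (at (snd z))"
  shows "classical_heat (\<lambda>z. g (snd z)) (\<lambda>z. g' (snd z)) z"
  unfolding classical_heat_def using assms
  by (intro exI[of _ 0]) (auto intro: has_laplacian_const)

lemma classical_heat_space:
  assumes "has_laplacian g (fst z) (L (fst z))"
  shows "classical_heat (\<lambda>z. g (fst z)) (\<lambda>z. - L (fst z)) z"
  unfolding classical_heat_def using assms by auto

text \<open>This space-time paraboloid is the penalty used to localise a maximum; its source is its
  time derivative minus its spatial Laplacian.\<close>

lemma classical_heat_norm_power2: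
  "classical_heat (\<lambda>z. (norm (z - q))\<^sup>2)
     (\<lambda>z. 2 * (snd z - snd q) - 2 * real DIM('a)) (z :: 'a::euclidean_space \<times> real)"
proof -
  have *: "(norm (z - q))\<^sup>2 = (norm (fst z - fst q))\<^sup>2 + (snd z - snd q)\<^sup>2" for z :: "'a \<times> real"
    by (simp add: norm_prod_def)
  have "((\<lambda>t. (t - snd q)\<^sup>2) has_real_derivative 2 * (t - snd q)) (at t)" for t
    by (auto intro!: derivative_eq_intros)
  from classical_heat_add[OF classical_heat_space[OF has_laplacian_norm_power2[of "fst q" "fst z"]]
      classical_heat_time[where g' = "\<lambda>t. 2 * (t - snd q)", OF this]]
  show ?thesis
    unfolding * by (simp add: algebra_simps)
qed

text \<open>At an interior maximum the time derivative is 0 and the Laplacian is at most 0; the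
  source is their difference.\<close>

lemma classical_heat_local_max:
  assumes "classical_heat w h z" "\<delta> > 0" "\<And>y. y \<in> ball z \<delta> \<Longrightarrow> w y \<le> w z"
  shows "h z \<ge> 0"
proof -
  obtain x t where z: "z = (x, t)" by (cases z)
  obtain d where d: "\<forall>i\<in>Basis. has_D2 (\<lambda>s. w (x + s *\<^sub>R i, t)) (d i)"
    "((\<lambda>s. w (x, s)) has_real_derivative (\<Sum>i\<in>Basis. d i) + h z) (at t)"
    using assms(1) by (auto simp: classical_heat_def has_laplacian_def z)
  have "d i \<le> 0" if "i \<in> Basis" for i
    by (rule has_D2_local_max[OF d(1)[rule_format, OF that] assms(2)])
       (use assms(3) that in \<open>auto simp: z dist_prod_def dist_norm\<close>)
  then have "(\<Sum>i\<in>Basis. d i) \<le> 0"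
    by (rule sum_nonpos)
  moreover have "(\<Sum>i\<in>Basis. d i) + h z = 0"
    by (rule DERIV_local_max[OF d(2) assms(2)])
       (use assms(3) in \<open>auto simp: z dist_prod_def dist_real_def\<close>)
  ultimately show ?thesis by simp
qed

text \<open>The maximum of \<open>W - \<Psi>\<close> at \<open>z0\<close> cannot be differentiated
  directly. Subtracting a small paraboloid makes it strict, so a close classical approximant also
  has an interior maximum near \<open>z0\<close>; there the sign of the source is known, up to
  errors that the assumed gap between \<open>P z0\<close> and \<open>H z0\<close> absorbs.\<close>

lemma approx_heat_touching:
  fixes W \<Psi> :: "'a::euclidean_space \<times> real \<Rightarrow> real"
  assumes W: "approx_heat V W H" and z0: "z0 \<in> V" and V: "open V"
    and \<Psi>: "continuous_on V \<Psi>" "\<And>z. z \<in> V \<Longrightarrow> classical_heat \<Psi> P z"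
    and cont: "continuous_on V H" "continuous_on V P"
    and max: "\<And>z. z \<in> V \<Longrightarrow> W z - \<Psi> z \<le> W z0 - \<Psi> z0"
  shows "P z0 \<le> H z0"
proof (rule ccontr)
  assume "\<not> P z0 \<le> H z0"
  \<comment> \<open>Here \<open>\<kappa>\<close> is the gap to be contradicted, not the supply rate
    of the system. Half of it survives near \<open>z0\<close> by continuity, and a quarter each is
    left for the penalty and for the approximation.\<close>
  define \<kappa> where "\<kappa> = P z0 - H z0"
  have \<kappa>: "\<kappa> > 0" using \<open>\<not> P z0 \<le> H z0\<close> by (simp add: \<kappa>_def)
  obtain r where r: "r > 0" "cball z0 r \<subseteq> V"
    and appr: "heat_approximable (cball z0 r) W H"
    using W z0 unfolding approx_heat_def by metis
  have "isCont (\<lambda>z. P z - H z) z0"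
    using cont V z0 by (auto intro!: continuous_intros simp: continuous_on_eq_continuous_at)
  then obtain d1 where d1: "d1 > 0" "\<And>z. dist z z0 < d1 \<Longrightarrow> \<bar>(P z - H z) - \<kappa>\<bar> < \<kappa> / 2"
    using \<kappa> unfolding continuous_at_eps_delta \<kappa>_def dist_real_def
    by (metis half_gt_zero)
  define d where "d = min r (d1 / 2)"
  have d: "d > 0" "d \<le> r" "d < d1"
    using r d1 by (auto simp: d_def)
  define n where "n = real DIM('a)"
  define c where "c = \<kappa> / (8 * (d + n + 1))"
  have n: "n \<ge> 0" by (simp add: n_def)
  have c: "c > 0" "2 * c * (d + n) < \<kappa> / 4"
    using \<kappa> d n by (auto simp: c_def field_simps add_nonneg_pos)
  \<comment> \<open>The second bound makes twice the approximation error smaller than the penalty on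
    the sphere of radius \<open>d\<close>, which rules out a maximum there.\<close>
  define e where "e = min (\<kappa> / 4) (c * d\<^sup>2 / 4)"
  have e: "e > 0" "e \<le> \<kappa> / 4" "2 * e < c * d\<^sup>2"
    using \<kappa> c d by (auto simp: e_def min_def)
  obtain w' h' where w': "continuous_on (cball z0 r) w'"
    "\<And>y. y \<in> cball z0 r \<Longrightarrow> \<bar>w' y - W y\<bar> < e"
    "\<And>y. y \<in> cball z0 r \<Longrightarrow> \<bar>h' y - H y\<bar> < e"
    "\<And>y. y \<in> cball z0 r \<Longrightarrow> classical_heat w' h' y"
    using appr e(1) unfolding heat_approximable_def by blast
  define F where "F z = w' z + (- 1) * (\<Psi> z + c * (norm (z - z0))\<^sup>2)" for z
  have sub: "cball z0 d \<subseteq> cball z0 r" using d by auto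
  have "continuous_on (cball z0 d) F"
    unfolding F_def using sub r continuous_on_subset[OF w'(1)] continuous_on_subset[OF \<Psi>(1)]
    by (auto intro!: continuous_intros)
  then obtain z1 where z1: "z1 \<in> cball z0 d" "\<And>z. z \<in> cball z0 d \<Longrightarrow> F z \<le> F z1"
    using continuous_attains_sup[of "cball z0 d" F] d(1) by auto
  have z1V: "z1 \<in> V" "z1 \<in> cball z0 r" using z1(1) sub r(2) by auto
  have "dist z0 z1 \<noteq> d"
  proof
    assume "dist z0 z1 = d"
    then have "F z1 = w' z1 - \<Psi> z1 - c * d\<^sup>2"
      by (simp add: F_def dist_norm norm_minus_commute)
    moreover have "w' z1 < W z1 + e" "W z0 < w' z0 + e"
      using w'(2)[OF z1V(2)] w'(2)[of z0] r(1) by auto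
    moreover have "W z1 - \<Psi> z1 \<le> W z0 - \<Psi> z0"
      using max z1V by blast
    moreover have "F z0 = w' z0 - \<Psi> z0"
      by (simp add: F_def)
    ultimately have "F z1 < F z0"
      using e(3) by linarith
    moreover have "F z0 \<le> F z1"
      using z1(2)[of z0] d by simp
    ultimately show False by simp
  qed
  then have z1b: "z1 \<in> ball z0 d" using z1(1) by simp
  then obtain \<delta> where \<delta>: "\<delta> > 0" "ball z1 \<delta> \<subseteq> ball z0 d"
    using open_ball open_contains_ball by blast
  have "classical_heat F (\<lambda>z. h' z + (- 1) * (P z + c * (2 * (snd z - snd z0) - 2 * n))) z1"
    unfolding F_def n_def
    by (intro classical_heat_add classical_heat_cmult classical_heat_norm_power2 w'(4) \<Psi>(2) z1V)
  then have "h' z1 + (- 1) * (P z1 + c * (2 * (snd z1 - snd z0) - 2 * n)) \<ge> 0"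
    by (rule classical_heat_local_max[OF _ \<delta>(1)]) (use z1(2) \<delta>(2) in force)
  moreover have "h' z1 < H z1 + e"
    using w'(3)[OF z1V(2)] by auto
  moreover have "P z1 - H z1 > \<kappa> / 2"
  proof -
    have "dist z1 z0 < d1" using z1(1) d by (simp add: dist_commute)
    from d1(2)[OF this] show ?thesis unfolding abs_less_iff by linarith
  qed
  moreover have "c * (2 * (snd z1 - snd z0) - 2 * n) \<ge> - (2 * c * (d + n))"
  proof -
    have "dist (snd z0) (snd z1) \<le> dist z0 z1" by (rule dist_snd_le)
    then have "snd z0 - snd z1 \<le> d" using z1(1) by (simp add: dist_real_def)
    then have "- 2 * (d + n) \<le> 2 * (snd z1 - snd z0) - 2 * n" by simp
    from mult_left_mono[OF this, of c] c(1) show ?thesis by (simp add: algebra_simps)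
  qed
  moreover define X Y where "X = c * (2 * (snd z1 - snd z0) - 2 * n)" "Y = 2 * c * (d + n)"
  ultimately have "h' z1 - (P z1 + X) \<ge> 0" "X \<ge> - Y" "h' z1 < H z1 + e" "P z1 - H z1 > \<kappa> / 2" "Y < \<kappa> / 4"
    using c(2) by simp_all
  then show False
    using e(2) by linarith
qed

text \<open>If the conclusion fails, \<open>W - \<psi>\<close> minus the penalty
  \<open>\<delta> / (t1 - t)\<close> has a positive maximum, attained at a time strictly between 0
  and \<open>t1\<close>. So a maximum at a final time, where only a one-sided time derivative would
  be available, does not occur. The hypothesis \<open>bdry\<close> excludes a maximum on
  \<open>C - U\<close>; it covers a Neumann condition through a better nearby point, and a Dirichlet
  condition vacuously.\<close>

lemma parabolic_comparison:
  fixes W \<psi> :: "'a::euclidean_space \<times> real \<Rightarrow> real"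
  assumes C: "compact C" "U \<subseteq> C" "open U"
    and cW: "continuous_on (C \<times> {0..t1}) W" and c\<psi>: "continuous_on (C \<times> {0..t1}) \<psi>"
    and W: "approx_heat (U \<times> {0<..<t1}) W H" and cH: "continuous_on (U \<times> {0<..<t1}) H"
    and \<psi>: "\<And>z. z \<in> U \<times> {0<..<t1} \<Longrightarrow> classical_heat \<psi> P z"
    and cP: "continuous_on (U \<times> {0<..<t1}) P"
    and strict: "\<And>z. z \<in> U \<times> {0<..<t1} \<Longrightarrow> \<psi> z < W z \<Longrightarrow> H z < P z"
    and init: "\<And>x. x \<in> C \<Longrightarrow> W (x, 0) \<le> \<psi> (x, 0)"
    and bdry: "\<And>x t. x \<in> C - U \<Longrightarrow> 0 < t \<Longrightarrow> t < t1 \<Longrightarrow> \<psi> (x, t) < W (x, t) \<Longrightarrow>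
        \<exists>y\<in>C. W (x, t) - \<psi> (x, t) < W (y, t) - \<psi> (y, t)"
    and x: "x \<in> C" "0 \<le> s" "s < t1"
  shows "W (x, s) \<le> \<psi> (x, s)"
proof (rule ccontr)
  assume "\<not> W (x, s) \<le> \<psi> (x, s)"
  define \<mu> where "\<mu> = W (x, s) - \<psi> (x, s)"
  have \<mu>: "\<mu> > 0" using \<open>\<not> W (x, s) \<le> \<psi> (x, s)\<close> by (simp add: \<mu>_def)
  have comp: "compact (C \<times> {0..t1})" using C by (intro compact_Times) auto
  have "continuous_on (C \<times> {0..t1}) (\<lambda>z. W z - \<psi> z)"
    by (intro continuous_intros cW c\<psi>)
  then have "compact ((\<lambda>z. W z - \<psi> z) ` (C \<times> {0..t1}))"
    using comp by (rule compact_continuous_image)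
  then obtain N where N: "\<And>z. z \<in> C \<times> {0..t1} \<Longrightarrow> W z - \<psi> z \<le> N"
    using compact_imp_bounded bounded_has_Sup(1)
    by (metis (no_types, lifting) bdd_above.unfold bounded_imp_bdd_above image_eqI)
  have Npos: "N > 0"
    using N[of "(x, s)"] x \<mu> by (simp add: \<mu>_def)
  \<comment> \<open>With this value the penalty at time \<open>s\<close> is
    \<open>\<mu> / 2\<close>, half of the excess.\<close>
  define \<delta> where "\<delta> = \<mu> * (t1 - s) / 2"
  have \<delta>: "\<delta> > 0" using \<mu> x by (simp add: \<delta>_def)
  \<comment> \<open>After \<open>t2\<close> the penalty is at least \<open>N\<close>, so the
    penalised difference is nonpositive and its supremum is found on
    \<open>C \<times> {0..t2}\<close>.\<close>
  define t2 where "t2 = max s (t1 - \<delta> / N)"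
  have t2: "s \<le> t2" "t2 < t1" "t1 - \<delta> / N \<le> t2"
    using x \<delta> Npos by (auto simp: t2_def)
  define \<Theta> where "\<Theta> z = W z - \<psi> z - \<delta> / (t1 - snd z)" for z
  have "continuous_on (C \<times> {0..t2}) \<Theta>"
  proof -
    have "C \<times> {0..t2} \<subseteq> C \<times> {0..t1}" using t2 by auto
    then have "continuous_on (C \<times> {0..t2}) W" "continuous_on (C \<times> {0..t2}) \<psi>"
      using cW c\<psi> continuous_on_subset by blast+
    then show ?thesis
      unfolding \<Theta>_def using t2 by (intro continuous_intros) auto
  qed
  moreover have "compact (C \<times> {0..t2})" "C \<times> {0..t2} \<noteq> {}"
    using C x t2 by (auto intro: compact_Times)
  ultimately obtain z0 where z0: "z0 \<in> C \<times> {0..t2}" "\<And>z. z \<in> C \<times> {0..t2} \<Longrightarrow> \<Theta> z \<le> \<Theta> z0"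
    using continuous_attains_sup by metis
  obtain x0 t0 where z0_eq: "z0 = (x0, t0)" by (cases z0)
  have \<Theta>s: "\<Theta> (x, s) = \<mu> / 2"
    using x by (simp add: \<Theta>_def \<mu>_def[symmetric] \<delta>_def field_simps)
  have \<Theta>0: "\<Theta> z0 > 0"
    using z0(2)[of "(x, s)"] x t2 \<mu> \<Theta>s by auto
  have all: "\<Theta> z \<le> \<Theta> z0" if "z \<in> C \<times> {0..<t1}" for z
  proof (cases "snd z \<le> t2")
    case True
    then show ?thesis using z0(2) that by (cases z) auto
  next
    case False
    have "t1 - snd z > 0" "t1 - snd z \<le> \<delta> / N" using False that t2 by auto
    then have "N \<le> \<delta> / (t1 - snd z)"
      using Npos by (simp add: field_simps)
    then have "\<Theta> z \<le> 0"
      using N[of z] that by (cases z) (auto simp: \<Theta>_def)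
    then show ?thesis using \<Theta>0 by simp
  qed
  have t0: "0 \<le> t0" "t0 < t1" "x0 \<in> C" using z0(1) t2 by (auto simp: z0_eq)
  have d0: "\<delta> / (t1 - t0) > 0" using \<delta> t0 by simp
  then have gt: "\<psi> (x0, t0) < W (x0, t0)"
    using \<Theta>0 by (simp add: \<Theta>_def z0_eq)
  then have t0p: "t0 > 0"
    using init[OF t0(3)] t0 by (cases "t0 = 0") auto
  have x0U: "x0 \<in> U"
  proof (rule ccontr)
    assume "x0 \<notin> U"
    then obtain y where "y \<in> C" "W (x0, t0) - \<psi> (x0, t0) < W (y, t0) - \<psi> (y, t0)"
      using bdry[of x0 t0] t0 t0p gt by auto
    then show False
      using all[of "(y, t0)"] t0 by (simp add: \<Theta>_def z0_eq)
  qed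
  let ?V = "U \<times> {0<..<t1}"
  have V: "z0 \<in> ?V" "open ?V" "?V \<subseteq> C \<times> {0..t1}"
    using x0U t0 t0p C by (auto simp: z0_eq open_Times)
  \<comment> \<open>The penalty increases in time and thus adds a positive source to
    \<open>\<psi>\<close>, which keeps the contradiction on the right side.\<close>
  have "(P z0 + \<delta> / (t1 - snd z0)\<^sup>2) \<le> H z0"
  proof (rule approx_heat_touching[OF W V(1,2)])
    show "continuous_on ?V (\<lambda>z. \<psi> z + \<delta> / (t1 - snd z))"
      using continuous_on_subset[OF c\<psi> V(3)] by (auto intro!: continuous_intros)
    show "continuous_on ?V (\<lambda>z. P z + \<delta> / (t1 - snd z)\<^sup>2)"
      using cP by (auto intro!: continuous_intros)
    show "continuous_on ?V H" by (rule cH)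
    show "W z - (\<psi> z + \<delta> / (t1 - snd z)) \<le> W z0 - (\<psi> z0 + \<delta> / (t1 - snd z0))" if "z \<in> ?V" for z
      using all[of z] that C by (cases z) (auto simp: \<Theta>_def)
    show "classical_heat (\<lambda>z. \<psi> z + \<delta> / (t1 - snd z)) (\<lambda>z. P z + \<delta> / (t1 - snd z)\<^sup>2) z"
      if "z \<in> ?V" for z
      using that by (intro classical_heat_add \<psi> classical_heat_time)
        (auto intro!: derivative_eq_intros simp: power2_eq_square)
  qed
  moreover have "H z0 < P z0"
    using strict[OF V(1)] gt by (simp add: z0_eq)
  moreover have "\<delta> / (t1 - snd z0)\<^sup>2 > 0"
    using \<delta> t0 by (simp add: z0_eq)
  ultimately show False by linarith
qed

subsection \<open>The Neumann boundary condition\<close>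


lemma Ck_on_2_laplacian:
  assumes "Ck_on 2 g UNIV"
  obtains E lap where "\<And>x. GDERIV g x :> E x" "continuous_on UNIV E"
    "\<And>x. has_laplacian g x (lap x)" "continuous_on UNIV lap"
proof -
  obtain E where E: "\<And>x. GDERIV g x :> E x" "\<And>i. i \<in> Basis \<Longrightarrow> Ck_on (Suc 0) (\<lambda>x. E x \<bullet> i) UNIV"
    using assms by (auto simp: numeral_2_eq_2)
  have "\<forall>i\<in>Basis. \<exists>K. (\<forall>x. GDERIV (\<lambda>x. E x \<bullet> i) x :> K x) \<and>
      (\<forall>j\<in>Basis. continuous_on UNIV (\<lambda>x. K x \<bullet> j))"
    using E(2) by auto
  then obtain K where K: "\<And>i x. i \<in> Basis \<Longrightarrow> GDERIV (\<lambda>x. E x \<bullet> i) x :> K i x"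
    "\<And>i j. i \<in> Basis \<Longrightarrow> j \<in> Basis \<Longrightarrow> continuous_on UNIV (\<lambda>x. K i x \<bullet> j)"
    by metis
  define lap where "lap x = (\<Sum>i\<in>Basis. K i x \<bullet> i)" for x
  show thesis
  proof (rule that[of E lap])
    show "GDERIV g x :> E x" for x by (rule E(1))
    show "continuous_on UNIV E"
      by (subst continuous_on_componentwise) (use E(2) Ck_on_continuous in blast)
    show "continuous_on UNIV lap"
      unfolding lap_def by (intro continuous_intros K(2))
    have "has_D2 (\<lambda>s. g (x + s *\<^sub>R i)) (K i x \<bullet> i)" if "i \<in> Basis" for i x
    proof (rule has_D2I)
      show "((\<lambda>s. g (x + s *\<^sub>R i)) has_real_derivative E (x + s *\<^sub>R i) \<bullet> i) (at s)" for s
        by (rule GDERIV_line[OF E(1)])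
      show "((\<lambda>s. E (x + s *\<^sub>R i) \<bullet> i) has_real_derivative K i x \<bullet> i) (at 0)"
        using GDERIV_line[of "\<lambda>x. E x \<bullet> i" x 0 i "K i x"] K(1)[OF that] by simp
    qed
    then show "has_laplacian g x (lap x)" for x
      unfolding has_laplacian_def lap_def by (intro exI[of _ "\<lambda>i. K i x \<bullet> i"]) auto
  qed
qed

lemma GDERIV_line0:
  assumes "GDERIV g x :> D"
  shows "((\<lambda>s. g (x + s *\<^sub>R e)) has_real_derivative D \<bullet> e) (at 0)"
  using GDERIV_line[of g x 0 e D] assms by simp

lemma open_line:
  fixes x :: "'a::real_normed_vector"
  assumes "open U" "x \<in> U"
  obtains s0 where "s0 > 0" "\<And>s. \<bar>s\<bar> < s0 \<Longrightarrow> x + s *\<^sub>R e \<in> U"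
proof -
  have "open ((\<lambda>s. x + s *\<^sub>R e) -` U)"
    by (intro open_vimage assms(1) continuous_intros)
  moreover have "0 \<in> (\<lambda>s. x + s *\<^sub>R e) -` U"
    using assms by simp
  ultimately obtain s0 where "s0 > 0" "ball 0 s0 \<subseteq> (\<lambda>s. x + s *\<^sub>R e) -` U"
    using open_contains_ball by meson
  then show thesis
    using that[of s0] by (auto simp: subset_iff)
qed

text \<open>A negative value would put the point into the open set \<open>\<Omega>\<close>; a
  positive value would persist in a neighbourhood and separate the point from
  \<open>\<Omega>\<close>.\<close>

lemma boundary_chart_frontier_eq_0:
  assumes "boundary_chart \<Omega> q U \<rho> G" "open \<Omega>" "x \<in> U" "x \<in> frontier \<Omega>"
  shows "\<rho> x = 0"
proof -
  have U: "open U" "\<Omega> \<inter> U = {x\<in>U. \<rho> x < 0}" "\<And>x. x \<in> U \<Longrightarrow> GDERIV \<rho> x :> G x"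
    using assms(1) by (auto simp: boundary_chart_def)
  have "x \<notin> \<Omega>" "x \<in> closure \<Omega>"
    using assms(2,4) by (auto simp: frontier_def interior_open)
  then have "\<not> \<rho> x < 0" using U(2) assms(3) by blast
  moreover have "\<not> \<rho> x > 0"
  proof
    assume "\<rho> x > 0"
    have "\<forall>x\<in>U. isCont \<rho> x"
      using has_derivative_continuous[OF U(3)[unfolded gderiv_def]] by simp
    then have "continuous_on U \<rho>"
      by (simp add: continuous_at_imp_continuous_on)
    then have "open (\<rho> -` {0<..} \<inter> U)"
      using continuous_on_open_vimage[OF U(1), of \<rho>] by simp
    moreover have "x \<in> \<rho> -` {0<..} \<inter> U" using \<open>\<rho> x > 0\<close> assms(3) by simp
    ultimately have "\<Omega> \<inter> (\<rho> -` {0<..} \<inter> U) \<noteq> {}"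
      using \<open>x \<in> closure \<Omega>\<close> open_Int_closure_eq_empty by blast
    then obtain y where "y \<in> \<Omega>" "y \<in> U" "\<rho> y > 0" by auto
    moreover have "\<rho> y < 0" using U(2) \<open>y \<in> \<Omega>\<close> \<open>y \<in> U\<close> by blast
    ultimately show False by simp
  qed
  ultimately show ?thesis by simp
qed

lemma boundary_chart_inward:
  assumes "boundary_chart \<Omega> q U \<rho> G" "open \<Omega>" "x \<in> U" "x \<in> frontier \<Omega>" "G x \<bullet> d < 0"
  obtains s0 where "s0 > 0" "\<And>s. 0 < s \<Longrightarrow> s < s0 \<Longrightarrow> x + s *\<^sub>R d \<in> \<Omega>"
proof -
  have U: "open U" "\<Omega> \<inter> U = {x\<in>U. \<rho> x < 0}" "GDERIV \<rho> x :> G x"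
    using assms(1,3) by (auto simp: boundary_chart_def)
  obtain s1 where s1: "s1 > 0" "\<And>s. \<bar>s\<bar> < s1 \<Longrightarrow> x + s *\<^sub>R d \<in> U"
    using open_line[OF U(1) assms(3)] by metis
  obtain s2 where s2: "s2 > 0" "\<And>h. 0 < h \<Longrightarrow> h < s2 \<Longrightarrow> \<rho> (x + h *\<^sub>R d) < \<rho> x"
    using DERIV_neg_dec_right[OF GDERIV_line0[OF U(3)] assms(5)] by auto
  show thesis
  proof (rule that[of "min s1 s2"])
    show "x + s *\<^sub>R d \<in> \<Omega>" if "0 < s" "s < min s1 s2" for s
      using s1(2)[of s] s2(2)[of s] that boundary_chart_frontier_eq_0[OF assms(1-4)] U(2) by auto
  qed (use s1 s2 in auto)
qed

text \<open>If the inner product were nonpositive, the difference of the two unit gradients would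
  decrease one defining function and increase the other, so that small steps along it would be
  inside and outside \<open>\<Omega>\<close> at once. This prevents cancellation when charts are
  glued.\<close>

lemma boundary_charts_gradients:
  assumes c1: "boundary_chart \<Omega> q1 U1 \<rho>1 G1" and c2: "boundary_chart \<Omega> q2 U2 \<rho>2 G2"
    and "open \<Omega>" "x \<in> U1" "x \<in> U2" "x \<in> frontier \<Omega>"
  shows "G1 x \<bullet> G2 x > 0"
proof (rule ccontr)
  assume neg: "\<not> G1 x \<bullet> G2 x > 0"
  have nz: "G1 x \<noteq> 0" "G2 x \<noteq> 0"
    using c1 c2 assms(4,5) by (auto simp: boundary_chart_def)
  define d where "d = - (1 / norm (G1 x)) *\<^sub>R G1 x + (1 / norm (G2 x)) *\<^sub>R G2 x"
  have "G1 x \<bullet> d = - norm (G1 x) + (G1 x \<bullet> G2 x) / norm (G2 x)"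
    using nz by (simp add: d_def inner_diff_right power2_norm_eq_inner[symmetric] power2_eq_square)
  also have "\<dots> \<le> - norm (G1 x)"
    using neg nz by (simp add: divide_nonpos_pos)
  finally have "G1 x \<bullet> d < 0" using nz by (simp add: le_less_trans)
  then obtain s1 where s1: "s1 > 0" "\<And>s. 0 < s \<Longrightarrow> s < s1 \<Longrightarrow> x + s *\<^sub>R d \<in> \<Omega>"
    using boundary_chart_inward[OF c1 assms(3,4,6)] by metis
  have "G2 x \<bullet> d = norm (G2 x) - (G1 x \<bullet> G2 x) / norm (G1 x)"
    using nz by (simp add: d_def inner_diff_right power2_norm_eq_inner[symmetric] power2_eq_square
        inner_commute)
  also have "\<dots> \<ge> norm (G2 x)"
    using neg nz by (simp add: divide_nonpos_pos)
  finally have "G2 x \<bullet> d > 0" using nz less_le_trans[of 0 "norm (G2 x)" "G2 x \<bullet> d"] by simp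
  have U2: "open U2" "\<Omega> \<inter> U2 = {x\<in>U2. \<rho>2 x < 0}" "GDERIV \<rho>2 x :> G2 x"
    using c2 assms(5) by (auto simp: boundary_chart_def)
  obtain s2 where s2: "s2 > 0" "\<And>s. 0 < s \<Longrightarrow> s < s2 \<Longrightarrow> \<rho>2 (x + s *\<^sub>R d) > 0"
    using DERIV_pos_inc_right[OF GDERIV_line0[OF U2(3)] \<open>G2 x \<bullet> d > 0\<close>]
      boundary_chart_frontier_eq_0[OF c2 assms(3,5,6)] by auto
  obtain s3 where s3: "s3 > 0" "\<And>s. \<bar>s\<bar> < s3 \<Longrightarrow> x + s *\<^sub>R d \<in> U2"
    using open_line[OF U2(1) assms(5)] by metis
  define s where "s = min s1 (min s2 s3) / 2"
  have s: "0 < s" "s < s1" "s < s2" "s < s3"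
    using s1(1) s2(1) s3(1) by (auto simp: s_def)
  then have "x + s *\<^sub>R d \<in> \<Omega> \<inter> U2" "\<rho>2 (x + s *\<^sub>R d) > 0"
    using s1(2) s2(2) s3(2)[of s] by auto
  then show False using U2(2) by auto
qed

text \<open>Adding a multiple of \<open>g\<close> to a barrier gives it a positive outward slope at
  the cost of a bounded source. The clause on \<open>D\<close> transfers the Neumann condition from
  unit normals to \<open>E q\<close> without singling out one normal; the last clause supplies the
  interior points used for comparison at \<open>q\<close>.\<close>

definition boundary_field ::
    "'a::euclidean_space set \<Rightarrow> ('a \<Rightarrow> real) \<Rightarrow> ('a \<Rightarrow> 'a) \<Rightarrow> ('a \<Rightarrow> real) \<Rightarrow> real \<Rightarrow> bool" where
  "boundary_field \<Omega> g E lap c \<longleftrightarrow> c > 0 \<and>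
     (\<forall>x. GDERIV g x :> E x) \<and> (\<forall>x. has_laplacian g x (lap x)) \<and> continuous_on UNIV lap \<and>
     (\<forall>q\<in>frontier \<Omega>. norm (E q) \<ge> c \<and>
        (\<forall>D. (\<forall>n. outer_unit_normal \<Omega> q n \<longrightarrow> D \<bullet> n = 0) \<longrightarrow> D \<bullet> E q = 0) \<and>
        (\<exists>s0>0. \<forall>s. 0 < s \<and> s < s0 \<longrightarrow> q + s *\<^sub>R (- E q) \<in> \<Omega>))"

text \<open>The function \<open>g\<close> glues the defining functions of finitely many charts by bump functions. On the
  boundary, where the defining functions vanish, its gradient is a nonnegative combination of their
  gradients, hence an outer normal.\<close>

lemma boundary_field_exists:
  fixes \<Omega> :: "'a::euclidean_space set"
  assumes "open \<Omega>" "bounded \<Omega>" "smooth_boundary \<Omega>"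
  obtains g E lap c where "boundary_field \<Omega> g E lap c"
proof -
  have "\<forall>q. \<exists>U \<rho> G. q \<in> frontier \<Omega> \<longrightarrow> boundary_chart \<Omega> q U \<rho> G"
    using assms(3) unfolding smooth_boundary_def by blast
  then obtain U \<rho> G where chart: "\<And>q. q \<in> frontier \<Omega> \<Longrightarrow> boundary_chart \<Omega> q (U q) (\<rho> q) (G q)"
    by metis
  have "\<forall>q. \<exists>r. q \<in> frontier \<Omega> \<longrightarrow> r > 0 \<and> cball q r \<subseteq> U q"
  proof
    fix q
    show "\<exists>r. q \<in> frontier \<Omega> \<longrightarrow> r > 0 \<and> cball q r \<subseteq> U q"
    proof (cases "q \<in> frontier \<Omega>")
      case True
      then have "open (U q)" "q \<in> U q"
        using chart by (auto simp: boundary_chart_def)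
      then show ?thesis using open_contains_cball by blast
    qed simp
  qed
  then obtain r where r: "\<And>q. q \<in> frontier \<Omega> \<Longrightarrow> r q > 0" "\<And>q. q \<in> frontier \<Omega> \<Longrightarrow> cball q (r q) \<subseteq> U q"
    by metis
  have comp: "compact (frontier \<Omega>)" using assms(2) by (rule compact_frontier_bounded)
  obtain F where F: "F \<subseteq> frontier \<Omega>" "finite F" "frontier \<Omega> \<subseteq> (\<Union>q\<in>F. ball q (r q))"
    by (rule compactE_image[OF comp, of "frontier \<Omega>" "\<lambda>q. ball q (r q)"]) (use r in auto)
  \<comment> \<open>The conditional extends the product by zero. It is C^2 everywhere because
    \<open>U q\<close> and the complement of the closed ball cover the space.\<close>
  define \<phi> where "\<phi> q x = (if x \<in> U q then bump (r q) q x * \<rho> q x else 0)" for q x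
  have rF: "r q > 0" "cball q (r q) \<subseteq> U q" "open (U q)" "smooth_on (\<rho> q) (U q)" if "q \<in> F" for q
    using that F(1) r chart by (auto simp: boundary_chart_def)
  have \<phi>0: "\<phi> q x = 0" if "q \<in> F" "x \<notin> cball q (r q)" for q x
  proof -
    have "x \<notin> ball q (r q)" using that by auto
    then show ?thesis using bump_eq_0[OF rF(1)[OF that(1)], of x q] by (simp add: \<phi>_def)
  qed
  have "Ck_on 2 (\<phi> q) UNIV" if q: "q \<in> F" for q
  proof -
    have "Ck_on 2 (\<phi> q) (U q)"
    proof (rule Ck_on_cong[OF rF(3)[OF q]])
      show "Ck_on 2 (\<lambda>x. bump (r q) q x * \<rho> q x) (U q)"
        using rF(4)[OF q] by (intro Ck_on_mult Ck_on_bump) (simp add: smooth_on_def)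
    qed (simp add: \<phi>_def)
    moreover have "Ck_on 2 (\<phi> q) (- cball q (r q))"
      by (rule Ck_on_cong[of _ "\<lambda>x. 0"]) (auto simp: \<phi>0 q Ck_on_const)
    ultimately have "Ck_on 2 (\<phi> q) (U q \<union> - cball q (r q))"
      by (intro Ck_on_Un rF(3) q) auto
    moreover have "U q \<union> - cball q (r q) = UNIV" using rF(2)[OF q] by auto
    ultimately show ?thesis by simp
  qed
  define g where "g x = (\<Sum>q\<in>F. \<phi> q x)" for x
  have "Ck_on 2 g UNIV"
    unfolding g_def by (rule Ck_on_sum) fact+
  then obtain E lap where E: "\<And>x. GDERIV g x :> E x" "continuous_on UNIV E"
    "\<And>x. has_laplacian g x (lap x)" "continuous_on UNIV lap"
    using Ck_on_2_laplacian by metis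
  \<comment> \<open>On the boundary the defining functions vanish, so the product rule leaves only
    the terms in which \<open>\<rho>\<close> is differentiated.\<close>
  have E_eq: "E x = (\<Sum>q\<in>F. bump (r q) q x *\<^sub>R G q x)" if x: "x \<in> frontier \<Omega>" for x
  proof -
    have d: "GDERIV (\<phi> q) x :> bump (r q) q x *\<^sub>R G q x" if q: "q \<in> F" for q
    proof (cases "x \<in> U q")
      case True
      have c: "boundary_chart \<Omega> q (U q) (\<rho> q) (G q)" using q F(1) chart by blast
      obtain B where B: "GDERIV (bump (r q) q) x :> B"
        using Ck_on_bump[of 1 "r q" q UNIV] by auto
      have R: "GDERIV (\<rho> q) x :> G q x" using c True by (auto simp: boundary_chart_def)
      have "GDERIV (\<lambda>x. bump (r q) q x * \<rho> q x) x :> bump (r q) q x *\<^sub>R G q x"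
        using GDERIV_mult[OF B R] boundary_chart_frontier_eq_0[OF c assms(1) True x] by simp
      then show ?thesis
        by (rule GDERIV_cong_open[OF _ rF(3)[OF q] True]) (simp add: \<phi>_def)
    next
      case False
      then have x': "x \<in> - cball q (r q)" using rF(2)[OF q] by auto
      then have "bump (r q) q x = 0" using bump_eq_0[OF rF(1)[OF q], of x q] by auto
      moreover have "GDERIV (\<phi> q) x :> 0"
        by (rule GDERIV_cong_open[OF GDERIV_const _ x']) (auto simp: \<phi>0 q)
      ultimately show ?thesis by simp
    qed
    have "GDERIV g x :> (\<Sum>q\<in>F. bump (r q) q x *\<^sub>R G q x)"
      using d unfolding g_def[abs_def] gderiv_def inner_sum_right by (intro has_derivative_sum)
    then show ?thesis using E(1) GDERIV_unique by blast
  qed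
  have bump_U: "x \<in> U q" if "q \<in> F" "bump (r q) q x \<noteq> 0" for x q
    using bump_eq_0[OF rF(1)[OF that(1)], of x q] that rF(2)[OF that(1)]
      ball_subset_cball by blast
  have chartF: "boundary_chart \<Omega> q (U q) (\<rho> q) (G q)" if "q \<in> F" for q
    using that F(1) chart by blast
  have inward: "E x \<noteq> 0 \<and> (\<exists>s0>0. \<forall>s. 0 < s \<and> s < s0 \<longrightarrow> x + s *\<^sub>R (- E x) \<in> \<Omega>)"
    if x: "x \<in> frontier \<Omega>" for x
  proof -
    obtain q where q: "q \<in> F" "x \<in> ball q (r q)" using F(3) x by auto
    have bq: "bump (r q) q x > 0" using bump_pos[OF rF(1)] q by blast
    have xU: "x \<in> U q" using bump_U q bq by force
    \<comment> \<open>Paired with the gradient of a chart that is active at \<open>x\<close>, every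
      summand of \<open>E x\<close> is nonnegative and its own summand is positive.\<close>
    have pos: "bump (r q') q' x * (G q x \<bullet> G q' x) \<ge> 0" if "q' \<in> F" for q'
    proof (cases "bump (r q') q' x = 0")
      case False
      then have "G q x \<bullet> G q' x > 0"
        using boundary_charts_gradients[OF chartF[OF q(1)] chartF[OF that] assms(1) xU] bump_U that x by blast
      then show ?thesis by (simp add: bump_nonneg)
    qed simp
    have "bump (r q) q x * (G q x \<bullet> G q x) > 0"
      using bq chartF[OF q(1)] xU by (auto simp: boundary_chart_def)
    then have "(\<Sum>q'\<in>F. bump (r q') q' x * (G q x \<bullet> G q' x)) > 0"
      using pos F(2) q(1) by (intro sum_pos2)
    then have GE: "G q x \<bullet> E x > 0" by (simp add: E_eq[OF x] inner_sum_right)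
    then have "G q x \<bullet> (- E x) < 0" by simp
    from boundary_chart_inward[OF chartF[OF q(1)] assms(1) xU x this] GE show ?thesis
      by (metis inner_zero_right less_irrefl)
  qed
  have normal: "D \<bullet> E x = 0" if x: "x \<in> frontier \<Omega>" and D: "\<forall>n. outer_unit_normal \<Omega> x n \<longrightarrow> D \<bullet> n = 0"
    for x D
  proof -
    have "bump (r q) q x * (D \<bullet> G q x) = 0" if q: "q \<in> F" for q
    proof (cases "bump (r q) q x = 0")
      case False
      then have xU: "x \<in> U q" using bump_U q by blast
      \<comment> \<open>A chart at \<open>q\<close> is also a chart at each point of its domain, so
        its normalised gradient at \<open>x\<close> is an outer unit normal at
        \<open>x\<close>.\<close>
      then have "boundary_chart \<Omega> x (U q) (\<rho> q) (G q)" "G q x \<noteq> 0"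
        using chartF[OF q] by (auto simp: boundary_chart_def)
      then have "D \<bullet> (G q x /\<^sub>R norm (G q x)) = 0"
        using D unfolding outer_unit_normal_def by blast
      then show ?thesis using \<open>G q x \<noteq> 0\<close> by simp
    qed simp
    then show ?thesis
      unfolding E_eq[OF x] inner_sum_right inner_scaleR_right by (intro sum.neutral) blast
  qed
  obtain c where c: "c > 0" "\<And>x. x \<in> frontier \<Omega> \<Longrightarrow> norm (E x) \<ge> c"
  proof (cases "frontier \<Omega> = {}")
    case True
    then show ?thesis using that[of 1] by simp
  next
    case False
    have "continuous_on (frontier \<Omega>) (\<lambda>x. norm (E x))"
      using continuous_on_subset[OF E(2)] by (auto intro!: continuous_intros)
    then obtain y where y: "y \<in> frontier \<Omega>" "\<And>x. x \<in> frontier \<Omega> \<Longrightarrow> norm (E y) \<le> norm (E x)"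
      using continuous_attains_inf[OF comp False] by metis
    with inward[OF y(1)] show ?thesis using that[of "norm (E y)"] by simp
  qed
  have "boundary_field \<Omega> g E lap c"
    unfolding boundary_field_def using c E inward normal by auto
  then show thesis by (rule that)
qed

text \<open>Moving inwards along \<open>- e\<close>, \<open>\<psi>\<close> falls at a definite rate,
  whereas the slope of \<open>w\<close> tends to 0 because \<open>D q \<bullet> e = 0\<close> and
  \<open>D\<close> is continuous up to the boundary. Hence \<open>w - \<psi>\<close> grows. The
  gradient of \<open>w\<close> is used only at interior points, through the mean value
  theorem.\<close>

lemma neumann_no_boundary_max:
  fixes w \<psi> :: "'a::euclidean_space \<Rightarrow> real"
  assumes w: "continuous_on (closure \<Omega>) w" "\<And>x. x \<in> \<Omega> \<Longrightarrow> GDERIV w x :> D x"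
    and D: "continuous_on (closure \<Omega>) D" "D q \<bullet> e = 0"
    and q: "q \<in> closure \<Omega>" "s0 > 0" "\<And>s. 0 < s \<Longrightarrow> s < s0 \<Longrightarrow> q + s *\<^sub>R (- e) \<in> \<Omega>"
    and \<psi>: "GDERIV \<psi> q :> \<Psi>" "\<Psi> \<bullet> e > 0"
  shows "\<exists>y\<in>closure \<Omega>. w q - \<psi> q < w y - \<psi> y"
proof -
  define \<mu> where "\<mu> = \<Psi> \<bullet> e / 2"
  have \<mu>: "\<mu> > 0" using \<psi> by (simp add: \<mu>_def)
  let ?l = "\<lambda>s. q + s *\<^sub>R (- e)"
  have "((\<lambda>s. \<psi> (?l s) + \<mu> * s) has_real_derivative - \<mu>) (at 0)"
    using GDERIV_line0[OF \<psi>(1), of "- e"]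
    by (auto intro!: derivative_eq_intros simp: \<mu>_def)
  from DERIV_neg_dec_right[OF this] \<mu>
  obtain s1 where s1: "s1 > 0" "\<And>h. 0 < h \<Longrightarrow> h < s1 \<Longrightarrow> \<psi> (?l h) + \<mu> * h < \<psi> q"
    by auto
  have lcl: "?l s \<in> closure \<Omega>" if "0 \<le> s" "s < s0" for s
  proof (cases "s = 0")
    case False
    then show ?thesis using q(3)[of s] that closure_subset by fastforce
  qed (use q in simp)
  have "continuous_on {0..<s0} ?l" by (intro continuous_intros)
  then have cD: "continuous_on {0..<s0} (\<lambda>s. D (?l s) \<bullet> e)" and cw: "continuous_on {0..<s0} (\<lambda>s. w (?l s))"
    using lcl by (auto intro!: continuous_intros continuous_on_compose2[OF D(1)]
        continuous_on_compose2[OF w(1)])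
  from cD q(2) \<mu> obtain s2 where s2: "s2 > 0"
    "\<And>s. s \<in> {0..<s0} \<Longrightarrow> dist s 0 < s2 \<Longrightarrow> dist (D (?l s) \<bullet> e) (D (?l 0) \<bullet> e) < \<mu>"
    unfolding continuous_on_iff by (metis atLeastLessThan_iff order_refl)
  define s where "s = min s0 (min s1 s2) / 2"
  have s: "0 < s" "s < s0" "s < s1" "s < s2"
    using q(2) s1(1) s2(1) by (auto simp: s_def)
  have "\<exists>z. 0 < z \<and> z < s \<and> w (?l s) - w (?l 0) = (s - 0) * (D (?l z) \<bullet> (- e))"
  proof -
    have "continuous_on {0..s} (\<lambda>s. w (?l s))"
      using s by (intro continuous_on_subset[OF cw]) auto
    moreover have "((\<lambda>s. w (?l s)) has_derivative (\<lambda>h. h * (D (?l z) \<bullet> (- e)))) (at z)"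
      if "0 < z" "z < s" for z
    proof -
      have "GDERIV w (?l z) :> D (?l z)"
        using that s q(3)[of z] by (intro w(2)) auto
      from GDERIV_line[OF this] show ?thesis
        unfolding has_field_derivative_def by (simp only: mult_commute_abs)
    qed
    ultimately show ?thesis
      using mvt[of 0 s "\<lambda>s. w (?l s)" "\<lambda>z h. h * (D (?l z) \<bullet> (- e))"] s(1) by metis
  qed
  then obtain z where z: "0 < z" "z < s" "w (?l s) - w q = - s * (D (?l z) \<bullet> e)"
    by auto
  have "\<bar>D (?l z) \<bullet> e\<bar> < \<mu>"
    using s2(2)[of z] z s D(2) by (simp add: dist_real_def)
  then have "s * (D (?l z) \<bullet> e) < s * \<mu>"
    using s(1) by (intro mult_strict_left_mono) auto
  then have "w (?l s) - w q > - (\<mu> * s)"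
    using z(3) by (simp add: mult.commute)
  moreover have "\<psi> (?l s) + \<mu> * s < \<psi> q" using s1(2) s by blast
  ultimately have "w q - \<psi> q < w (?l s) - \<psi> (?l s)" by linarith
  then show ?thesis using lcl[of s] s by auto
qed

subsection \<open>Barriers and bounds on the whole domain\<close>


text \<open>The barriers are built from the even function \<open>kink \<tau>\<close> of one coordinate. Its second derivative
  dominates \<open>|s|\<^sup>-\<^sup>1\<^sup>/\<^sup>2\<close> truncated at the level \<open>\<tau>\<^sup>-\<^sup>1\<^sup>/\<^sup>4\<close>, while it and its first derivative
  are bounded uniformly in \<open>\<tau> \<in> (0,1]\<close>.\<close>

definition spike :: "real \<Rightarrow> real \<Rightarrow> real" where
  "spike \<tau> s = (s\<^sup>2 + \<tau>) powr (- 1 / 4)"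

definition kink :: "real \<Rightarrow> real \<Rightarrow> real" where
  "kink \<tau> s = (s\<^sup>2 + \<tau>) powr (3 / 4)"

definition kink1 :: "real \<Rightarrow> real \<Rightarrow> real" where
  "kink1 \<tau> s = 3 / 2 * s * (s\<^sup>2 + \<tau>) powr (- 1 / 4)"

definition kink2 :: "real \<Rightarrow> real \<Rightarrow> real" where
  "kink2 \<tau> s = 3 / 2 * (s\<^sup>2 + \<tau>) powr (- 1 / 4) - 3 / 4 * s\<^sup>2 * (s\<^sup>2 + \<tau>) powr (- 5 / 4)"

section \<open>Derivatives and uniform bounds of the one-dimensional barrier\<close>

lemma square_add_pos: "\<tau> > 0 \<Longrightarrow> s\<^sup>2 + \<tau> > (0::real)"
  by (simp add: add_nonneg_pos)

lemma kink_derivative: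
  assumes "\<tau> > 0"
  shows "(kink \<tau> has_real_derivative kink1 \<tau> s) (at s)"
  unfolding kink_def[abs_def] kink1_def
  using square_add_pos[OF assms, of s]
  by (auto intro!: derivative_eq_intros)

lemma kink1_derivative:
  assumes "\<tau> > 0"
  shows "(kink1 \<tau> has_real_derivative kink2 \<tau> s) (at s)"
  unfolding kink1_def[abs_def] kink2_def
  using square_add_pos[OF assms, of s]
  by (auto intro!: derivative_eq_intros simp: power2_eq_square)

text \<open>Since s^2 \<le> s^2 + \<tau>, the negative term of \<open>kink2\<close> costs at most
  half of the leading coefficient 3/2.\<close>

lemma kink2_ge_spike:
  assumes "\<tau> > 0"
  shows "kink2 \<tau> s \<ge> 3 / 4 * spike \<tau> s"
proof -
  have "s\<^sup>2 * (s\<^sup>2 + \<tau>) powr (- 5 / 4) \<le> (s\<^sup>2 + \<tau>) * (s\<^sup>2 + \<tau>) powr (- 5 / 4)"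
    using assms by (intro mult_right_mono) auto
  also have "\<dots> = (s\<^sup>2 + \<tau>) powr (1 + (- 5 / 4))"
    using square_add_pos[OF assms, of s] by (subst powr_add) simp
  finally show ?thesis
    by (simp add: kink2_def spike_def)
qed

lemma continuous_kink2: "\<tau> > 0 \<Longrightarrow> continuous_on A f \<Longrightarrow> continuous_on A (\<lambda>x. kink2 \<tau> (f x))"
  unfolding kink2_def using square_add_pos[of \<tau>]
  by (intro continuous_intros) (auto simp: less_imp_neq[THEN not_sym])

lemma continuous_kink: "\<tau> > 0 \<Longrightarrow> continuous_on A f \<Longrightarrow> continuous_on A (\<lambda>x. kink \<tau> (f x))"
  unfolding kink_def using square_add_pos[of \<tau>]
  by (intro continuous_intros) (auto simp: less_imp_neq[THEN not_sym])

lemma spike_nonneg: "spike \<tau> s \<ge> 0"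
  by (simp add: spike_def)

lemma kink_nonneg: "kink \<tau> s \<ge> 0"
  by (simp add: kink_def)

lemma square_add_bound:
  assumes "0 < \<tau>" "\<tau> \<le> 1" "\<bar>s\<bar> \<le> R"
  shows "s\<^sup>2 + \<tau> \<le> R\<^sup>2 + (1::real)"
proof -
  have "\<bar>s\<bar>\<^sup>2 \<le> R\<^sup>2" using assms(3) by (intro power_mono) auto
  then show ?thesis using assms by simp
qed

lemma kink_le:
  assumes "0 < \<tau>" "\<tau> \<le> 1" "\<bar>s\<bar> \<le> R"
  shows "kink \<tau> s \<le> R\<^sup>2 + 1"
proof -
  have "kink \<tau> s \<le> (R\<^sup>2 + 1) powr (3 / 4)"
    unfolding kink_def using square_add_bound[OF assms] assms(1) by (intro powr_mono2) auto
  also have "\<dots> \<le> (R\<^sup>2 + 1) powr 1"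
    by (intro powr_mono) auto
  finally show ?thesis by (simp add: add_nonneg_pos)
qed

text \<open>The factor |s| is at most the square root of s^2 + \<tau>, which leaves the power 1/4;
  this is what keeps the slope bounded as \<tau> tends to 0.\<close>

lemma kink1_abs_le:
  assumes "0 < \<tau>" "\<tau> \<le> 1" "\<bar>s\<bar> \<le> R"
  shows "\<bar>kink1 \<tau> s\<bar> \<le> 3 / 2 * (R\<^sup>2 + 1)"
proof -
  have p: "s\<^sup>2 + \<tau> > 0" by (rule square_add_pos) fact
  have "\<bar>s\<bar> = (s\<^sup>2) powr (1 / 2)"
    by (simp add: powr_half_sqrt)
  also have "\<dots> \<le> (s\<^sup>2 + \<tau>) powr (1 / 2)"
    using assms by (intro powr_mono2) auto
  finally have "\<bar>s\<bar> * (s\<^sup>2 + \<tau>) powr (- 1 / 4) \<le> (s\<^sup>2 + \<tau>) powr (1 / 2) * (s\<^sup>2 + \<tau>) powr (- 1 / 4)"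
    by (intro mult_right_mono) auto
  also have "\<dots> = (s\<^sup>2 + \<tau>) powr (1 / 4)"
    by (simp flip: powr_add)
  also have "\<dots> \<le> (R\<^sup>2 + 1) powr (1 / 4)"
    using square_add_bound[OF assms] p by (intro powr_mono2) auto
  also have "\<dots> \<le> (R\<^sup>2 + 1) powr 1"
    by (intro powr_mono) auto
  also have "\<dots> = R\<^sup>2 + 1" by (simp add: add_nonneg_pos)
  finally show ?thesis by (simp add: kink1_def abs_mult)
qed

text \<open>The hypotheses say that \<open>k\<close> is below both |s|^(-1/2) and \<tau>^(-1/4),
  stated with fourth powers. They add up to k^4 (s^2 + \<tau>) \<le> 2, which is relaxed to 2^4 so
  that the fourth root is the factor 2.\<close>

lemma truncated_le_spike:
  assumes "0 \<le> k" "k ^ 4 * s\<^sup>2 \<le> 1" "k ^ 4 * \<tau> \<le> 1" "\<tau> > 0"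
  shows "k \<le> 2 * spike \<tau> s"
proof -
  have p: "s\<^sup>2 + \<tau> > 0" by (rule square_add_pos) fact
  have "k ^ 4 * (s\<^sup>2 + \<tau>) \<le> 2 ^ 4"
    using assms by (simp add: algebra_simps)
  then have "k ^ 4 \<le> 2 ^ 4 * inverse (s\<^sup>2 + \<tau>)"
    using p by (simp add: field_simps)
  also have "inverse (s\<^sup>2 + \<tau>) = spike \<tau> s ^ 4"
  proof -
    have "spike \<tau> s ^ 4 = (s\<^sup>2 + \<tau>) powr (real 4 * (- 1 / 4))"
      using p by (simp add: spike_def powr_power)
    also have "\<dots> = inverse (s\<^sup>2 + \<tau>)"
      using p by (simp add: powr_minus)
    finally show ?thesis ..
  qed
  finally have "k ^ 4 \<le> (2 * spike \<tau> s) ^ 4"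
    by (simp add: power_mult_distrib)
  then show ?thesis
    using power_le_imp_le_base[of k 3 "2 * spike \<tau> s"] spike_nonneg[of \<tau> s] by (simp add: eval_nat_numeral)
qed

lemma has_laplacian_coordinate:
  assumes i: "i \<in> Basis" and F: "\<And>s. (F has_real_derivative F1 s) (at s)"
    "\<And>s. (F1 has_real_derivative F2 s) (at s)"
  shows "has_laplacian (\<lambda>x. F (x \<bullet> i)) x (F2 (x \<bullet> i))"
  unfolding has_laplacian_def
proof (intro exI[of _ "\<lambda>j. if j = i then F2 (x \<bullet> i) else 0"] conjI ballI)
  fix j :: 'a assume j: "j \<in> Basis"
  show "has_D2 (\<lambda>s. F ((x + s *\<^sub>R j) \<bullet> i)) (if j = i then F2 (x \<bullet> i) else 0)"
  proof (cases "j = i")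
    case True
    have shift: "((\<lambda>s. x \<bullet> i + s) has_real_derivative 1) (at s)" for s
      by (auto intro!: derivative_eq_intros)
    have "has_D2 (\<lambda>s. F (x \<bullet> i + s)) (F2 (x \<bullet> i))"
      using DERIV_chain2[OF F(1) shift] DERIV_chain2[OF F(2) shift, of 0]
      by (intro has_D2I[of _ "\<lambda>s. F1 (x \<bullet> i + s)"]) simp_all
    then show ?thesis using True i by (simp add: inner_add_left)
  next
    case False
    then show ?thesis using i j by (simp add: inner_add_left inner_Basis has_D2_const)
  qed
qed (use i in simp)

lemma GDERIV_coordinate:
  assumes "\<And>s. (F has_real_derivative F1 s) (at s)"
  shows "GDERIV (\<lambda>x. F (x \<bullet> i)) x :> F1 (x \<bullet> i) *\<^sub>R i"
proof (rule GDERIV_DERIV_compose[OF _ assms])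
  show "GDERIV (\<lambda>x. x \<bullet> i) x :> i"
    unfolding gderiv_def by (auto intro!: derivative_eq_intros)
qed

section \<open>Restriction, scaling and addition of weak solutions\<close>

lemma heat_approximable_subset:
  assumes "heat_approximable K w h" "K' \<subseteq> K"
  shows "heat_approximable K' w h"
  unfolding heat_approximable_def
proof (intro allI impI)
  fix e :: real assume "e > 0"
  then obtain w' h' where *: "continuous_on K w'"
    "\<forall>y\<in>K. \<bar>w' y - w y\<bar> < e \<and> \<bar>h' y - h y\<bar> < e \<and> classical_heat w' h' y"
    using assms(1) unfolding heat_approximable_def by blast
  then show "\<exists>w' h'. continuous_on K' w' \<and>
      (\<forall>y\<in>K'. \<bar>w' y - w y\<bar> < e \<and> \<bar>h' y - h y\<bar> < e \<and> classical_heat w' h' y)"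
    using assms(2) by (intro exI[of _ w'] exI[of _ h'] conjI continuous_on_subset[OF *(1)]) blast+
qed

lemma approx_heat_cmult:
  assumes "approx_heat V w h"
  shows "approx_heat V (\<lambda>z. c * w z) (\<lambda>z. c * h z)"
proof -
  have "heat_approximable K (\<lambda>z. c * w z) (\<lambda>z. c * h z)" if K: "heat_approximable K w h" for K
    unfolding heat_approximable_def
  proof (intro allI impI)
    fix e :: real assume e: "e > 0"
    \<comment> \<open>Using \<open>\<bar>c\<bar> + 1\<close> in place of
      \<open>\<bar>c\<bar>\<close> covers \<open>c = 0\<close>.\<close>
    have k: "\<bar>c * x - c * y\<bar> < e" if "\<bar>x - y\<bar> < e / (\<bar>c\<bar> + 1)" for x y
    proof -
      have "\<bar>c * x - c * y\<bar> = \<bar>c\<bar> * \<bar>x - y\<bar>"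
        by (simp add: abs_mult flip: right_diff_distrib)
      also have "\<dots> \<le> (\<bar>c\<bar> + 1) * \<bar>x - y\<bar>" by (intro mult_right_mono) auto
      also have "\<dots> < e" using that by (simp add: less_divide_eq mult.commute)
      finally show ?thesis .
    qed
    have "e / (\<bar>c\<bar> + 1) > 0" using e by (simp add: add_nonneg_pos)
    then obtain w' h' where *: "continuous_on K w'"
        "\<forall>y\<in>K. \<bar>w' y - w y\<bar> < e / (\<bar>c\<bar> + 1) \<and> \<bar>h' y - h y\<bar> < e / (\<bar>c\<bar> + 1) \<and>
          classical_heat w' h' y"
      using K unfolding heat_approximable_def by blast
    show "\<exists>w' h'. continuous_on K w' \<and> (\<forall>y\<in>K. \<bar>w' y - c * w y\<bar> < e \<and>
      \<bar>h' y - c * h y\<bar> < e \<and> classical_heat w' h' y)"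
      by (rule exI[of _ "\<lambda>z. c * w' z"], rule exI[of _ "\<lambda>z. c * h' z"])
         (use * k in \<open>auto intro!: continuous_intros classical_heat_cmult\<close>)
  qed
  then show ?thesis using assms unfolding approx_heat_def by meson
qed

lemma approx_heat_add:
  assumes "approx_heat V w h" "approx_heat V v k"
  shows "approx_heat V (\<lambda>z. w z + v z) (\<lambda>z. h z + k z)"
proof -
  have sum: "heat_approximable K (\<lambda>z. w z + v z) (\<lambda>z. h z + k z)"
    if K: "heat_approximable K w h" "heat_approximable K v k" for K
    unfolding heat_approximable_def
  proof (intro allI impI)
    fix e :: real assume "e > 0"
    then have e: "e / 2 > 0" by simp
    obtain w' h' where 1: "continuous_on K w'"
        "\<forall>y\<in>K. \<bar>w' y - w y\<bar> < e / 2 \<and> \<bar>h' y - h y\<bar> < e / 2 \<and> classical_heat w' h' y"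
      using K(1) e unfolding heat_approximable_def by blast
    obtain v' k' where 2: "continuous_on K v'"
        "\<forall>y\<in>K. \<bar>v' y - v y\<bar> < e / 2 \<and> \<bar>k' y - k y\<bar> < e / 2 \<and> classical_heat v' k' y"
      using K(2) e unfolding heat_approximable_def by blast
    have tri: "\<bar>a + b - (c + d)\<bar> < e" if "\<bar>a - c\<bar> < e / 2" "\<bar>b - d\<bar> < e / 2" for a b c d :: real
      using abs_triangle_ineq[of "a - c" "b - d"] that by (simp add: algebra_simps)
    show "\<exists>w' h'. continuous_on K w' \<and> (\<forall>y\<in>K. \<bar>w' y - (w y + v y)\<bar> < e \<and>
      \<bar>h' y - (h y + k y)\<bar> < e \<and> classical_heat w' h' y)"
      by (rule exI[of _ "\<lambda>z. w' z + v' z"], rule exI[of _ "\<lambda>z. h' z + k' z"])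
         (use 1 2 tri in \<open>auto intro!: continuous_on_add classical_heat_add\<close>)
  qed
  show ?thesis
    unfolding approx_heat_def
  proof
    fix z assume z: "z \<in> V"
    obtain r1 where r1: "r1 > 0" "cball z r1 \<subseteq> V" "heat_approximable (cball z r1) w h"
      using assms(1) z unfolding approx_heat_def by blast
    obtain r2 where r2: "r2 > 0" "heat_approximable (cball z r2) v k"
      using assms(2) z unfolding approx_heat_def by blast
    show "\<exists>r>0. cball z r \<subseteq> V \<and> heat_approximable (cball z r) (\<lambda>z. w z + v z) (\<lambda>z. h z + k z)"
      using r1 r2 by (intro exI[of _ "min r1 r2"])
        (auto intro!: sum elim!: heat_approximable_subset)
  qed
qed

lemma approx_heat_subset:
  assumes "approx_heat V w h" "V' \<subseteq> V" "open V'"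
  shows "approx_heat V' w h"
  unfolding approx_heat_def
proof
  fix z assume z: "z \<in> V'"
  then have "z \<in> V" using assms(2) by blast
  then obtain r1 where r1: "r1 > 0" "heat_approximable (cball z r1) w h"
    using assms(1) unfolding approx_heat_def by blast
  obtain r2 where r2: "r2 > 0" "cball z r2 \<subseteq> V'"
    using assms(3) z open_contains_cball by metis
  then show "\<exists>r>0. cball z r \<subseteq> V' \<and> heat_approximable (cball z r) w h"
    using r1 by (intro exI[of _ "min r1 r2"]) (auto elim!: heat_approximable_subset)
qed

text \<open>The boundary clause of \<open>parabolic_comparison\<close> comes from
  \<open>neumann_no_boundary_max\<close>: a barrier with positive slope along \<open>E q\<close>
  admits no boundary maximum of \<open>W - \<psi>\<close>.\<close>

lemma neumann_comparison:
  fixes \<Omega> :: "'a::euclidean_space set" and W \<psi> :: "'a \<times> real \<Rightarrow> real"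
  assumes \<Omega>: "open \<Omega>" "bounded \<Omega>" and bf: "boundary_field \<Omega> g E lap c"
    and cW: "continuous_on (closure \<Omega> \<times> {0..t1}) W"
    and W: "approx_heat (\<Omega> \<times> {0<..<t1}) W H" and cH: "continuous_on (\<Omega> \<times> {0<..<t1}) H"
    and nc: "neumann_condition \<Omega> {0<..<t1} (\<lambda>x t. W (x, t))"
    and c\<psi>: "continuous_on (closure \<Omega> \<times> {0..t1}) \<psi>"
    and \<psi>: "\<And>z. z \<in> \<Omega> \<times> {0<..<t1} \<Longrightarrow> classical_heat \<psi> P z"
    and cP: "continuous_on (\<Omega> \<times> {0<..<t1}) P"
    and grad: "\<And>q t. q \<in> frontier \<Omega> \<Longrightarrow> 0 < t \<Longrightarrow> t < t1 \<Longrightarrow>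
        GDERIV (\<lambda>x. \<psi> (x, t)) q :> \<Psi> q t \<and> \<Psi> q t \<bullet> E q > 0"
    and strict: "\<And>z. z \<in> \<Omega> \<times> {0<..<t1} \<Longrightarrow> \<psi> z < W z \<Longrightarrow> H z < P z"
    and init: "\<And>x. x \<in> closure \<Omega> \<Longrightarrow> W (x, 0) \<le> \<psi> (x, 0)"
    and x: "x \<in> closure \<Omega>" "0 \<le> s" "s < t1"
  shows "W (x, s) \<le> \<psi> (x, s)"
proof (rule parabolic_comparison[OF _ closure_subset \<Omega>(1) cW c\<psi> W cH \<psi> cP strict init _ x])
  show "compact (closure \<Omega>)" using \<Omega>(2) by simp
  fix q t assume q: "q \<in> closure \<Omega> - \<Omega>" and t: "0 < t" "t < t1"
  then have qf: "q \<in> frontier \<Omega>" using \<Omega>(1) by (simp add: frontier_def interior_open)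
  obtain D where D: "continuous_on (closure \<Omega> \<times> {0<..<t1}) (\<lambda>(x, t). D x t)"
    "\<And>x t. x \<in> \<Omega> \<Longrightarrow> t \<in> {0<..<t1} \<Longrightarrow> GDERIV (\<lambda>y. W (y, t)) x :> D x t"
    "\<And>n. outer_unit_normal \<Omega> q n \<Longrightarrow> D q t \<bullet> n = 0"
    using nc qf t unfolding neumann_condition_def by (metis greaterThanLessThan_iff)
  have slice: "continuous_on (closure \<Omega>) (\<lambda>x. (x, t))" by (intro continuous_intros)
  have DE: "D q t \<bullet> E q = 0" using bf qf D(3) unfolding boundary_field_def by blast
  obtain s0 where s0: "s0 > 0" "\<And>s. 0 < s \<Longrightarrow> s < s0 \<Longrightarrow> q + s *\<^sub>R (- E q) \<in> \<Omega>"
    using bf qf unfolding boundary_field_def by blast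
  show "\<exists>y\<in>closure \<Omega>. W (q, t) - \<psi> (q, t) < W (y, t) - \<psi> (y, t)"
  proof (rule neumann_no_boundary_max[where w = "\<lambda>x. W (x, t)" and \<psi> = "\<lambda>x. \<psi> (x, t)"
        and D = "\<lambda>x. D x t" and e = "E q" and \<Psi> = "\<Psi> q t", OF _ _ _ DE _ s0])
    show "continuous_on (closure \<Omega>) (\<lambda>x. W (x, t))"
      by (rule continuous_on_compose2[OF cW slice]) (use t in auto)
    show "continuous_on (closure \<Omega>) (\<lambda>x. D x t)"
      using continuous_on_compose2[OF D(1) slice] t by (simp add: image_subset_iff)
  qed (use D(2) t grad[OF qf t] q in auto)
qed

lemma boundary_field_bounds:
  assumes "boundary_field \<Omega> g E lap c" "bounded \<Omega>"
  obtains N B where "\<And>A. continuous_on A g" "\<And>y. y \<in> closure \<Omega> \<Longrightarrow> \<bar>g y\<bar> \<le> N"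
    "\<And>y. y \<in> closure \<Omega> \<Longrightarrow> \<bar>lap y\<bar> \<le> B"
proof -
  have comp: "compact (closure \<Omega>)" using assms by simp
  have g: "GDERIV g y :> E y" "continuous_on UNIV lap" for y
    using assms(1) by (auto simp: boundary_field_def)
  have cg: "continuous_on A g" for A
    using has_derivative_continuous[OF g(1)[unfolded gderiv_def]]
    by (simp add: continuous_at_imp_continuous_on)
  obtain N where N: "\<And>y. y \<in> closure \<Omega> \<Longrightarrow> \<bar>g y\<bar> \<le> N"
    using compact_imp_bounded[OF compact_continuous_image[OF cg comp]] by (auto simp: bounded_iff)
  obtain B where "\<And>y. y \<in> closure \<Omega> \<Longrightarrow> \<bar>lap y\<bar> \<le> B"
    using compact_imp_bounded[OF compact_continuous_image[OF continuous_on_subset[OF g(2)] comp]]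
    by (auto simp: bounded_iff)
  with cg N show thesis by (rule that)
qed

text \<open>The constant \<open>M\<close> is not a strict barrier, neither inside nor at the
  boundary. It is perturbed by \<sigma> (g + N + (B + 1) t): \<open>g\<close> gives the outward
  slope, \<open>N\<close> makes the perturbation nonnegative, and (B + 1) t exceeds the Laplacian of
  \<open>g\<close> by a positive margin.\<close>

lemma neumann_max_principle:
  fixes \<Omega> :: "'a::euclidean_space set" and W :: "'a \<times> real \<Rightarrow> real"
  assumes \<Omega>: "open \<Omega>" "bounded \<Omega>" and bf: "boundary_field \<Omega> g E lap c"
    and cW: "continuous_on (closure \<Omega> \<times> {0..t1}) W"
    and W: "approx_heat (\<Omega> \<times> {0<..<t1}) W H" and cH: "continuous_on (\<Omega> \<times> {0<..<t1}) H"
    and nc: "neumann_condition \<Omega> {0<..<t1} (\<lambda>x t. W (x, t))"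
    and H: "\<And>z. z \<in> \<Omega> \<times> {0<..<t1} \<Longrightarrow> M < W z \<Longrightarrow> H z \<le> 0"
    and init: "\<And>x. x \<in> closure \<Omega> \<Longrightarrow> W (x, 0) \<le> M"
    and x: "x \<in> closure \<Omega>" "0 \<le> s" "s < t1"
  shows "W (x, s) \<le> M"
proof (rule ccontr)
  assume "\<not> W (x, s) \<le> M"
  have g: "GDERIV g y :> E y" "has_laplacian g y (lap y)" "continuous_on UNIV lap" for y
    using bf by (auto simp: boundary_field_def)
  obtain N B where cg: "\<And>A. continuous_on A g" and N: "\<And>y. y \<in> closure \<Omega> \<Longrightarrow> \<bar>g y\<bar> \<le> N"
    and B: "\<And>y. y \<in> closure \<Omega> \<Longrightarrow> \<bar>lap y\<bar> \<le> B"
    using boundary_field_bounds[OF bf \<Omega>(2)] by metis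
  have B0: "B \<ge> 0" using B[OF x(1)] by simp
  define K where "K = g x + N + (B + 1) * s"
  have K: "K \<ge> 0" using N[OF x(1)] B0 x by (simp add: K_def)
  \<comment> \<open>Small enough that at \<open>(x, s)\<close> the perturbed barrier uses up at most
    half of the assumed excess over \<open>M\<close>.\<close>
  define \<sigma> where "\<sigma> = (W (x, s) - M) / (K + 1) / 2"
  have \<sigma>: "\<sigma> > 0" using \<open>\<not> W (x, s) \<le> M\<close> K by (simp add: \<sigma>_def)
  define \<psi> where "\<psi> z = \<sigma> * (g (fst z) + (N + (B + 1) * snd z)) + M" for z :: "'a \<times> real"
  define P where "P z = \<sigma> * (- lap (fst z) + (B + 1)) + 0" for z :: "'a \<times> real"
  have \<psi>M: "\<psi> (y, t) \<ge> M" if "y \<in> closure \<Omega>" "t \<ge> 0" for y t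
  proof -
    have "(B + 1) * t \<ge> 0" using B0 that(2) by simp
    then have "g y + (N + (B + 1) * t) \<ge> 0" using N[OF that(1)] by linarith
    then show ?thesis using \<sigma> by (simp add: \<psi>_def)
  qed
  have "W (x, s) \<le> \<psi> (x, s)"
  proof (rule neumann_comparison[OF \<Omega> bf cW W cH nc, where P = P and \<Psi> = "\<lambda>q t. \<sigma> *\<^sub>R E q"])
    show "continuous_on (closure \<Omega> \<times> {0..t1}) \<psi>"
      unfolding \<psi>_def by (intro continuous_intros continuous_on_compose2[OF cg]) auto
    show "continuous_on (\<Omega> \<times> {0<..<t1}) P"
      unfolding P_def by (intro continuous_intros continuous_on_compose2[OF g(3)]) auto
    have time: "((\<lambda>t. N + (B + 1) * t) has_real_derivative B + 1) (at t)" for t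
      by (auto intro!: derivative_eq_intros)
    have const: "((\<lambda>t. M) has_real_derivative 0) (at t)" for t :: real by simp
    show "classical_heat \<psi> P z" for z
      unfolding \<psi>_def[abs_def] P_def[abs_def]
      by (intro classical_heat_add classical_heat_cmult classical_heat_space[where g = g]
          classical_heat_time[where g = "\<lambda>t. N + (B + 1) * t" and g' = "\<lambda>_. B + 1"]
          classical_heat_time[where g = "\<lambda>_. M" and g' = "\<lambda>_. 0"] g(2) time const)
    fix q t assume q: "q \<in> frontier \<Omega>"
    have "GDERIV (\<lambda>x. \<psi> (x, t)) q :> \<sigma> *\<^sub>R E q"
      using GDERIV_add[OF GDERIV_mult[OF GDERIV_const[where k = \<sigma>]
            GDERIV_add[OF g(1) GDERIV_const[where k = "N + (B + 1) * t"]]] GDERIV_const[where k = M]]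
      by (simp add: \<psi>_def)
    moreover have "norm (E q) > 0" using bf q unfolding boundary_field_def by force
    ultimately show "GDERIV (\<lambda>x. \<psi> (x, t)) q :> \<sigma> *\<^sub>R E q \<and> \<sigma> *\<^sub>R E q \<bullet> E q > 0"
      using \<sigma> by simp
  next
    fix z assume z: "z \<in> \<Omega> \<times> {0<..<t1}" and lt: "\<psi> z < W z"
    have y: "fst z \<in> closure \<Omega>" using z closure_subset by fastforce
    have "M < W z" using \<psi>M[of "fst z" "snd z"] y z lt by fastforce
    then have "H z \<le> 0" using H z by blast
    moreover have "P z > 0" using B[OF y] \<sigma> by (simp add: P_def)
    ultimately show "H z < P z" by simp
  next
    fix y assume "y \<in> closure \<Omega>"
    then show "W (y, 0) \<le> \<psi> (y, 0)"
      using init[of y] \<psi>M[of y 0] by simp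
  qed (use x in auto)
  also have "\<psi> (x, s) = \<sigma> * K + M" by (simp add: \<psi>_def K_def algebra_simps)
  also have "\<sigma> * K \<le> \<sigma> * (K + 1)" using \<sigma> by simp
  also have "\<sigma> * (K + 1) = (W (x, s) - M) / 2" using K by (simp add: \<sigma>_def divide_simps)
  finally show False using \<open>\<not> W (x, s) \<le> M\<close> by (simp add: field_simps)
qed

lemma neumann_condition_cmult:
  assumes "neumann_condition \<Omega> I w"
  shows "neumann_condition \<Omega> I (\<lambda>x t. k * w x t)"
proof -
  obtain D where D: "continuous_on (closure \<Omega> \<times> I) (\<lambda>(x, t). D x t)"
          "\<forall>x\<in>\<Omega>. \<forall>t\<in>I. GDERIV (\<lambda>y. w y t) x :> D x t"
          "\<forall>q\<in>frontier \<Omega>. \<forall>t\<in>I. \<forall>n. outer_unit_normal \<Omega> q n \<longrightarrow> D q t \<bullet> n = 0"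
    using assms unfolding neumann_condition_def by blast
  have "GDERIV (\<lambda>y. k * w y t) x :> k *\<^sub>R D x t" if "x \<in> \<Omega>" "t \<in> I" for x t
    using GDERIV_mult[OF GDERIV_const[where k = k] D(2)[rule_format, OF that]] by simp
  then show ?thesis
    unfolding neumann_condition_def using D
    by (intro exI[of _ "\<lambda>x t. k *\<^sub>R D x t"]) (auto simp: split_def intro!: continuous_intros)
qed

text \<open>Fixes the order of quantifiers: \<open>K\<close> is chosen before the solution, the
  strength \<sigma> of the sink and the truncation \<tau>. So the loss \<sigma> K becomes small with
  \<sigma>.\<close>

definition lower_bound_constant :: "'a::euclidean_space set \<Rightarrow> real \<Rightarrow> bool" where
  "lower_bound_constant \<Omega> K \<longleftrightarrow> (\<forall>W H t1 m \<sigma> \<tau> i.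
     continuous_on (closure \<Omega> \<times> {0..t1}) W \<longrightarrow>
     approx_heat (\<Omega> \<times> {0<..<t1}) W H \<longrightarrow> continuous_on (\<Omega> \<times> {0<..<t1}) H \<longrightarrow>
     neumann_condition \<Omega> {0<..<t1} (\<lambda>x t. W (x, t)) \<longrightarrow>
     0 < \<sigma> \<longrightarrow> 0 < \<tau> \<longrightarrow> \<tau> \<le> 1 \<longrightarrow> t1 \<le> 1 \<longrightarrow> i \<in> Basis \<longrightarrow>
     (\<forall>z\<in>\<Omega> \<times> {0<..<t1}. W z < m \<longrightarrow> H z \<ge> - \<sigma> * spike \<tau> (fst z \<bullet> i)) \<longrightarrow>
     (\<forall>x\<in>closure \<Omega>. W (x, 0) \<ge> m) \<longrightarrow>
     (\<forall>x\<in>closure \<Omega>. \<forall>s\<in>{0..<t1}. W (x, s) \<ge> m - \<sigma> * K))"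

text \<open>The barrier bounds \<open>- W\<close> from above. In it \<open>- kink\<close> produces
  the source that beats the spike, \<open>A * g\<close> repairs the boundary slope that
  \<open>kink\<close> may spoil, and the part \<open>N + B * t\<close> ensures positivity and
  absorbs the Laplacian of \<open>A * g\<close>.\<close>

lemma neumann_lower_bound:
  fixes \<Omega> :: "'a::euclidean_space set"
  assumes \<Omega>: "open \<Omega>" "bounded \<Omega>" and bf: "boundary_field \<Omega> g E lap c"
  obtains K where "K > 0" "lower_bound_constant \<Omega> K"
proof -
  have comp: "compact (closure \<Omega>)" using \<Omega> by simp
  have g: "GDERIV g y :> E y" "has_laplacian g y (lap y)" "continuous_on UNIV lap" for y
    using bf by (auto simp: boundary_field_def)
  obtain N0 B0 where cg: "\<And>A. continuous_on A g" and N0: "\<And>y. y \<in> closure \<Omega> \<Longrightarrow> \<bar>g y\<bar> \<le> N0"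
    and B0: "\<And>y. y \<in> closure \<Omega> \<Longrightarrow> \<bar>lap y\<bar> \<le> B0"
    using boundary_field_bounds[OF bf \<Omega>(2)] by metis
  obtain R where R: "\<And>y. y \<in> closure \<Omega> \<Longrightarrow> norm y \<le> R"
    using compact_imp_bounded[OF comp] by (auto simp: bounded_iff)
  have c: "c > 0" using bf by (simp add: boundary_field_def)
  \<comment> \<open>Chosen so that the slope of \<open>A * g\<close> along the boundary field, at
    least \<open>A * c\<close>, exceeds the bound for \<open>kink1\<close> by one.\<close>
  define A where "A = (3 / 2 * (R\<^sup>2 + 1) + 1) / c"
  have A: "A > 0" "A * c = 3 / 2 * (R\<^sup>2 + 1) + 1"
    using c by (auto simp: A_def add_nonneg_pos)
  define N where "N = A * \<bar>N0\<bar> + R\<^sup>2 + 1"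
  define B where "B = A * \<bar>B0\<bar> + 1"
  \<comment> \<open>Here 4/3 undoes the 3/4 in \<open>kink2_ge_spike\<close>, and 2 N + B bounds the
    bracket of the barrier for times up to one.\<close>
  define K where "K = 4 / 3 * (2 * N + B)"
  have N: "N > 0" "B > 0" using A by (auto simp: N_def B_def add_nonneg_pos)
  then have K: "K > 0" by (simp add: K_def)
  have "lower_bound_constant \<Omega> K"
    unfolding lower_bound_constant_def
  proof (intro allI impI ballI)
    fix W H :: "'a \<times> real \<Rightarrow> real" and t1 m \<sigma> \<tau> s and x i :: 'a
    assume cW: "continuous_on (closure \<Omega> \<times> {0..t1}) W"
    and W: "approx_heat (\<Omega> \<times> {0<..<t1}) W H" and cH: "continuous_on (\<Omega> \<times> {0<..<t1}) H"
    and nc: "neumann_condition \<Omega> {0<..<t1} (\<lambda>x t. W (x, t))"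
    and par: "0 < \<sigma>" "0 < \<tau>" "\<tau> \<le> 1" "t1 \<le> 1" and i: "i \<in> Basis"
      and H: "\<forall>z\<in>\<Omega> \<times> {0<..<t1}. W z < m \<longrightarrow> H z \<ge> - \<sigma> * spike \<tau> (fst z \<bullet> i)"
      and init: "\<forall>x\<in>closure \<Omega>. W (x, 0) \<ge> m" and "x \<in> closure \<Omega>" "s \<in> {0..<t1}"
    then have x: "x \<in> closure \<Omega>" "0 \<le> s" "s < t1" by auto
    define S where "S = \<sigma> * (4 / 3)"
    have S: "S > 0" using par by (simp add: S_def)
    have si: "\<bar>y \<bullet> i\<bar> \<le> R" if "y \<in> closure \<Omega>" for y
      using Basis_le_norm[OF i, of y] R[OF that] by simp
    define G where "G y = A * g y + (- 1) * kink \<tau> (y \<bullet> i)" for y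
    have Gb: "\<bar>G y\<bar> \<le> N" if "y \<in> closure \<Omega>" for y
    proof -
      have "\<bar>A * g y\<bar> \<le> A * \<bar>N0\<bar>"
        using N0[OF that] A by (simp add: abs_mult)
      then show ?thesis
        using kink_le[OF par(2,3) si[OF that]] kink_nonneg[of \<tau> "y \<bullet> i"] unfolding G_def N_def by linarith
    qed
    define \<psi> where "\<psi> z = S * (G (fst z) + (N + B * snd z)) + (- m)" for z :: "'a \<times> real"
    define P where "P z = S * (- (A * lap (fst z) + (- 1) * kink2 \<tau> (fst z \<bullet> i)) + B) + 0"
      for z :: "'a \<times> real"
    have cG: "continuous_on A' G" for A'
      unfolding G_def by (intro continuous_intros cg continuous_kink par)
    have \<psi>m: "\<psi> (y, t) \<ge> - m" if "y \<in> closure \<Omega>" "t \<ge> 0" for y t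
    proof -
      have "B * t \<ge> 0" using N that(2) by simp
      then have "G y + (N + B * t) \<ge> 0" using Gb[OF that(1)] by linarith
      then show ?thesis using S by (simp add: \<psi>_def)
    qed
    have "(- 1) * W (x, s) \<le> \<psi> (x, s)"
    proof (rule neumann_comparison[OF \<Omega> bf, where W = "\<lambda>z. (- 1) * W z" and H = "\<lambda>z. (- 1) * H z"
          and P = P and \<Psi> = "\<lambda>q t. S *\<^sub>R (A *\<^sub>R E q - kink1 \<tau> (q \<bullet> i) *\<^sub>R i)" and ?t1.0 = t1])
      show "continuous_on (closure \<Omega> \<times> {0..t1}) (\<lambda>z. (- 1) * W z)"
        by (intro continuous_intros cW)
      show "approx_heat (\<Omega> \<times> {0<..<t1}) (\<lambda>z. (- 1) * W z) (\<lambda>z. (- 1) * H z)"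
        by (rule approx_heat_cmult[OF W])
      show "continuous_on (\<Omega> \<times> {0<..<t1}) (\<lambda>z. (- 1) * H z)"
        by (intro continuous_intros cH)
      show "neumann_condition \<Omega> {0<..<t1} (\<lambda>x t. (- 1) * W (x, t))"
        by (rule neumann_condition_cmult[OF nc])
      show "continuous_on (closure \<Omega> \<times> {0..t1}) \<psi>"
        unfolding \<psi>_def by (intro continuous_intros continuous_on_compose2[OF cG]) auto
      show "continuous_on (\<Omega> \<times> {0<..<t1}) P"
        unfolding P_def
        by (intro continuous_intros continuous_on_compose2[OF g(3)] continuous_kink2 par) auto
      have time: "((\<lambda>t. N + B * t) has_real_derivative B) (at t)" for t
        by (auto intro!: derivative_eq_intros)
      have const: "((\<lambda>t. - m) has_real_derivative 0) (at t)" for t :: real by simp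
      have "has_laplacian G y (A * lap y + (- 1) * kink2 \<tau> (y \<bullet> i))" for y
        unfolding G_def
        by (intro has_laplacian_add has_laplacian_cmult g(2)
            has_laplacian_coordinate[OF i kink_derivative[OF par(2)] kink1_derivative[OF par(2)]])
      note lapG = classical_heat_space[where g = G and L = "\<lambda>y. A * lap y + (- 1) * kink2 \<tau> (y \<bullet> i)", OF this]
      show "classical_heat \<psi> P z" for z
        unfolding \<psi>_def[abs_def] P_def[abs_def]
        by (intro classical_heat_add classical_heat_cmult lapG
            classical_heat_time[where g = "\<lambda>t. N + B * t" and g' = "\<lambda>_. B"]
            classical_heat_time[where g = "\<lambda>_. - m" and g' = "\<lambda>_. 0"] time const)
      fix q t assume q: "q \<in> frontier \<Omega>"
      have qc: "q \<in> closure \<Omega>" using q by (simp add: frontier_def)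
      have dG: "GDERIV G q :> A *\<^sub>R E q - kink1 \<tau> (q \<bullet> i) *\<^sub>R i"
        using GDERIV_diff[OF GDERIV_mult[OF GDERIV_const[where k = A] g(1)]
            GDERIV_coordinate[OF kink_derivative[OF par(2)]]]
        by (simp add: G_def[abs_def])
      have "GDERIV (\<lambda>x. \<psi> (x, t)) q :> S *\<^sub>R (A *\<^sub>R E q - kink1 \<tau> (q \<bullet> i) *\<^sub>R i)"
        using GDERIV_add[OF GDERIV_mult[OF GDERIV_const[where k = S]
              GDERIV_add[OF dG GDERIV_const[where k = "N + B * t"]]] GDERIV_const[where k = "- m"]]
        by (simp add: \<psi>_def)
      moreover have "(A *\<^sub>R E q - kink1 \<tau> (q \<bullet> i) *\<^sub>R i) \<bullet> E q > 0"
      proof -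
        have nE: "norm (E q) \<ge> c" using bf q unfolding boundary_field_def by blast
        have "\<bar>kink1 \<tau> (q \<bullet> i) * (i \<bullet> E q)\<bar> \<le> (3 / 2 * (R\<^sup>2 + 1)) * norm (E q)"
          unfolding abs_mult inner_commute[of i]
          by (intro mult_mono kink1_abs_le[OF par(2,3) si[OF qc]] Basis_le_norm[OF i]) auto
        also have "\<dots> < (A * c) * norm (E q)"
          unfolding A(2) using nE c by (intro mult_strict_right_mono) auto
        also have "\<dots> \<le> (A * norm (E q)) * norm (E q)"
          using nE A by (intro mult_right_mono mult_left_mono) auto
        also have "\<dots> = A * (E q \<bullet> E q)"
          by (simp add: power2_norm_eq_inner[symmetric] power2_eq_square)
        finally show ?thesis by (simp add: inner_diff_left abs_less_iff)
      qed
      ultimately show "GDERIV (\<lambda>x. \<psi> (x, t)) q :> S *\<^sub>R (A *\<^sub>R E q - kink1 \<tau> (q \<bullet> i) *\<^sub>R i) \<and>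
          S *\<^sub>R (A *\<^sub>R E q - kink1 \<tau> (q \<bullet> i) *\<^sub>R i) \<bullet> E q > 0"
        using S by simp
    next
      fix z assume z: "z \<in> \<Omega> \<times> {0<..<t1}" and lt: "\<psi> z < (- 1) * W z"
      have y: "fst z \<in> closure \<Omega>" using z closure_subset by fastforce
      have "W z < m" using \<psi>m[of "fst z" "snd z"] y z lt by fastforce
      then have "(- 1) * H z \<le> \<sigma> * spike \<tau> (fst z \<bullet> i)" using H[rule_format, OF z] by simp
      also have "\<dots> = S * (3 / 4 * spike \<tau> (fst z \<bullet> i))" by (simp add: S_def)
      also have "\<dots> \<le> S * kink2 \<tau> (fst z \<bullet> i)"
        using kink2_ge_spike[OF par(2)] S by (intro mult_left_mono) auto
      also have "\<dots> < P z"
      proof -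
        have "A * lap (fst z) \<le> A * \<bar>B0\<bar>"
          using B0[OF y] A by (intro mult_left_mono) auto
        then have "kink2 \<tau> (fst z \<bullet> i) < - (A * lap (fst z) + (- 1) * kink2 \<tau> (fst z \<bullet> i)) + B"
          by (simp add: B_def)
        then show ?thesis using S by (simp add: P_def)
      qed
      finally show "(- 1) * H z < P z" .
    next
      fix y assume "y \<in> closure \<Omega>"
      then show "(- 1) * W (y, 0) \<le> \<psi> (y, 0)"
        using init \<psi>m[of y 0] by fastforce
    qed (use x in auto)
    also have "\<psi> (x, s) \<le> \<sigma> * K - m"
    proof -
      have "B * s \<le> B * 1" using x par N by (intro mult_left_mono) auto
      then have "G x + (N + B * s) \<le> 2 * N + B"
        using Gb[OF x(1)] by (simp add: abs_le_iff)
      then have "S * (G x + (N + B * s)) \<le> S * (2 * N + B)"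
        using S by (intro mult_left_mono) auto
      moreover have "S * (2 * N + B) = \<sigma> * K" by (simp add: S_def K_def)
      ultimately show ?thesis by (simp add: \<psi>_def)
    qed
    finally show "W (x, s) \<ge> m - \<sigma> * K" by simp
  qed
  then show thesis using that[OF K] by blast
qed

subsection \<open>Interior Lipschitz estimate by reflection\<close>


text \<open>Reflection in the hyperplane \<open>x \<bullet> i = m\<close>, for \<open>i\<close> in
  \<open>Basis\<close>.\<close>

definition coord_reflect :: "'a::euclidean_space \<Rightarrow> real \<Rightarrow> 'a \<Rightarrow> 'a" where
  "coord_reflect i m x = x + (2 * (m - x \<bullet> i)) *\<^sub>R i"

lemma coord_reflect_inner_same: "i \<in> Basis \<Longrightarrow> coord_reflect i m x \<bullet> i = 2 * m - x \<bullet> i"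
  by (simp add: coord_reflect_def inner_add_left algebra_simps)

lemma coord_reflect_line:
  assumes "i \<in> Basis" "j \<in> Basis"
  shows "coord_reflect i m (x + s *\<^sub>R j) =
    coord_reflect i m x + (if j = i then - s else s) *\<^sub>R j"
  using assms
  by (cases "j = i") (auto simp: coord_reflect_def inner_add_left inner_Basis algebra_simps
      simp flip: scaleR_add_left)

lemma norm_coord_reflect_diff:
  assumes "i \<in> Basis"
  shows "norm (coord_reflect i m x - coord_reflect i m y) = norm (x - y)"
proof -
  define d where "d = x - y"
  have eq: "coord_reflect i m x - coord_reflect i m y = d - (2 * (d \<bullet> i)) *\<^sub>R i"
    by (simp add: coord_reflect_def d_def inner_diff_left algebra_simps)
  have "(d - (2 * (d \<bullet> i)) *\<^sub>R i) \<bullet> (d - (2 * (d \<bullet> i)) *\<^sub>R i) = d \<bullet> d"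
    using assms by (simp add: inner_diff_left inner_diff_right inner_commute algebra_simps)
  then show ?thesis
    unfolding eq by (simp add: norm_eq_sqrt_inner d_def[symmetric])
qed

lemma continuous_coord_reflect [continuous_intros]:
  "continuous_on A f \<Longrightarrow> continuous_on A (\<lambda>x. coord_reflect i m (f x))"
  unfolding coord_reflect_def by (intro continuous_intros)

section \<open>Invariance of the heat equation under coordinate reflections\<close>

lemma has_D2_uminus_arg:
  assumes "has_D2 f d"
  shows "has_D2 (\<lambda>s. f (- s)) d"
proof -
  obtain f' where f: "\<forall>\<^sub>F s in nhds 0. (f has_real_derivative f' s) (at s)"
    "(f' has_real_derivative d) (at 0)"
    using assms by (auto simp: has_D2_def)
  have neg: "((\<lambda>s. - s) has_real_derivative - 1) (at s)" for s :: real
    by (auto intro!: derivative_eq_intros)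
  obtain r where r: "r > 0" "\<And>s. \<bar>s\<bar> < r \<Longrightarrow> (f has_real_derivative f' s) (at s)"
    using f(1) by (auto simp: eventually_nhds_metric dist_real_def)
  have "((\<lambda>s. f (- s)) has_real_derivative - f' (- s)) (at s)" if "\<bar>s\<bar> < r" for s
    using DERIV_chain2[OF r(2) neg, of s] that by simp
  then have "\<forall>\<^sub>F s in nhds 0. ((\<lambda>s. f (- s)) has_real_derivative - f' (- s)) (at s)"
    using r(1) unfolding eventually_nhds_metric by (intro exI[of _ r]) (auto simp: dist_real_def)
  moreover have "((\<lambda>s. - f' (- s)) has_real_derivative d) (at 0)"
    using DERIV_minus[OF DERIV_chain2[OF _ neg, of f' d 0]] f(2) by simp
  ultimately show ?thesis
    unfolding has_D2_def by (intro exI[of _ "\<lambda>s. - f' (- s)"] conjI)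
qed

lemma has_laplacian_coord_reflect:
  assumes "has_laplacian g (coord_reflect i m x) L" and i: "i \<in> Basis"
  shows "has_laplacian (\<lambda>x. g (coord_reflect i m x)) x L"
proof -
  obtain d where d: "\<forall>j\<in>Basis. has_D2 (\<lambda>s. g (coord_reflect i m x + s *\<^sub>R j)) (d j)" "L = (\<Sum>j\<in>Basis. d j)"
    using assms(1) by (auto simp: has_laplacian_def)
  have "has_D2 (\<lambda>s. g (coord_reflect i m (x + s *\<^sub>R j))) (d j)" if j: "j \<in> Basis" for j
  proof (cases "j = i")
    case True
    then show ?thesis
      using has_D2_uminus_arg[OF d(1)[rule_format, OF j]] coord_reflect_line[OF i j] by simp
  next
    case False
    then show ?thesis
      using d(1) j coord_reflect_line[OF i j] by simp
  qed
  then show ?thesis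
    unfolding has_laplacian_def using d(2) by (intro exI[of _ d]) simp
qed

lemma approx_heat_coord_reflect:
  fixes i :: "'a::euclidean_space"
  assumes "approx_heat V w h" and i: "i \<in> Basis" and "open V'"
    and V': "\<And>x t. (x, t) \<in> V' \<Longrightarrow> (coord_reflect i m x, t) \<in> V"
  shows "approx_heat V' (\<lambda>z. w (coord_reflect i m (fst z), snd z))
    (\<lambda>z. h (coord_reflect i m (fst z), snd z))"
  unfolding approx_heat_def
proof
  let ?T = "\<lambda>z::'a \<times> real. (coord_reflect i m (fst z), snd z)"
  fix z assume z: "z \<in> V'"
  then have "?T z \<in> V" using V' by (cases z) auto
  then obtain r1 where r1: "r1 > 0" and appr: "heat_approximable (cball (?T z) r1) w h"
    using assms(1) unfolding approx_heat_def by blast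
  obtain r2 where r2: "r2 > 0" "cball z r2 \<subseteq> V'"
    using assms(3) z open_contains_cball by metis
  define r where "r = min r1 r2"
  have T: "?T y \<in> cball (?T z) r1" if "y \<in> cball z r" for y
    using that by (simp add: r_def dist_prod_def dist_norm norm_coord_reflect_diff[OF i])
  have "\<exists>w' h'. continuous_on (cball z r) w' \<and> (\<forall>y\<in>cball z r. \<bar>w' y - w (?T y)\<bar> < e \<and>
      \<bar>h' y - h (?T y)\<bar> < e \<and> classical_heat w' h' y)" if "e > 0" for e
  proof -
    obtain w' h' where *: "continuous_on (cball (?T z) r1) w'"
        "\<And>y. y\<in>cball (?T z) r1 \<Longrightarrow> \<bar>w' y - w y\<bar> < e"
        "\<And>y. y\<in>cball (?T z) r1 \<Longrightarrow> \<bar>h' y - h y\<bar> < e"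
        "\<And>y. y\<in>cball (?T z) r1 \<Longrightarrow> classical_heat w' h' y"
      using appr \<open>e > 0\<close> unfolding heat_approximable_def by blast
    show ?thesis
    proof (rule exI[of _ "\<lambda>z. w' (?T z)"], rule exI[of _ "\<lambda>z. h' (?T z)"], intro conjI ballI)
      show "continuous_on (cball z r) (\<lambda>z. w' (?T z))"
        using T by (intro continuous_on_compose2[OF *(1)] continuous_intros) auto
      fix y assume y: "y \<in> cball z r"
      show "\<bar>w' (?T y) - w (?T y)\<bar> < e" "\<bar>h' (?T y) - h (?T y)\<bar> < e"
        using *(2,3) T[OF y] by blast+
      obtain L where "has_laplacian (\<lambda>u. w' (u, snd y)) (coord_reflect i m (fst y)) L"
        "((\<lambda>s. w' (coord_reflect i m (fst y), s)) has_real_derivative L + h' (?T y)) (at (snd y))"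
        using *(4)[OF T[OF y]] by (auto simp: classical_heat_def)
      then show "classical_heat (\<lambda>z. w' (?T z)) (\<lambda>z. h' (?T z)) y"
        unfolding classical_heat_def
        using has_laplacian_coord_reflect[of "\<lambda>u. w' (u, snd y)", OF _ i]
        by (intro exI[of _ L]) simp
    qed
  qed
  then show "\<exists>r>0. cball z r \<subseteq> V' \<and> heat_approximable (cball z r) (\<lambda>z. w (?T z)) (\<lambda>z. h (?T z))"
    unfolding heat_approximable_def using r1 r2 by (intro exI[of _ r]) (auto simp: r_def)
qed

text \<open>The type argument records the space, and with it the dimension. The constant \<Lambda>
  is fixed before \<tau>, \<open>t1\<close> and the solution; the larger ball leaves room for
  reflected points.\<close>

definition lipschitz_constant ::
    "'a::euclidean_space itself \<Rightarrow> real \<Rightarrow> real \<Rightarrow> real \<Rightarrow> real \<Rightarrow> real \<Rightarrow> bool" where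
  "lipschitz_constant _ r M C0 C1 \<Lambda> \<longleftrightarrow> (\<forall>v h t1 c \<tau> (i::'a) y d s.
     continuous_on (ball 0 (5 * r) \<times> {0..t1}) v \<longrightarrow>
     approx_heat (ball 0 (5 * r) \<times> {0<..<t1}) v h \<longrightarrow>
     continuous_on (ball 0 (5 * r) \<times> {0<..<t1}) h \<longrightarrow>
     (\<forall>z\<in>ball 0 (5 * r) \<times> {0..t1}. 0 \<le> v z \<and> v z \<le> M) \<longrightarrow>
     (\<forall>x\<in>ball 0 (5 * r). v (x, 0) = c) \<longrightarrow> 0 < \<tau> \<longrightarrow> \<tau> \<le> 1 \<longrightarrow> i \<in> Basis \<longrightarrow>
     (\<forall>z\<in>ball 0 (5 * r) \<times> {0<..<t1}. \<bar>h z\<bar> \<le> C0 + C1 * spike \<tau> (fst z \<bullet> i)) \<longrightarrow>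
     norm y \<le> r / 2 \<longrightarrow> norm (y + d *\<^sub>R i) \<le> r / 2 \<longrightarrow> 0 < d \<longrightarrow> s \<in> {0..<t1} \<longrightarrow>
     \<bar>v (y + d *\<^sub>R i, s) - v (y, s)\<bar> \<le> \<Lambda> * d)"

text \<open>The odd part of \<open>v\<close> with respect to the hyperplane halfway between two points vanishes on that
  hyperplane, so a barrier in a half ball that vanishes linearly there bounds the difference quotient.\<close>

lemma heat_coordinate_lipschitz:
  assumes r: "r > 0" and M: "M \<ge> 0" and C: "C0 \<ge> 0" "C1 \<ge> 0"
  obtains \<Lambda> where "\<Lambda> \<ge> 0" "lipschitz_constant TYPE('a::euclidean_space) r M C0 C1 \<Lambda>"
proof -
  define n where "n = real DIM('a)"
  \<comment> \<open>Chosen so that B (r/2)^2 = M: on the spherical part of the boundary, at distance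
    at least r/2 from \<open>y'\<close>, the quadratic term alone dominates the odd part.\<close>
  define B where "B = 4 * M / r\<^sup>2"
  define E where "E = 4 / 3 * C1"
  \<comment> \<open>Twice \<open>E'\<close> pays for the Laplacian 2 n B of the quadratic term and
    for the constant \<open>C0\<close> of both sources, with 2 left over for strictness.\<close>
  define E' where "E' = n * B + C0 + 1"
  define Gb where "Gb = 3 / 2 * ((3 * r)\<^sup>2 + 1)"
  \<comment> \<open>The largest amount by which the concave terms can reduce the slope of
    \<open>F\<close> on an interval of length 2 r; this gives \<open>0 \<le> F1\<close> and
    \<open>F1 \<le> 2 * \<Lambda>\<close>.\<close>
  define \<Lambda> where "\<Lambda> = 2 * E * Gb + 4 * E' * r"
  have nn: "n \<ge> 0" "B \<ge> 0" "E \<ge> 0" "E' \<ge> 0" "Gb \<ge> 0"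
    using r M C by (auto simp: n_def B_def E_def E'_def Gb_def)
  then have \<Lambda>: "\<Lambda> \<ge> 0" using r by (simp add: \<Lambda>_def)
  have "lipschitz_constant TYPE('a) r M C0 C1 \<Lambda>"
    unfolding lipschitz_constant_def
  proof (intro allI impI)
    fix v h :: "'a \<times> real \<Rightarrow> real" and t1 vb \<tau> and i y :: 'a and d s
    assume cv: "continuous_on (ball 0 (5 * r) \<times> {0..t1}) v"
      and v: "approx_heat (ball 0 (5 * r) \<times> {0<..<t1}) v h"
      and ch: "continuous_on (ball 0 (5 * r) \<times> {0<..<t1}) h"
      and v0M: "\<forall>z\<in>ball 0 (5 * r) \<times> {0..t1}. 0 \<le> v z \<and> v z \<le> M"
      and init: "\<forall>x\<in>ball 0 (5 * r). v (x, 0) = vb"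
      and \<tau>: "0 < \<tau>" "\<tau> \<le> 1" and i: "i \<in> Basis"
      and h: "\<forall>z\<in>ball 0 (5 * r) \<times> {0<..<t1}. \<bar>h z\<bar> \<le> C0 + C1 * spike \<tau> (fst z \<bullet> i)"
      and y: "norm y \<le> r / 2" "norm (y + d *\<^sub>R i) \<le> r / 2" and d: "0 < d" and s: "s \<in> {0..<t1}"
    define m where "m = y \<bullet> i + d / 2"
    define y' where "y' = y + d *\<^sub>R i"
    let ?R = "coord_reflect i m"
    have y'i: "y' \<bullet> i = m + d / 2" using i by (simp add: y'_def m_def inner_add_left)
    have Ry': "?R y' = y"
      using y'i by (simp add: coord_reflect_def y'_def)
    have ny': "norm y' \<le> r / 2" using y(2) by (simp add: y'_def)
    have m: "\<bar>m\<bar> \<le> r / 2"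
      using Basis_le_norm[OF i, of y] Basis_le_norm[OF i, of y'] y(1) ny' y'i d
      unfolding m_def abs_le_iff by linarith
    \<comment> \<open>With |m| \<le> r/2 and |x| \<le> r the reflection moves \<open>x\<close> by at
      most 3 r.\<close>
    have R5: "?R x \<in> ball 0 (5 * r)" if "norm x \<le> r" for x
    proof -
      have "\<bar>2 * (m - x \<bullet> i)\<bar> \<le> 3 * r"
      proof -
        have "x \<bullet> i \<le> r" "- r \<le> x \<bullet> i" "m \<le> r / 2" "- (r / 2) \<le> m"
          using m Basis_le_norm[OF i, of x] that unfolding abs_le_iff by linarith+
        then show ?thesis unfolding abs_le_iff by (intro conjI; simp)
      qed
      moreover have "norm (?R x) \<le> norm x + \<bar>2 * (m - x \<bullet> i)\<bar>"
        unfolding coord_reflect_def using norm_triangle_ineq[of x "(2 * (m - x \<bullet> i)) *\<^sub>R i"] i by simp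
      ultimately show ?thesis using that r by simp
    qed
    \<comment> \<open>The odd part has sources singular at \<open>x \<bullet> i = 0\<close> and at
      the mirror image of this hyperplane, whence two kinks. Subtracting their common value at
      \<open>m\<close> makes \<open>F\<close> vanish there.\<close>
    define F where "F u = \<Lambda> * (u - m) + (- E) * (kink \<tau> u + kink \<tau> (2 * m - u) - 2 * kink \<tau> m) - E' * (u - m)\<^sup>2" for u
    define F1 where "F1 u = \<Lambda> - E * (kink1 \<tau> u - kink1 \<tau> (2 * m - u)) - 2 * E' * (u - m)" for u
    define F2 where "F2 u = - E * (kink2 \<tau> u + kink2 \<tau> (2 * m - u)) - 2 * E'" for u
    have neg: "((\<lambda>u. 2 * m - u) has_real_derivative - 1) (at u)" for u
      by (auto intro!: derivative_eq_intros)
    have dF: "(F has_real_derivative F1 u) (at u)" for u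
      unfolding F_def[abs_def] F1_def
      by (rule derivative_eq_intros kink_derivative[OF \<tau>(1)] DERIV_chain2[OF kink_derivative[OF \<tau>(1)] neg] refl)+
         (simp add: algebra_simps)
    have dF1: "(F1 has_real_derivative F2 u) (at u)" for u
      unfolding F1_def[abs_def] F2_def
      by (rule derivative_eq_intros kink1_derivative[OF \<tau>(1)] DERIV_chain2[OF kink1_derivative[OF \<tau>(1)] neg] refl)+
         (simp add: algebra_simps)
    have F1b: "0 \<le> F1 u" "F1 u \<le> 2 * \<Lambda>" if "m \<le> u" "u \<le> m + 2 * r" for u
    proof -
      have "\<bar>kink1 \<tau> u\<bar> \<le> Gb" "\<bar>kink1 \<tau> (2 * m - u)\<bar> \<le> Gb"
        unfolding Gb_def
        by (rule kink1_abs_le[OF \<tau>], use m that r in arith)+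
      then have "\<bar>kink1 \<tau> u - kink1 \<tau> (2 * m - u)\<bar> \<le> 2 * Gb" by (simp add: abs_le_iff)
      then have 1: "\<bar>E * (kink1 \<tau> u - kink1 \<tau> (2 * m - u))\<bar> \<le> E * (2 * Gb)"
        using nn by (simp add: abs_mult mult_left_mono)
      have 2: "0 \<le> 2 * E' * (u - m)"
        using nn that by simp
      have 3: "2 * E' * (u - m) \<le> 2 * E' * (2 * r)"
        using nn that by (intro mult_left_mono) simp_all
      show "0 \<le> F1 u" "F1 u \<le> 2 * \<Lambda>"
        using 1 2 3 nn r unfolding F1_def \<Lambda>_def abs_le_iff by (simp_all add: algebra_simps)
    qed
    have Fm: "F m = 0" by (simp add: F_def)
    have Fb: "0 \<le> F u" "F u \<le> 2 * \<Lambda> * (u - m)" if "m \<le> u" "u \<le> m + 2 * r" for u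
    proof -
      have "0 \<le> F u \<and> F u \<le> 2 * \<Lambda> * (u - m)"
      proof (cases "u = m")
        case False
        then have "m < u" using that by simp
        from MVT2[OF this, of F F1] dF
        obtain z where z: "m < z" "z < u" "F u - F m = (u - m) * F1 z" by blast
        have "0 \<le> F1 z" "F1 z \<le> 2 * \<Lambda>" using F1b[of z] z that by auto
        then have "0 \<le> (u - m) * F1 z" "(u - m) * F1 z \<le> (u - m) * (2 * \<Lambda>)"
          using that by (auto intro: mult_left_mono)
        then show ?thesis using z(3) Fm by (simp add: mult.commute)
      qed (simp add: Fm)
      then show "0 \<le> F u" "F u \<le> 2 * \<Lambda> * (u - m)" by auto
    qed
    define Cs where "Cs = cball 0 r \<inter> {x. m \<le> x \<bullet> i}"
    define U where "U = ball 0 r \<inter> {x. m < x \<bullet> i}"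
    have C_range: "m \<le> x \<bullet> i" "x \<bullet> i \<le> m + 2 * r" if "x \<in> Cs" for x
      using that m Basis_le_norm[OF i, of x] r by (auto simp: Cs_def abs_le_iff)
    have cC: "compact Cs"
      unfolding Cs_def
      by (intro compact_Int_closed compact_cball) (simp add: closed_halfspace_component_ge)
    have oU: "open U"
      unfolding U_def by (intro open_Int open_ball) (simp add: open_halfspace_component_gt)
    have UC: "U \<subseteq> Cs" by (auto simp: U_def Cs_def)
    have C5: "x \<in> ball 0 (5 * r)" "?R x \<in> ball 0 (5 * r)" if "x \<in> Cs" for x
      using that R5[of x] r by (auto simp: Cs_def)
    define \<psi> where "\<psi> z = F (fst z \<bullet> i) + B * (norm (fst z - y'))\<^sup>2" for z :: "'a \<times> real"
    define P where "P z = - (F2 (fst z \<bullet> i) + B * (2 * n))" for z :: "'a \<times> real"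
    \<comment> \<open>The two signs \<open>\<theta>\<close> yield the two halves of the absolute
      value.\<close>
    have key: "\<theta> * (v (y', s) - v (y, s)) \<le> \<Lambda> * d" if \<theta>: "\<theta> = 1 \<or> \<theta> = - 1" for \<theta>
    proof -
      define W where "W z = \<theta> * (v z + (- 1) * v (?R (fst z), snd z))" for z
      define H where "H z = \<theta> * (h z + (- 1) * h (?R (fst z), snd z))" for z
      have WM: "W (x, t) \<le> M" if "x \<in> Cs" "t \<in> {0..t1}" for x t
        using v0M[rule_format, of "(x, t)"] v0M[rule_format, of "(?R x, t)"] C5[OF that(1)] that(2) \<theta> unfolding W_def by auto
      \<comment> \<open>On the flat part of the boundary the reflection fixes \<open>x\<close> and
        \<open>W\<close> is 0; on the spherical part the quadratic term exceeds \<open>M\<close>, or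
        equals it. So the boundary clause of the comparison is vacuous.\<close>
      have W\<psi>: "W (x, t) \<le> \<psi> (x, t)" if "x \<in> Cs - U" "t \<in> {0..t1}" for x t
      proof (cases "x \<bullet> i = m")
        case True
        then have "?R x = x" by (simp add: coord_reflect_def)
        then have "W (x, t) = 0" by (simp add: W_def)
        then show ?thesis using nn True Fm by (simp add: \<psi>_def)
      next
        case False
        then have "norm x = r" using that(1) by (auto simp: Cs_def U_def)
        then have "norm (x - y') \<ge> r / 2"
          using norm_triangle_ineq2[of x y'] ny' by simp
        then have "(r / 2)\<^sup>2 \<le> (norm (x - y'))\<^sup>2"
          using r by (intro power_mono) auto
        then have "B * (r / 2)\<^sup>2 \<le> B * (norm (x - y'))\<^sup>2"
          using nn by (intro mult_left_mono) auto
        moreover have "B * (r / 2)\<^sup>2 = M" using r by (simp add: B_def power_divide)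
        moreover have "F (x \<bullet> i) \<ge> 0" using Fb C_range[of x] that by auto
        ultimately show ?thesis using WM[of x t] that by (simp add: \<psi>_def)
      qed
      have dom: "U \<times> {0<..<t1} \<subseteq> ball 0 (5 * r) \<times> {0<..<t1}"
        using C5(1) UC by blast
      have domR: "(?R (fst z), snd z) \<in> ball 0 (5 * r) \<times> {0<..<t1}" if "z \<in> U \<times> {0<..<t1}" for z
        using C5(2) UC that by auto
      have "W (y', s) \<le> \<psi> (y', s)"
      proof (rule parabolic_comparison[OF cC UC oU, where W = W and H = H and P = P])
        have "continuous_on (Cs \<times> {0..t1}) v"
          by (rule continuous_on_subset[OF cv]) (use C5 in auto)
        moreover have "continuous_on (Cs \<times> {0..t1}) (\<lambda>z. v (?R (fst z), snd z))"
          by (rule continuous_on_compose2[OF cv]) (use C5 in \<open>auto intro!: continuous_intros\<close>)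
        ultimately show "continuous_on (Cs \<times> {0..t1}) W"
          unfolding W_def by (intro continuous_intros)
        have cF: "continuous_on A F" for A
          using dF by (meson DERIV_isCont continuous_at_imp_continuous_on)
        show "continuous_on (Cs \<times> {0..t1}) \<psi>"
          unfolding \<psi>_def by (intro continuous_intros continuous_on_compose2[OF cF]) auto
        show "approx_heat (U \<times> {0<..<t1}) W H"
          unfolding W_def H_def
        proof (intro approx_heat_cmult approx_heat_add)
          show "approx_heat (U \<times> {0<..<t1}) v h"
            by (rule approx_heat_subset[OF v dom]) (intro open_Times oU open_greaterThanLessThan)
          show "approx_heat (U \<times> {0<..<t1}) (\<lambda>z. v (?R (fst z), snd z)) (\<lambda>z. h (?R (fst z), snd z))"
            by (rule approx_heat_coord_reflect[OF v i])
               (use domR in \<open>auto intro!: open_Times oU\<close>)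
        qed
        have "continuous_on (U \<times> {0<..<t1}) h"
          by (rule continuous_on_subset[OF ch dom])
        moreover have "continuous_on (U \<times> {0<..<t1}) (\<lambda>z. h (?R (fst z), snd z))"
          by (rule continuous_on_compose2[OF ch]) (use domR in \<open>auto intro!: continuous_intros\<close>)
        ultimately show "continuous_on (U \<times> {0<..<t1}) H"
          unfolding H_def by (intro continuous_intros)
        have "has_laplacian (\<lambda>x. F (x \<bullet> i) + B * (norm (x - y'))\<^sup>2) x (F2 (x \<bullet> i) + B * (2 * n))" for x
          unfolding n_def
          by (intro has_laplacian_add has_laplacian_cmult has_laplacian_norm_power2
              has_laplacian_coordinate[OF i dF dF1])
        then show "classical_heat \<psi> P z" for z
          unfolding \<psi>_def[abs_def] P_def[abs_def]
          by (rule classical_heat_space[where L = "\<lambda>x. F2 (x \<bullet> i) + B * (2 * n)"])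
        show "continuous_on (U \<times> {0<..<t1}) P"
          unfolding P_def F2_def by (intro continuous_intros continuous_kink2 \<tau>)
        show "W (x, 0) \<le> \<psi> (x, 0)" if x: "x \<in> Cs" for x
        proof -
          have "W (x, 0) = 0" using init C5[OF x] by (simp add: W_def)
          then show ?thesis using Fb(1)[OF C_range[OF x]] nn by (simp add: \<psi>_def)
        qed
        show "\<exists>y\<in>Cs. W (x, t) - \<psi> (x, t) < W (y, t) - \<psi> (y, t)"
          if "x \<in> Cs - U" "0 < t" "t < t1" "\<psi> (x, t) < W (x, t)" for x t
          using W\<psi>[of x t] that by auto
        show "y' \<in> Cs" using ny' r y'i d by (simp add: Cs_def)
        show "H z < P z" if z: "z \<in> U \<times> {0<..<t1}" for z
        proof -
          let ?u = "fst z \<bullet> i"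
          have "\<bar>h z\<bar> \<le> C0 + C1 * spike \<tau> ?u"
            using h[rule_format, OF subsetD[OF dom z]] .
          moreover have "\<bar>h (?R (fst z), snd z)\<bar> \<le> C0 + C1 * spike \<tau> (2 * m - ?u)"
            using h[rule_format, OF domR[OF z]] coord_reflect_inner_same[OF i] by simp
          ultimately have "H z \<le> 2 * C0 + (C1 * spike \<tau> ?u + C1 * spike \<tau> (2 * m - ?u))"
            using \<theta> unfolding H_def by (auto simp: abs_le_iff)
          also have "C1 * spike \<tau> u' \<le> E * kink2 \<tau> u'" for u'
            using mult_left_mono[OF kink2_ge_spike[OF \<tau>(1), of u'] nn(3)] by (simp add: E_def)
          from add_mono[OF this[of ?u] this[of "2 * m - ?u"]]
          have "2 * C0 + (C1 * spike \<tau> ?u + C1 * spike \<tau> (2 * m - ?u)) < P z"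
            by (simp add: P_def F2_def E'_def algebra_simps)
          finally show ?thesis .
        qed
      qed (use s in auto)
      \<comment> \<open>The quadratic term is centred at \<open>y'\<close> and vanishes there, and
        \<open>y'\<close> lies at distance \<open>d / 2\<close> from the hyperplane.\<close>
      also have "\<psi> (y', s) \<le> 2 * \<Lambda> * (d / 2)"
        using Fb(2)[of "m + d / 2"] C_range[of y'] ny' r y'i d by (simp add: \<psi>_def Cs_def)
      finally show ?thesis by (simp add: W_def Ry')
    qed
    show "\<bar>v (y + d *\<^sub>R i, s) - v (y, s)\<bar> \<le> \<Lambda> * d"
      using key[of 1] key[of "- 1"] by (simp add: y'_def abs_le_iff)
  qed
  then show thesis using that[OF \<Lambda>] by blast
qed

text \<open>The origin is joined to \<open>x\<close> by adding one coordinate at a time. The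
  vertices of this path have norm at most DIM times |x|, so they stay where the coordinate estimate
  holds.\<close>

lemma heat_lipschitz_origin:
  fixes v :: "'a::euclidean_space \<Rightarrow> real"
  assumes \<Lambda>: "\<Lambda> \<ge> 0"
    and step: "\<And>i y d. i \<in> Basis \<Longrightarrow> norm y \<le> \<rho> \<Longrightarrow> norm (y + d *\<^sub>R i) \<le> \<rho> \<Longrightarrow> d > 0 \<Longrightarrow>
      \<bar>v (y + d *\<^sub>R i) - v y\<bar> \<le> \<Lambda> * d"
    and x: "real DIM('a) * norm x \<le> \<rho>"
  shows "\<bar>v x - v 0\<bar> \<le> real DIM('a) * (\<Lambda> * norm x)"
proof -
  have nb: "norm (\<Sum>i\<in>A. (x \<bullet> i) *\<^sub>R i) \<le> \<rho>" if "A \<subseteq> Basis" for A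
  proof -
    have "norm (\<Sum>i\<in>A. (x \<bullet> i) *\<^sub>R i) \<le> (\<Sum>i\<in>A. norm x)"
    proof (rule sum_norm_le)
      show "norm ((x \<bullet> i) *\<^sub>R i) \<le> norm x" if "i \<in> A" for i
        using Basis_le_norm[of i x] \<open>A \<subseteq> Basis\<close> that by auto
    qed
    also have "\<dots> = real (card A) * norm x" by simp
    also have "\<dots> \<le> real DIM('a) * norm x"
      using card_mono[OF finite_Basis that] by (intro mult_right_mono) auto
    finally show ?thesis using x by simp
  qed
  have step': "\<bar>v (y + d *\<^sub>R i) - v y\<bar> \<le> \<Lambda> * \<bar>d\<bar>"
    if i: "i \<in> Basis" and "norm y \<le> \<rho>" "norm (y + d *\<^sub>R i) \<le> \<rho>" for i y d
  proof -
    consider "d > 0" | "d = 0" | "d < 0" by linarith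
    then show ?thesis
    proof cases
      case 1
      then show ?thesis using step[OF that] by simp
    next
      case 3
      then show ?thesis
        using step[OF i, of "y + d *\<^sub>R i" "- d"] that by (simp add: abs_minus_commute)
    qed simp
  qed
  have "\<bar>v (\<Sum>i\<in>A. (x \<bullet> i) *\<^sub>R i) - v 0\<bar> \<le> real (card A) * (\<Lambda> * norm x)" if "A \<subseteq> Basis" for A
    using finite_subset[OF that finite_Basis] that
  proof (induction A rule: finite_induct)
    case (insert i A)
    let ?y = "\<Sum>i\<in>A. (x \<bullet> i) *\<^sub>R i"
    have i: "i \<in> Basis" and A: "A \<subseteq> Basis" using insert by auto
    have eq: "(\<Sum>i\<in>insert i A. (x \<bullet> i) *\<^sub>R i) = ?y + (x \<bullet> i) *\<^sub>R i"
      using insert by simp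
    have "\<bar>v (?y + (x \<bullet> i) *\<^sub>R i) - v ?y\<bar> \<le> \<Lambda> * \<bar>x \<bullet> i\<bar>"
      using step'[OF i nb[OF A]] nb[OF insert.prems] unfolding eq by blast
    also have "\<dots> \<le> \<Lambda> * norm x"
      using Basis_le_norm[OF i] \<Lambda> by (intro mult_left_mono) auto
    finally have "\<bar>v (?y + (x \<bullet> i) *\<^sub>R i) - v ?y\<bar> \<le> \<Lambda> * norm x" .
    moreover have "\<bar>v ?y - v 0\<bar> \<le> real (card A) * (\<Lambda> * norm x)"
      using insert.IH A by blast
    moreover have "real (card (insert i A)) * (\<Lambda> * norm x) = real (card A) * (\<Lambda> * norm x) + \<Lambda> * norm x"
      using insert by (simp add: algebra_simps)
    ultimately show ?case unfolding eq by linarith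
  qed simp
  from this[OF subset_refl] show ?thesis
    by (simp add: euclidean_representation)
qed

subsection \<open>A priori estimates\<close>


text \<open>Positivity of the infimum in the extended reals yields a positive real lower bound.
  Hence the set is bounded below and the real-valued infimum in the theorem is the genuine
  one.\<close>

lemma admissible_INF:
  assumes "admissible_nonlinearity f" "R > 0"
  shows "0 < (INF v\<in>{R..}. f v)" "\<And>v. v \<ge> R \<Longrightarrow> (INF v\<in>{R..}. f v) \<le> f v"
proof -
  have "0 < (INF v\<in>{R..}. ereal (f v))"
    using assms by (auto simp: admissible_nonlinearity_def)
  then obtain c where c: "0 < ereal c" "ereal c < (INF v\<in>{R..}. ereal (f v))"
    using ereal_dense2 by blast
  have lb: "c \<le> f v" if "v \<ge> R" for v
  proof -
    have "(INF v\<in>{R..}. ereal (f v)) \<le> ereal (f v)"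
      using that by (intro INF_lower) auto
    with c(2) have "ereal c < ereal (f v)" by (rule less_le_trans)
    then show ?thesis by simp
  qed
  have "c \<le> (INF v\<in>{R..}. f v)"
    using lb by (intro cINF_greatest) auto
  then show "0 < (INF v\<in>{R..}. f v)" using c(1) by simp
  show "(INF v\<in>{R..}. f v) \<le> f v" if "v \<ge> R" for v
    using that lb by (intro cINF_lower) (auto intro!: bdd_belowI2)
qed

lemma admissible_nonneg:
  assumes "admissible_nonlinearity f" "v \<ge> 0"
  shows "f v \<ge> 0"
proof (cases "v = 0")
  case False
  then show ?thesis using admissible_INF[OF assms(1), of v] assms(2) by fastforce
qed (use assms in \<open>simp add: admissible_nonlinearity_def\<close>)

lemma admissible_continuous:
  assumes "admissible_nonlinearity f"
  shows "continuous_on {0..} f"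
proof -
  obtain f' where "\<forall>v\<ge>0. (f has_real_derivative f' v) (at v within {0..})"
    using assms by (auto simp: admissible_nonlinearity_def C1_halfline_def)
  then show ?thesis
    by (intro DERIV_continuous_on[of _ f f']) auto
qed

lemma admissible_bounds:
  assumes "admissible_nonlinearity f"
  obtains F L where "F > 0" "L \<ge> 0" "\<And>v. 0 \<le> v \<Longrightarrow> v \<le> M \<Longrightarrow> f v \<le> F"
    "\<And>v w. 0 \<le> v \<Longrightarrow> v \<le> M \<Longrightarrow> 0 \<le> w \<Longrightarrow> w \<le> M \<Longrightarrow> \<bar>f v - f w\<bar> \<le> L * \<bar>v - w\<bar>"
proof -
  obtain f' where f': "\<And>v. v \<ge> 0 \<Longrightarrow> (f has_real_derivative f' v) (at v within {0..})"
    "continuous_on {0..} f'"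
    using assms by (auto simp: admissible_nonlinearity_def C1_halfline_def)
  have bdd: "\<exists>B. \<forall>v\<in>{0..M}. \<bar>g v\<bar> \<le> B" if "continuous_on {0..} g" for g :: "real \<Rightarrow> real"
  proof -
    have "continuous_on {0..M} g" using continuous_on_subset[OF that] by auto
    from compact_imp_bounded[OF compact_continuous_image[OF this compact_Icc]]
    show ?thesis by (auto simp: bounded_iff)
  qed
  obtain F where F: "\<And>v. v \<in> {0..M} \<Longrightarrow> \<bar>f v\<bar> \<le> F"
    using bdd[OF admissible_continuous[OF assms]] by blast
  obtain L where L: "\<And>v. v \<in> {0..M} \<Longrightarrow> \<bar>f' v\<bar> \<le> L"
    using bdd[OF f'(2)] by blast
  show thesis
  proof (rule that[of "\<bar>F\<bar> + 1" "\<bar>L\<bar>"])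
    show "f v \<le> \<bar>F\<bar> + 1" if "0 \<le> v" "v \<le> M" for v
      using F[of v] that by (simp add: abs_le_iff)
    show "\<bar>f v - f w\<bar> \<le> \<bar>L\<bar> * \<bar>v - w\<bar>" if "0 \<le> v" "v \<le> M" "0 \<le> w" "w \<le> M" for v w
    proof -
      have "norm (f v - f w) \<le> \<bar>L\<bar> * norm (v - w)"
      proof (rule field_differentiable_bound[of "{0..M}" f f'])
        show "(f has_real_derivative f' z) (at z within {0..M})" if "z \<in> {0..M}" for z
          using f'(1)[of z] that by (auto intro: DERIV_subset)
        show "norm (f' z) \<le> \<bar>L\<bar>" if "z \<in> {0..M}" for z
          using L[OF that] by simp
      qed (use that in auto)
      then show ?thesis by simp
    qed
  qed auto
qed

lemma neumann_condition_subset: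
  assumes "neumann_condition \<Omega> I w" "I' \<subseteq> I"
  shows "neumann_condition \<Omega> I' w"
proof -
  obtain D where D: "continuous_on (closure \<Omega> \<times> I) (\<lambda>(x, t). D x t)"
          "\<forall>x\<in>\<Omega>. \<forall>t\<in>I. GDERIV (\<lambda>y. w y t) x :> D x t"
          "\<forall>q\<in>frontier \<Omega>. \<forall>t\<in>I. \<forall>n. outer_unit_normal \<Omega> q n \<longrightarrow> D q t \<bullet> n = 0"
    using assms(1) unfolding neumann_condition_def by blast
  have "continuous_on (closure \<Omega> \<times> I') (\<lambda>(x, t). D x t)"
    by (rule continuous_on_subset[OF D(1)]) (use assms(2) in auto)
  with D(2,3) assms(2) show ?thesis
    unfolding neumann_condition_def by (intro exI[of _ D]) blast
qed

text \<open>The estimates run on closed intervals inside [0,T): over a bounded domain these give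
  compact cylinders, on which \<open>u\<close> and \<open>v\<close> are bounded. The weak equation
  is traded here for \<open>approx_heat\<close>.\<close>

lemma rd_ode_solution_facts:
  fixes \<Omega> :: "'a::euclidean_space set"
  assumes sol: "rd_ode_solution \<Omega> f p a b \<kappa> u0 v0 T u v" and "open \<Omega>" "p > 0"
    and f: "continuous_on {0..} f" and t1: "0 < t1" "ereal t1 < T"
  shows "continuous_on (closure \<Omega> \<times> {0..t1}) (\<lambda>(x, t). u x t)"
    "continuous_on (closure \<Omega> \<times> {0..t1}) (\<lambda>(x, t). v x t)"
    "continuous_on (closure \<Omega> \<times> {0..t1}) (\<lambda>(x, t). - b * v x t - u x t powr p * f (v x t) + \<kappa>)"
    "approx_heat (\<Omega> \<times> {0<..<t1}) (\<lambda>(x, t). v x t)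
       (\<lambda>(x, t). - b * v x t - u x t powr p * f (v x t) + \<kappa>)"
    "neumann_condition \<Omega> {0<..<t1} v"
    "\<And>x t. x \<in> closure \<Omega> \<Longrightarrow> t \<in> {0..t1} \<Longrightarrow> u x t \<ge> 0 \<and> v x t \<ge> 0"
    "\<And>x t. x \<in> closure \<Omega> \<Longrightarrow> t \<in> {0..t1} \<Longrightarrow>
       (u x has_real_derivative - a * u x t + u x t powr p * f (v x t)) (at t within {0..t1})"
    "\<And>x. x \<in> \<Omega> \<Longrightarrow> u x 0 = u0 x \<and> v x 0 = v0 x"
proof -
  define J where "J = {t. 0 \<le> t \<and> ereal t < T}"
  define I where "I = {t. 0 < t \<and> ereal t < T}"
  have *: "continuous_on (closure \<Omega> \<times> J) (\<lambda>(x, t). u x t)"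
      "continuous_on (closure \<Omega> \<times> J) (\<lambda>(x, t). v x t)"
      "\<forall>x\<in>closure \<Omega>. \<forall>t\<in>J. u x t \<ge> 0 \<and> v x t \<ge> 0"
      "\<forall>x\<in>closure \<Omega>. \<forall>t\<in>J.
         (u x has_real_derivative - a * u x t + u x t powr p * f (v x t)) (at t within J)"
      "heat_equation_distributional \<Omega> I v (\<lambda>x t. - b * v x t - u x t powr p * f (v x t) + \<kappa>)"
      "neumann_condition \<Omega> I v"
      "\<forall>x\<in>\<Omega>. u x 0 = u0 x \<and> v x 0 = v0 x"
    using sol unfolding rd_ode_solution_def Let_def J_def I_def by blast+
  have J: "{0..t1} \<subseteq> J"
    using t1 unfolding J_def by (auto intro: le_less_trans[of _ "ereal t1"])
  have I: "{0<..<t1} \<subseteq> I" "I \<subseteq> J"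
    using t1 unfolding I_def J_def by (auto intro: less_trans[of _ "ereal t1"])
  have cJ: "closure \<Omega> \<times> {0..t1} \<subseteq> closure \<Omega> \<times> J" using J by auto
  show cu: "continuous_on (closure \<Omega> \<times> {0..t1}) (\<lambda>(x, t). u x t)"
    and cv: "continuous_on (closure \<Omega> \<times> {0..t1}) (\<lambda>(x, t). v x t)"
    using *(1,2) cJ continuous_on_subset by blast+
  have cf: "continuous_on (closure \<Omega> \<times> J) (\<lambda>z. f (v (fst z) (snd z)))"
    using *(2,3) by (intro continuous_on_compose2[OF f]) (auto simp: split_def)
  have cp: "continuous_on (closure \<Omega> \<times> J) (\<lambda>z. u (fst z) (snd z) powr p)"
    using *(1,3) \<open>p > 0\<close> by (intro continuous_on_powr' continuous_on_const) (auto simp: split_def)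
  have cH: "continuous_on (closure \<Omega> \<times> J) (\<lambda>(x, t). - b * v x t - u x t powr p * f (v x t) + \<kappa>)"
    using *(2) cf cp by (auto simp: split_def intro!: continuous_intros)
  then show "continuous_on (closure \<Omega> \<times> {0..t1}) (\<lambda>(x, t). - b * v x t - u x t powr p * f (v x t) + \<kappa>)"
    using cJ continuous_on_subset by blast
  have oI: "open I"
  proof (cases T)
    case (real r)
    then have "I = {0<..<r}" by (auto simp: I_def)
    then show ?thesis by simp
  next
    case PInf
    then have "I = {0<..}" by (auto simp: I_def)
    then show ?thesis by simp
  qed (simp add: I_def)
  have sub: "\<Omega> \<times> I \<subseteq> closure \<Omega> \<times> J" using I closure_subset by auto
  have "approx_heat (\<Omega> \<times> I) (\<lambda>(x, t). v x t) (\<lambda>(x, t). - b * v x t - u x t powr p * f (v x t) + \<kappa>)"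
    by (rule distributional_imp_approx_heat[OF *(5) \<open>open \<Omega>\<close> oI])
       (use continuous_on_subset[OF *(2) sub] continuous_on_subset[OF cH sub] in auto)
  then show "approx_heat (\<Omega> \<times> {0<..<t1}) (\<lambda>(x, t). v x t)
       (\<lambda>(x, t). - b * v x t - u x t powr p * f (v x t) + \<kappa>)"
    by (rule approx_heat_subset) (use I \<open>open \<Omega>\<close> in \<open>auto intro: open_Times\<close>)
  show "neumann_condition \<Omega> {0<..<t1} v"
    by (rule neumann_condition_subset[OF *(6) I(1)])
  show "u x t \<ge> 0 \<and> v x t \<ge> 0" if "x \<in> closure \<Omega>" "t \<in> {0..t1}" for x t
    using *(3) that J by blast
  show "(u x has_real_derivative - a * u x t + u x t powr p * f (v x t)) (at t within {0..t1})"
    if "x \<in> closure \<Omega>" "t \<in> {0..t1}" for x t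
    using *(4) that J DERIV_subset by blast
  show "u x 0 = u0 x \<and> v x 0 = v0 x" if "x \<in> \<Omega>" for x
    using *(7) that by blast
qed

text \<open>With k = (u/\<epsilon>)^p the assumption \<open>Q\<close> becomes k^4 |x|^2 \<le> 1,
  because 4 p times 1/(2 p) is 2. The bound \<open>U\<close> enters only through \<tau>, which is
  chosen to give k^4 \<tau> \<le> 1.\<close>

lemma powr_le_spike:
  fixes x :: "'a::euclidean_space"
  assumes u: "0 \<le> u" "u \<le> U" "0 < U" and "p > 1" "\<epsilon> > 0" and i: "i \<in> Basis"
    and Q: "u * norm x powr (1 / (2 * p)) \<le> \<epsilon>"
    and \<tau>: "\<tau> = min 1 (1 / ((U / \<epsilon>) powr p) ^ 4)"
  shows "u powr p \<le> 2 * \<epsilon> powr p * spike \<tau> (x \<bullet> i)"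
proof -
  define k where "k = (u / \<epsilon>) powr p"
  have \<tau>0: "\<tau> > 0" using assms by (simp add: \<tau>)
  have "k ^ 4 * (x \<bullet> i)\<^sup>2 \<le> k ^ 4 * (norm x)\<^sup>2"
    using power_mono[OF Basis_le_norm[OF i, of x], of 2] by (intro mult_left_mono) simp_all
  also have "\<dots> \<le> 1"
  \<comment> \<open>At the origin \<open>0 powr\<close> is 0 and \<open>Q\<close> carries no
    information, but then the product to be estimated vanishes.\<close>
  proof (cases "x = 0 \<or> u = 0")
    case False
    have "k ^ 4 * (norm x)\<^sup>2 = ((u * norm x powr (1 / (2 * p))) / \<epsilon>) powr (4 * p)"
    proof -
      have "(norm x)\<^sup>2 = norm x powr (1 / (2 * p) * (4 * p))"
        using \<open>p > 1\<close> False by simp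
      also have "\<dots> = (norm x powr (1 / (2 * p))) powr (4 * p)"
        by (simp add: powr_powr)
      finally have "(norm x)\<^sup>2 = (norm x powr (1 / (2 * p))) powr (4 * p)" .
      moreover have "k ^ 4 = (u / \<epsilon>) powr (4 * p)"
        using False u \<open>\<epsilon> > 0\<close> by (simp add: k_def powr_power mult.commute)
      ultimately have "k ^ 4 * (norm x)\<^sup>2 = (u / \<epsilon> * norm x powr (1 / (2 * p))) powr (4 * p)"
        using u \<open>\<epsilon> > 0\<close> powr_mult[of "u / \<epsilon>" "norm x powr (1 / (2 * p))" "4 * p"] by simp
      then show ?thesis by simp
    qed
    also have "\<dots> \<le> 1 powr (4 * p)"
      using Q u \<open>\<epsilon> > 0\<close> \<open>p > 1\<close> by (intro powr_mono2) auto
    finally show ?thesis by simp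
  qed (auto simp: k_def)
  finally have 1: "k ^ 4 * (x \<bullet> i)\<^sup>2 \<le> 1" .
  define N where "N = ((U / \<epsilon>) powr p) ^ 4"
  have N: "N > 0" using assms by (simp add: N_def)
  have "k ^ 4 \<le> N"
    unfolding N_def k_def using assms by (intro power_mono powr_mono2 divide_right_mono) auto
  then have "k ^ 4 * \<tau> \<le> N * (1 / N)"
    using \<tau>0 N by (intro mult_mono) (auto simp: \<tau> N_def)
  then have 2: "k ^ 4 * \<tau> \<le> 1" using N by simp
  have "k \<le> 2 * spike \<tau> (x \<bullet> i)"
    by (rule truncated_le_spike[OF _ 1 2 \<tau>0]) (simp add: k_def)
  then have "\<epsilon> powr p * k \<le> \<epsilon> powr p * (2 * spike \<tau> (x \<bullet> i))"
    by (intro mult_left_mono) auto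
  moreover have "\<epsilon> powr p * k = u powr p"
    using u \<open>\<epsilon> > 0\<close> by (simp add: k_def powr_divide)
  ultimately show ?thesis by (simp add: algebra_simps)
qed

lemma rd_apriori:
  fixes \<Omega> :: "'a::euclidean_space set"
  assumes \<Omega>: "open \<Omega>" "bounded \<Omega>" "smooth_boundary \<Omega>" "0 \<in> \<Omega>" and f: "admissible_nonlinearity f"
    and par: "p > 1" "b > 0" "\<kappa> > 0" and \<alpha>: "0 < \<alpha>" "\<alpha> < 1" and R0: "R0 = \<kappa> / (2 * b)" "R0 < vb"
  obtains \<epsilon> where "\<epsilon> > 0"
    "\<And>a u0 v0 T u v t1. \<lbrakk>rd_ode_solution \<Omega> f p a b \<kappa> u0 v0 T u v; \<And>x. x \<in> \<Omega> \<Longrightarrow> v0 x = vb;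
      0 < t1; ereal t1 < T; t1 \<le> 1;
      \<And>x t. x \<in> closure \<Omega> \<Longrightarrow> t \<in> {0..<t1} \<Longrightarrow> u x t * norm x powr (1 / (2 * p)) \<le> \<epsilon>\<rbrakk> \<Longrightarrow>
      (\<forall>x\<in>closure \<Omega>. \<forall>t\<in>{0..<t1}. v x t \<ge> R0) \<and>
      (\<forall>x\<in>\<Omega>. \<forall>t\<in>{0..<t1}. (p - 1) * \<bar>f (v 0 t) - f (v x t)\<bar> \<le> 1 / 2 * \<epsilon> powr (- (p - 1)) * norm x powr \<alpha>)"
proof -
  \<comment> \<open>Below \<open>m\<close> the linear part of the source is nonnegative, so only the
    reaction can push \<open>v\<close> from \<open>m\<close> down to \<open>R0\<close>.\<close>
  define m where "m = min vb (\<kappa> / b)"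
  define M where "M = max vb (\<kappa> / b)"
  have R0p: "R0 > 0" using R0 par by simp
  have "R0 < \<kappa> / b" using par by (simp add: R0 field_simps)
  then have m: "R0 < m" "m \<le> vb" "m \<le> \<kappa> / b" using R0 by (auto simp: m_def)
  have M: "vb \<le> M" "\<kappa> / b \<le> M" "M > 0" using R0 R0p by (auto simp: M_def)
  obtain F L where F: "F > 0" "\<And>v. 0 \<le> v \<Longrightarrow> v \<le> M \<Longrightarrow> f v \<le> F" and
    L: "L \<ge> 0" "\<And>v w. 0 \<le> v \<Longrightarrow> v \<le> M \<Longrightarrow> 0 \<le> w \<Longrightarrow> w \<le> M \<Longrightarrow> \<bar>f v - f w\<bar> \<le> L * \<bar>v - w\<bar>"
    using admissible_bounds[OF f, of M] by metis
  obtain g E lap c where bf: "boundary_field \<Omega> g E lap c"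
    using boundary_field_exists[OF \<Omega>(1-3)] by metis
  obtain K where K: "K > 0" and lower: "lower_bound_constant \<Omega> K"
    using neumann_lower_bound[OF \<Omega>(1,2) bf] by metis
  obtain r0 where r0: "r0 > 0" "cball 0 r0 \<subseteq> \<Omega>"
    using open_contains_cball \<Omega>(1,4) by metis
  define r where "r = r0 / 5"
  have r: "r > 0" "ball 0 (5 * r) \<subseteq> \<Omega>"
    using r0 by (auto simp: r_def)
  define C0 where "C0 = b * M + \<kappa>"
  \<comment> \<open>The reaction is at most 2 F \<epsilon>^p times the spike. With \<epsilon> \<le>
    1 this is at most 2 F, which lets \<Lambda> and \<open>C\<close> be fixed before
    \<epsilon>.\<close>
  define C1 where "C1 = 2 * F"
  have C: "C0 \<ge> 0" "C1 \<ge> 0" using par M F by (auto simp: C0_def C1_def)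
  obtain \<Lambda> where \<Lambda>: "\<Lambda> \<ge> 0" and lip: "lipschitz_constant TYPE('a) r M C0 C1 \<Lambda>"
    using heat_coordinate_lipschitz[OF r(1) less_imp_le[OF M(3)] C] by metis
  define n where "n = real DIM('a)"
  have n: "n > 0" by (simp add: n_def)
  \<comment> \<open>For |x| \<le> q the coordinate path from 0 to \<open>x\<close> stays in the ball
    of radius r/2.\<close>
  define q where "q = r / (2 * n)"
  have q: "q > 0" using r n by (simp add: q_def)
  \<comment> \<open>The first term turns the Lipschitz bound into one with exponent \<alpha> for |x|
    \<le> q; the second covers |x| > q, where the difference is at most \<open>M\<close>.\<close>
  define C where "C = n * \<Lambda> * q powr (1 - \<alpha>) + M * (1 / q) powr \<alpha>"
  have C0': "C \<ge> 0" using n \<Lambda> M by (simp add: C_def)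
  define X where "X = 2 * (p - 1) * L * C + 1"
  have X: "X > 0" using par L C0' by (simp add: X_def add_nonneg_pos)
  \<comment> \<open>The three entries make the constants independent of \<epsilon>, keep the loss of
    \<open>v\<close> within \<open>m - R0\<close>, and give X \<le> \<epsilon>^(1-p), so that the
    deviation of f(v) costs at most half of \<epsilon>^(1-p) |x|^\<alpha>.\<close>
  define \<epsilon> where "\<epsilon> = min 1 (min ((m - R0) / (2 * F * K)) (X powr (- (1 / (p - 1)))))"
  have \<epsilon>: "\<epsilon> > 0" "\<epsilon> \<le> 1" "\<epsilon> \<le> (m - R0) / (2 * F * K)" "\<epsilon> \<le> X powr (- (1 / (p - 1)))"
    using m F K X by (auto simp: \<epsilon>_def)
  have \<epsilon>p: "\<epsilon> powr p \<le> \<epsilon>"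
    using powr_mono'[of 1 p \<epsilon>] \<epsilon> par by simp
  have \<epsilon>K: "2 * F * \<epsilon> powr p * K \<le> m - R0"
  proof -
    have "2 * F * K * \<epsilon> powr p \<le> 2 * F * K * ((m - R0) / (2 * F * K))"
      using \<epsilon>p \<epsilon>(3) F K by (intro mult_left_mono) auto
    also have "\<dots> = m - R0" using F K by simp
    finally show ?thesis by (simp add: mult_ac)
  qed
  have \<epsilon>X: "X \<le> \<epsilon> powr (- (p - 1))"
  proof -
    have "X = (X powr (- (1 / (p - 1)))) powr (- (p - 1))"
    proof -
      have "- (1 / (p - 1)) * (- (p - 1)) = 1" using par by (simp add: field_simps)
      then show ?thesis using X by (simp only: powr_powr powr_one)
    qed
    also have "\<dots> \<le> \<epsilon> powr (- (p - 1))"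
      using \<epsilon>(1,4) par by (intro powr_mono2') auto
    finally show ?thesis .
  qed
  show thesis
  proof (rule that[OF \<epsilon>(1)])
    fix a u0 v0 T u v t1
    assume sol: "rd_ode_solution \<Omega> f p a b \<kappa> u0 v0 T u v" and v0: "\<And>x. x \<in> \<Omega> \<Longrightarrow> v0 x = vb"
      and t1: "0 < t1" "ereal t1 < T" "t1 \<le> 1"
      and Q: "\<And>x t. x \<in> closure \<Omega> \<Longrightarrow> t \<in> {0..<t1} \<Longrightarrow> u x t * norm x powr (1 / (2 * p)) \<le> \<epsilon>"
    have p0: "p > 0" using par by simp
    note facts = rd_ode_solution_facts[OF sol \<Omega>(1) p0 admissible_continuous[OF f] t1(1,2)]
    let ?V = "\<lambda>(x, t). v x t" and ?H = "\<lambda>(x, t). - b * v x t - u x t powr p * f (v x t) + \<kappa>"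
    have sub: "\<Omega> \<times> {0<..<t1} \<subseteq> closure \<Omega> \<times> {0..t1}" using closure_subset by auto
    have cH: "continuous_on (\<Omega> \<times> {0<..<t1}) ?H" using continuous_on_subset[OF facts(3) sub] .
    have init: "v x 0 = vb" if "x \<in> closure \<Omega>" for x
    proof -
      have "continuous_on (closure \<Omega>) (\<lambda>x. v x 0)"
      proof -
        have "continuous_on (closure \<Omega>) (\<lambda>x. (\<lambda>(x, t). v x t) (x, 0))"
          using t1 by (intro continuous_on_compose2[OF facts(2)] continuous_intros) auto
        then show ?thesis by simp
      qed
      then show ?thesis
        by (rule continuous_constant_on_closure) (use facts(8) v0 that in auto)
    qed
    have ncV: "neumann_condition \<Omega> {0<..<t1} (\<lambda>x t. ?V (x, t))" using facts(5) by simp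
    have vM0: "v x t \<le> M" if "x \<in> closure \<Omega>" "0 \<le> t" "t < t1" for x t
    proof -
      have "?V (x, t) \<le> M"
      proof (rule neumann_max_principle[OF \<Omega>(1,2) bf facts(2,4) cH ncV])
        fix z assume z: "z \<in> \<Omega> \<times> {0<..<t1}" and "M < ?V z"
        obtain y s where ys: "z = (y, s)" by (cases z)
        have y: "y \<in> closure \<Omega>" "s \<in> {0..t1}" using z ys closure_subset[of \<Omega>] by auto
        have "M < v y s" using \<open>M < ?V z\<close> ys by simp
        then have "b * (\<kappa> / b) \<le> b * v y s"
          using M(2) par by (intro mult_left_mono) auto
        then have "\<kappa> \<le> b * v y s" using par by simp
        moreover have "u y s powr p * f (v y s) \<ge> 0"
          using facts(6)[OF y] admissible_nonneg[OF f] by simp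
        ultimately show "?H z \<le> 0" by (simp add: ys)
      qed (use init M that in auto)
      then show ?thesis by simp
    qed
    have vM: "v x t \<le> M" if x: "x \<in> closure \<Omega>" and t: "t \<in> {0..t1}" for x t
    proof (cases "t < t1")
      case True
      then show ?thesis using vM0 x t by simp
    next
      case False
      have cl: "closure {0..<t1} = {0..t1}" using t1 by simp
      have "continuous_on (closure {0..<t1}) (v x)"
      proof -
        have "continuous_on {0..t1} (\<lambda>t. (\<lambda>(x, t). v x t) (x, t))"
          using x by (intro continuous_on_compose2[OF facts(2)] continuous_intros) auto
        then show ?thesis unfolding cl by simp
      qed
      then show ?thesis
        by (rule continuous_le_on_closure) (use vM0 x t cl in auto)
    qed
    have comp: "compact (closure \<Omega> \<times> {0..t1})" using \<Omega>(2) by (intro compact_Times) auto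
    obtain U0 where U0: "\<And>z. z \<in> closure \<Omega> \<times> {0..t1} \<Longrightarrow> \<bar>(\<lambda>(x, t). u x t) z\<bar> \<le> U0"
      using compact_imp_bounded[OF compact_continuous_image[OF facts(1) comp]]
      by (auto simp: bounded_iff)
    \<comment> \<open>This bound depends on the solution and on \<open>t1\<close>, which is harmless
      because it affects only \<tau>.\<close>
    define U where "U = \<bar>U0\<bar> + 1"
    have U: "U > 0" "\<And>x t. x \<in> closure \<Omega> \<Longrightarrow> t \<in> {0..t1} \<Longrightarrow> u x t \<le> U"
      using U0 by (force simp: U_def)+
    define \<tau> where "\<tau> = min 1 (1 / ((U / \<epsilon>) powr p) ^ 4)"
    have \<tau>: "0 < \<tau>" "\<tau> \<le> 1" using U \<epsilon> by (auto simp: \<tau>_def)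
    have react: "0 \<le> u x t powr p * f (v x t)"
        "u x t powr p * f (v x t) \<le> (2 * F * \<epsilon> powr p) * spike \<tau> (x \<bullet> i)"
      if x: "x \<in> closure \<Omega>" and t: "t \<in> {0..<t1}" and i: "i \<in> Basis" for x t and i :: 'a
    proof -
      have t': "t \<in> {0..t1}" using t by auto
      have f0: "0 \<le> f (v x t)" "f (v x t) \<le> F"
        using facts(6)[OF x t'] admissible_nonneg[OF f] F(2) vM[OF x t'] by auto
      then show "0 \<le> u x t powr p * f (v x t)" by simp
      have "u x t powr p \<le> 2 * \<epsilon> powr p * spike \<tau> (x \<bullet> i)"
        using facts(6)[OF x t'] U par \<epsilon> i Q[OF x t] t' x by (intro powr_le_spike[where U = U]) (auto simp: \<tau>_def)
      then have "u x t powr p * f (v x t) \<le> (2 * \<epsilon> powr p * spike \<tau> (x \<bullet> i)) * F"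
        using f0 F(1) spike_nonneg[of \<tau> "x \<bullet> i"] by (intro mult_mono) auto
      then show "u x t powr p * f (v x t) \<le> (2 * F * \<epsilon> powr p) * spike \<tau> (x \<bullet> i)"
        by (simp add: mult_ac)
    qed
    have lowv: "v x t \<ge> R0" if x: "x \<in> closure \<Omega>" and t: "t \<in> {0..<t1}" for x t
    proof -
      obtain i :: 'a where i: "i \<in> Basis" using nonempty_Basis by blast
      have \<sigma>: "2 * F * \<epsilon> powr p > 0" using F \<epsilon> by simp
      have "?V (x, t) \<ge> m - (2 * F * \<epsilon> powr p) * K"
      proof (rule lower[unfolded lower_bound_constant_def, rule_format, OF facts(2,4) cH ncV \<sigma> \<tau> t1(3) i _ _ x t])
        fix z assume z: "z \<in> \<Omega> \<times> {0<..<t1}" and lt: "?V z < m"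
        obtain y s where ys: "z = (y, s)" by (cases z)
        have y: "y \<in> closure \<Omega>" "s \<in> {0..<t1}" using z ys closure_subset[of \<Omega>] by auto
        have "v y s \<le> \<kappa> / b" using lt m ys by simp
        then have "b * v y s \<le> \<kappa>" using par by (simp add: le_divide_eq mult.commute)
        then show "- (2 * F * \<epsilon> powr p) * spike \<tau> (fst z \<bullet> i) \<le> ?H z"
          using react(2)[OF y i] by (simp add: ys)
      qed (use init m t in auto)
      then show ?thesis using \<epsilon>K by simp
    qed
    have hold: "\<bar>v x t - v 0 t\<bar> \<le> C * norm x powr \<alpha>" if x: "x \<in> \<Omega>" and t: "t \<in> {0..<t1}" for x t
    proof (cases "norm x \<le> q")
      case True
      have step: "\<bar>v (y + d *\<^sub>R i) t - v y t\<bar> \<le> \<Lambda> * d"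
        if i: "i \<in> Basis" and y: "norm y \<le> r / 2" "norm (y + d *\<^sub>R i) \<le> r / 2" and d: "d > 0" for i y d
      proof -
        have b5: "y \<in> closure \<Omega>" if "y \<in> ball 0 (5 * r)" for y
          using that r(2) closure_subset by blast
        have sub5: "ball 0 (5 * r) \<times> {0..t1} \<subseteq> closure \<Omega> \<times> {0..t1}"
          "ball 0 (5 * r) \<times> {0<..<t1} \<subseteq> \<Omega> \<times> {0<..<t1}"
          using r(2) closure_subset by auto
        have "\<bar>?V (y + d *\<^sub>R i, t) - ?V (y, t)\<bar> \<le> \<Lambda> * d"
        proof (rule lip[unfolded lipschitz_constant_def, rule_format, OF _ _ _ _ _ \<tau> i _ y d t])
          show "continuous_on (ball 0 (5 * r) \<times> {0..t1}) ?V"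
            by (rule continuous_on_subset[OF facts(2) sub5(1)])
          show "approx_heat (ball 0 (5 * r) \<times> {0<..<t1}) ?V ?H"
            by (rule approx_heat_subset[OF facts(4) sub5(2)]) (intro open_Times open_ball open_greaterThanLessThan)
          show "continuous_on (ball 0 (5 * r) \<times> {0<..<t1}) ?H"
            by (rule continuous_on_subset[OF cH sub5(2)])
          show "0 \<le> ?V z \<and> ?V z \<le> M" if "z \<in> ball 0 (5 * r) \<times> {0..t1}" for z
          proof -
            obtain y s where ys: "z = (y, s)" by (cases z)
            have y: "y \<in> closure \<Omega>" "s \<in> {0..t1}" using that ys b5 by blast+
            show ?thesis using facts(6)[OF y] vM[OF y] by (simp add: ys)
          qed
          show "?V (x, 0) = vb" if "x \<in> ball 0 (5 * r)" for x
            using init b5 that by simp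
          show "\<bar>?H z\<bar> \<le> C0 + C1 * spike \<tau> (fst z \<bullet> i)" if "z \<in> ball 0 (5 * r) \<times> {0<..<t1}" for z
          proof -
            obtain y s where ys: "z = (y, s)" by (cases z)
            have "y \<in> ball 0 (5 * r)" "s \<in> {0<..<t1}" using that ys by blast+
            then have y: "y \<in> closure \<Omega>" "s \<in> {0..<t1}" "s \<in> {0..t1}" using b5 by auto
            have vb: "0 \<le> b * v y s" "b * v y s \<le> b * M"
              using facts(6)[OF y(1,3)] vM[OF y(1,3)] par by auto
            have "(2 * F * \<epsilon> powr p) * spike \<tau> (y \<bullet> i) \<le> C1 * spike \<tau> (y \<bullet> i)"
              unfolding C1_def using F \<epsilon> \<epsilon>p spike_nonneg by (intro mult_right_mono) auto
            then show ?thesis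
              using react[OF y(1,2) i] vb par(3) unfolding ys C0_def prod.case fst_conv abs_le_iff
              by (intro conjI; linarith)
          qed
        qed
        then show ?thesis by simp
      qed
      have "n * norm x \<le> r / 2" using True n by (simp add: q_def field_simps)
      then have "\<bar>v x t - v 0 t\<bar> \<le> n * (\<Lambda> * norm x)"
        unfolding n_def by (intro heat_lipschitz_origin[where \<rho> = "r / 2" and v = "\<lambda>x. v x t", OF \<Lambda> step])
      also have "norm x \<le> q powr (1 - \<alpha>) * norm x powr \<alpha>"
      proof (cases "x = 0")
        case False
        have "norm x = norm x powr (1 - \<alpha>) * norm x powr \<alpha>"
          using False by (simp flip: powr_add)
        also have "\<dots> \<le> q powr (1 - \<alpha>) * norm x powr \<alpha>"
          using True \<alpha> by (intro mult_right_mono powr_mono2) auto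
        finally show ?thesis .
      qed simp
      then have "n * (\<Lambda> * norm x) \<le> n * (\<Lambda> * (q powr (1 - \<alpha>) * norm x powr \<alpha>))"
        using n \<Lambda> by (intro mult_left_mono) auto
      also have "\<dots> \<le> C * norm x powr \<alpha>"
      proof -
        have "C * norm x powr \<alpha> = n * (\<Lambda> * (q powr (1 - \<alpha>) * norm x powr \<alpha>))
            + M * (1 / q) powr \<alpha> * norm x powr \<alpha>"
          by (simp add: C_def algebra_simps)
        then show ?thesis using M(3) by simp
      qed
      finally show ?thesis by simp
    next
      case False
      have t': "t \<in> {0..t1}" using t by auto
      have xc: "x \<in> closure \<Omega>" "0 \<in> closure \<Omega>" using x \<Omega>(4) closure_subset by auto
      have "\<bar>v x t - v 0 t\<bar> \<le> M"
        using vM[OF _ t'] facts(6)[OF _ t'] xc by (fastforce simp: abs_le_iff)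
      also have "M * 1 \<le> M * ((1 / q) * norm x) powr \<alpha>"
        using False q M \<alpha> by (intro mult_left_mono ge_one_powr_ge_zero) (auto simp: field_simps)
      then have "M \<le> M * (1 / q) powr \<alpha> * norm x powr \<alpha>"
        using q by (simp add: powr_mult mult.assoc del: times_divide_eq_left)
      also have "\<dots> \<le> C * norm x powr \<alpha>"
        using n \<Lambda> by (intro mult_right_mono) (auto simp: C_def)
      finally show ?thesis .
    qed
    show "(\<forall>x\<in>closure \<Omega>. \<forall>t\<in>{0..<t1}. v x t \<ge> R0) \<and>
      (\<forall>x\<in>\<Omega>. \<forall>t\<in>{0..<t1}. (p - 1) * \<bar>f (v 0 t) - f (v x t)\<bar> \<le> 1 / 2 * \<epsilon> powr (- (p - 1)) * norm x powr \<alpha>)"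
    proof (intro conjI ballI)
      fix x t assume x: "x \<in> \<Omega>" and t: "t \<in> {0..<t1}"
      have t': "t \<in> {0..t1}" using t by auto
      have xc: "x \<in> closure \<Omega>" "0 \<in> closure \<Omega>" using x \<Omega>(4) closure_subset by auto
      have "\<bar>f (v 0 t) - f (v x t)\<bar> \<le> L * \<bar>v 0 t - v x t\<bar>"
        using L(2) facts(6)[OF _ t'] vM[OF _ t'] xc by blast
      also have "\<dots> \<le> L * (C * norm x powr \<alpha>)"
        using hold[OF x t] L(1) by (intro mult_left_mono) (auto simp: abs_minus_commute)
      finally have "(p - 1) * \<bar>f (v 0 t) - f (v x t)\<bar> \<le> (p - 1) * (L * (C * norm x powr \<alpha>))"
        using par by (intro mult_left_mono) auto
      also have "\<dots> = ((p - 1) * L * C) * norm x powr \<alpha>" by simp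
      also have "\<dots> \<le> (1 / 2 * \<epsilon> powr (- (p - 1))) * norm x powr \<alpha>"
        using \<epsilon>X by (intro mult_right_mono) (auto simp: X_def algebra_simps)
      finally show "(p - 1) * \<bar>f (v 0 t) - f (v x t)\<bar> \<le> 1 / 2 * \<epsilon> powr (- (p - 1)) * norm x powr \<alpha>" .
    qed (rule lowv)
  qed
qed

subsection \<open>The ordinary differential equation and blow-up\<close>


lemma derivative_le_imp_increment_le:
  fixes y z :: "real \<Rightarrow> real"
  assumes "0 \<le> t"
    and y: "\<And>s. s \<in> {0..t} \<Longrightarrow> (y has_real_derivative y' s) (at s within {0..t})"
    and z: "\<And>s. s \<in> {0..t} \<Longrightarrow> (z has_real_derivative z' s) (at s within {0..t})"
    and le: "\<And>s. 0 < s \<Longrightarrow> s < t \<Longrightarrow> y' s \<le> z' s"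
  shows "y t - y 0 \<le> z t - z 0"
proof (cases "t = 0")
  case False
  then have t: "0 < t" using assms(1) by simp
  have d: "((\<lambda>s. z s - y s) has_real_derivative z' s - y' s) (at s within {0..t})" if "s \<in> {0..t}" for s
    by (rule DERIV_diff[OF z[OF that] y[OF that]])
  have "continuous_on {0..t} (\<lambda>s. z s - y s)"
    using d by (rule DERIV_continuous_on)
  note c = this
  have m: "((\<lambda>s. z s - y s) has_derivative (\<lambda>h. (z' s - y' s) * h)) (at s)" if "0 < s" "s < t" for s
    using d[of s] that at_within_interior[of s "{0..t}"] unfolding has_field_derivative_def
    by (simp add: interior_atLeastAtMost_real)
  obtain \<xi> where \<xi>: "0 < \<xi>" "\<xi> < t"
    "(z t - y t) - (z 0 - y 0) = (z' \<xi> - y' \<xi>) * (t - 0)"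
    using mvt[OF t c m] by blast
  have "(z' \<xi> - y' \<xi>) * (t - 0) \<ge> 0"
    using le[OF \<xi>(1,2)] t by simp
  then show ?thesis using \<xi>(3) by linarith
qed simp

text \<open>With the integrating factor exp(a s) only the nonnegative reaction term remains, so the
  product with \<open>u\<close> is nondecreasing.\<close>

lemma rd_ode_positive:
  fixes u k :: "real \<Rightarrow> real"
  assumes "0 \<le> t" "u 0 > 0"
    and u: "\<And>s. s \<in> {0..t} \<Longrightarrow> (u has_real_derivative - a * u s + u s powr p * k s) (at s within {0..t})"
    and k: "\<And>s. s \<in> {0..t} \<Longrightarrow> k s \<ge> 0"
  shows "u t > 0"
proof -
  have e: "((\<lambda>s. exp (a * s)) has_real_derivative a * exp (a * s)) (at s within {0..t})" for s
    by (auto intro!: derivative_eq_intros)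
  have "((\<lambda>s. u s * exp (a * s)) has_real_derivative u s powr p * k s * exp (a * s)) (at s within {0..t})"
    if "s \<in> {0..t}" for s
    using DERIV_mult[OF u[OF that] e] by (simp add: algebra_simps)
  then have "(\<lambda>_. 0) t - (\<lambda>_. 0) 0 \<le> u t * exp (a * t) - u 0 * exp (a * 0)"
    using assms(1) k by (intro derivative_le_imp_increment_le[where y' = "\<lambda>_. 0"]) auto
  then have "u t * exp (a * t) > 0" using assms(2) by simp
  then show ?thesis by (simp add: zero_less_mult_iff)
qed

text \<open>Bernoulli's substitution u^(1-p) makes the equation linear, and the exponential factor
  removes its zeroth-order term.\<close>

lemma rd_ode_bernoulli:
  fixes u k :: "real \<Rightarrow> real"
  assumes u: "(u has_real_derivative - a * u s + u s powr p * k s) (at s within S)" "u s > 0"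
  shows "((\<lambda>s. u s powr (1 - p) * exp (- (p - 1) * a * s)) has_real_derivative
    - (p - 1) * k s * exp (- (p - 1) * a * s)) (at s within S)"
proof -
  have "((\<lambda>x. x powr (1 - p)) has_real_derivative (1 - p) * u s powr (1 - p - 1)) (at (u s))"
    using u(2) by (rule has_real_derivative_powr)
  from DERIV_chain2[OF this u(1)]
  have 1: "((\<lambda>s. u s powr (1 - p)) has_real_derivative
      (1 - p) * u s powr (1 - p - 1) * (- a * u s + u s powr p * k s)) (at s within S)" .
  have 2: "((\<lambda>s. exp (- (p - 1) * a * s)) has_real_derivative
      - (p - 1) * a * exp (- (p - 1) * a * s)) (at s within S)"
    by (auto intro!: derivative_eq_intros)
  have 3: "u s powr (1 - p - 1) * u s = u s powr (1 - p)"
    using u(2) powr_add[of "u s" "1 - p - 1" 1] by simp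
  have 4: "u s powr (1 - p - 1) * u s powr p = 1"
    using u(2) by (simp flip: powr_add)
  have "(1 - p) * u s powr (1 - p - 1) * (- a * u s + u s powr p * k s)
      = (1 - p) * (- a * (u s powr (1 - p - 1) * u s) + (u s powr (1 - p - 1) * u s powr p) * k s)"
    by (simp add: algebra_simps)
  then have 5: "(1 - p) * u s powr (1 - p - 1) * (- a * u s + u s powr p * k s)
      = (1 - p) * (- a * u s powr (1 - p) + k s)"
    unfolding 3 4 by simp
  show ?thesis
    by (rule DERIV_cong[OF DERIV_mult[OF 1[unfolded 5] 2]]) (simp add: algebra_simps)
qed

text \<open>Raising to the power -1/(p - 1) reverses the inequality; the factor 3/2 becomes a number
  below one, which is the gain of the bootstrap.\<close>

lemma powr_lower_imp_upper:
  fixes u \<epsilon> X p :: real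
  assumes "p > 1" "\<epsilon> > 0" "X > 0" "u > 0"
    and le: "3 / 2 * \<epsilon> powr (- (p - 1)) * X powr ((p - 1) / (2 * p)) \<le> u powr (1 - p)"
  shows "u * X powr (1 / (2 * p)) \<le> (3 / 2) powr (- (1 / (p - 1))) * \<epsilon>"
proof -
  have "(u powr (1 - p)) powr (- (1 / (p - 1)))
      \<le> (3 / 2 * \<epsilon> powr (- (p - 1)) * X powr ((p - 1) / (2 * p))) powr (- (1 / (p - 1)))"
    using assms by (intro powr_mono2'[OF _ _ le]) auto
  also have "(u powr (1 - p)) powr (- (1 / (p - 1))) = u"
  proof -
    have "(1 - p) * (- (1 / (p - 1))) = 1" using assms(1) by (simp add: field_simps)
    then show ?thesis using assms(4) by (simp only: powr_powr powr_one)
  qed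
  also have "(3 / 2 * \<epsilon> powr (- (p - 1)) * X powr ((p - 1) / (2 * p))) powr (- (1 / (p - 1)))
     = (3 / 2) powr (- (1 / (p - 1))) * \<epsilon> * X powr (- (1 / (2 * p)))"
  proof -
    have "- (p - 1) * (- (1 / (p - 1))) = 1" "(p - 1) / (2 * p) * (- (1 / (p - 1))) = - (1 / (2 * p))"
      using assms(1) by (simp_all add: field_simps)
    then show ?thesis
      using assms(2) by (simp only: powr_mult powr_powr powr_one)
  qed
  finally have "u * X powr (1 / (2 * p))
      \<le> (3 / 2) powr (- (1 / (p - 1))) * \<epsilon> * X powr (- (1 / (2 * p))) * X powr (1 / (2 * p))"
    by (intro mult_right_mono) auto
  also have "\<dots> = (3 / 2) powr (- (1 / (p - 1))) * \<epsilon> * (X powr (- (1 / (2 * p))) * X powr (1 / (2 * p)))"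
    by (simp only: mult.assoc)
  also have "X powr (- (1 / (2 * p))) * X powr (1 / (2 * p)) = 1"
    using assms(3) by (simp flip: powr_add)
  finally show ?thesis by simp
qed

lemma less_powr_imp_powr_less:
  fixes u Y p :: real
  assumes "p > 1" "u > 0" "Y > 0" "u < Y powr (- (1 / (p - 1)))"
  shows "Y < u powr (1 - p)"
proof -
  have "- (1 / (p - 1)) * (1 - p) = 1" using assms(1) by (simp add: field_simps)
  then have "Y = (Y powr (- (1 / (p - 1)))) powr (1 - p)"
    using assms(3) by (simp only: powr_powr powr_one)
  also have "\<dots> < u powr (1 - p)"
    using assms by (intro powr_less_mono2_neg) auto
  finally show ?thesis .
qed

lemma decay_le_one: "p > 1 \<Longrightarrow> a > 0 \<Longrightarrow> s \<ge> 0 \<Longrightarrow> exp (- (p - 1) * a * s) \<le> (1::real)"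
  unfolding exp_le_one_iff by (intro mult_nonpos_nonneg) auto

text \<open>In the Bernoulli variable the value at \<open>x\<close> starts more than 2 c above the
  value at 0. Up to time one the two reaction terms can shrink this gap by at most c/2, and the
  value at 0 is positive, so 3/2 c remains.\<close>

lemma rd_bootstrap_step:
  fixes \<Omega> :: "'a::euclidean_space set"
  assumes sol: "rd_ode_solution \<Omega> f p a b \<kappa> u0 v0 T u v" and \<Omega>: "open \<Omega>" "0 \<in> \<Omega>"
    and f: "admissible_nonlinearity f" and par: "p > 1" "a > 0" "\<epsilon> > 0"
    and t1: "0 < t1" "ereal t1 < T" "t1 \<le> 1"
    and u00: "u0 0 > 0"
    and u0: "\<And>x. x \<in> \<Omega> - {0} \<Longrightarrow> 0 < u0 x \<and> u0 x < (u0 0 powr (1 - p)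
        + 2 * \<epsilon> powr (- (p - 1)) * norm x powr ((p - 1) / (2 * p))) powr (- (1 / (p - 1)))"
    and hold: "\<And>x t. x \<in> \<Omega> \<Longrightarrow> t \<in> {0..<t1} \<Longrightarrow> (p - 1) * \<bar>f (v 0 t) - f (v x t)\<bar>
        \<le> 1 / 2 * \<epsilon> powr (- (p - 1)) * norm x powr ((p - 1) / (2 * p))"
    and x: "x \<in> \<Omega>" and t: "t \<in> {0..<t1}"
  shows "u x t * norm x powr (1 / (2 * p)) \<le> (3 / 2) powr (- (1 / (p - 1))) * \<epsilon>"
proof (cases "x = 0")
  case False
  have p0: "p > 0" using par by simp
  note facts = rd_ode_solution_facts[OF sol \<Omega>(1) p0 admissible_continuous[OF f] t1(1,2)]
  have cl: "y \<in> closure \<Omega>" if "y \<in> \<Omega>" for y using that closure_subset by blast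
  have sub: "{0..t} \<subseteq> {0..t1}" using t by auto
  have du: "(u y has_real_derivative - a * u y s + u y s powr p * f (v y s)) (at s within {0..r})"
    if "y \<in> \<Omega>" "s \<in> {0..r}" "{0..r} \<subseteq> {0..t}" for y s r
  proof -
    have "s \<in> {0..t1}" "{0..r} \<subseteq> {0..t1}" using that sub by blast+
    then show ?thesis using facts(7)[OF cl[OF that(1)]] DERIV_subset by blast
  qed
  have fp: "f (v y s) \<ge> 0" if "y \<in> \<Omega>" "s \<in> {0..t}" for y s
    using facts(6)[OF cl[OF that(1)], of s] that(2) sub admissible_nonneg[OF f] by blast
  have upos: "u y s > 0" if "y \<in> \<Omega>" "s \<in> {0..t}" for y s
  proof (rule rd_ode_positive[where u = "u y" and t = s and k = "\<lambda>s. f (v y s)" and a = a and p = p])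
    show "u y 0 > 0" using facts(8)[OF that(1)] u0 u00 that(1) by (cases "y = 0") auto
    show "(u y has_real_derivative - a * u y r + u y r powr p * f (v y r)) (at r within {0..s})"
      if "r \<in> {0..s}" for r
      using du[OF \<open>y \<in> \<Omega>\<close> that] \<open>s \<in> {0..t}\<close> by auto
    show "f (v y r) \<ge> 0" if "r \<in> {0..s}" for r
      using fp[OF \<open>y \<in> \<Omega>\<close>] that \<open>s \<in> {0..t}\<close> by auto
  qed (use that in auto)
  define Y where "Y y s = u y s powr (1 - p) * exp (- (p - 1) * a * s)" for y s
  have dY: "(Y y has_real_derivative - (p - 1) * f (v y s) * exp (- (p - 1) * a * s)) (at s within {0..t})"
    if "y \<in> \<Omega>" "s \<in> {0..t}" for y s
    unfolding Y_def using du[OF that subset_refl] upos[OF that] by (rule rd_ode_bernoulli)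
  \<comment> \<open>For positive \<open>u\<close> the target bound u \<le> \<epsilon> |x|^(-1/(2p))
    amounts to c \<le> u^(1-p).\<close>
  define c where "c = \<epsilon> powr (- (p - 1)) * norm x powr ((p - 1) / (2 * p))"
  have c: "c > 0" using False par by (simp add: c_def)
  have "(\<lambda>s. - (1 / 2 * c) * s) t - (\<lambda>s. - (1 / 2 * c) * s) 0 \<le> (Y x t - Y 0 t) - (Y x 0 - Y 0 0)"
  proof (rule derivative_le_imp_increment_le[where t = t and y = "\<lambda>s. - (1 / 2 * c) * s"
        and z = "\<lambda>s. Y x s - Y 0 s"
        and z' = "\<lambda>s. - (p - 1) * f (v x s) * exp (- (p - 1) * a * s) - - (p - 1) * f (v 0 s) * exp (- (p - 1) * a * s)"
        and y' = "\<lambda>s. - (1 / 2 * c)"])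
    show "0 \<le> t" using t by simp
    show "((\<lambda>s. - (1 / 2 * c) * s) has_real_derivative - (1 / 2 * c)) (at s within {0..t})" for s
      by (auto intro!: derivative_eq_intros)
    show "((\<lambda>s. Y x s - Y 0 s) has_real_derivative - (p - 1) * f (v x s) * exp (- (p - 1) * a * s)
        - - (p - 1) * f (v 0 s) * exp (- (p - 1) * a * s)) (at s within {0..t})"
      if "s \<in> {0..t}" for s
      by (intro DERIV_diff dY x \<Omega>(2) that)
    fix s assume s: "0 < s" "s < t"
    define e where "e = exp (- (p - 1) * a * s)"
    have e: "0 < e" "e \<le> 1" using decay_le_one[OF par(1,2), of s] s by (simp_all add: e_def)
    have st: "s \<in> {0..<t1}" using s t by auto
    have "(p - 1) * (f (v x s) - f (v 0 s)) \<le> (p - 1) * \<bar>f (v 0 s) - f (v x s)\<bar>"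
      using par by (intro mult_left_mono) auto
    also have "\<dots> \<le> 1 / 2 * c"
      using hold[OF x st] by (simp add: c_def mult.assoc)
    finally have "(p - 1) * (f (v x s) - f (v 0 s)) * e \<le> (1 / 2 * c) * e"
      using e by (intro mult_right_mono) auto
    also have "\<dots> \<le> 1 / 2 * c" using e c by simp
    finally show "- (1 / 2 * c) \<le> - (p - 1) * f (v x s) * exp (- (p - 1) * a * s)
        - - (p - 1) * f (v 0 s) * exp (- (p - 1) * a * s)"
      unfolding e_def[symmetric] by (simp add: algebra_simps)
  qed
  moreover have "1 / 2 * c * t \<le> 1 / 2 * c" using t t1 c by simp
  moreover have "Y x 0 - Y 0 0 > 2 * c"
  proof -
    have "u0 0 powr (1 - p) + 2 * c < u0 x powr (1 - p)"
      using less_powr_imp_powr_less[OF par(1), of "u0 x" "u0 0 powr (1 - p) + 2 * c"] u0[of x] x False c u00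
      by (simp add: c_def mult.assoc add_pos_pos)
    then show ?thesis using facts(8) x \<Omega>(2) by (simp add: Y_def)
  qed
  moreover have "Y 0 t > 0" using upos[OF \<Omega>(2), of t] t by (simp add: Y_def)
  ultimately have "3 / 2 * c \<le> Y x t" by simp
  also have "Y x t \<le> u x t powr (1 - p)"
  proof -
    have "exp (- (p - 1) * a * t) \<le> 1" using decay_le_one[OF par(1,2)] t by simp
    from mult_left_mono[OF this, of "u x t powr (1 - p)"] show ?thesis by (simp add: Y_def)
  qed
  finally have "3 / 2 * \<epsilon> powr (- (p - 1)) * norm x powr ((p - 1) / (2 * p)) \<le> u x t powr (1 - p)"
    by (simp add: c_def mult.assoc)
  then show ?thesis
    using powr_lower_imp_upper[OF par(1,3), of "norm x" "u x t"] False upos[OF x, of t] t by simp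
qed (use par in simp)

theorem theorem3p1:
  fixes \<Omega> :: "'a::euclidean_space set" and f :: "real \<Rightarrow> real" and p a b \<kappa> :: real
  assumes "open \<Omega>" "connected \<Omega>" "bounded \<Omega>" "smooth_boundary \<Omega>" "0 \<in> \<Omega>"
    and "admissible_nonlinearity f"
    and "p > 1" "a > 0" "b > 0" "\<kappa> > 0"
  shows "\<exists>\<alpha> R0. 0 < \<alpha> \<and> \<alpha> < 1 \<and> 0 < R0 \<and>
    (\<forall>vbar0 > R0. \<exists>\<epsilon> > 0. \<forall>u0 v0 Tmax u v.
       continuous_on (closure \<Omega>) u0 \<and> continuous_on (closure \<Omega>) v0 \<and>
       (\<forall>x\<in>\<Omega> - {0}. 0 < u0 x \<and>
          u0 x < (u0 0 powr (1 - p) + 2 * \<epsilon> powr (- (p - 1)) * norm x powr \<alpha>)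
                   powr (- (1 / (p - 1)))) \<and>
       u0 0 \<ge> (a / ((1 - exp ((1 - p) * a)) * (INF v\<in>{R0..}. f v))) powr (1 / (p - 1)) \<and>
       (\<forall>x\<in>\<Omega>. v0 x = vbar0) \<and>
       maximal_rd_ode_solution \<Omega> f p a b \<kappa> u0 v0 Tmax u v
       \<longrightarrow>
       Tmax < \<infinity> \<and> Tmax \<le> 1 \<and>
       (\<forall>x\<in>\<Omega>. \<forall>t. 0 \<le> t \<and> ereal t < Tmax \<longrightarrow>
          0 < u x t \<and> (x \<noteq> 0 \<longrightarrow> u x t < \<epsilon> * norm x powr (- (\<alpha> / (p - 1)))) \<and> v x t \<ge> R0))"
proof -
  note \<Omega> = assms(1,3,4,5) and f = assms(6) and par = assms(7-10)
  define \<alpha> where "\<alpha> = (p - 1) / (2 * p)"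
  define R0 where "R0 = \<kappa> / (2 * b)"
  have \<alpha>: "0 < \<alpha>" "\<alpha> < 1" using par by (auto simp: \<alpha>_def field_simps)
  have R0: "0 < R0" using par by (simp add: R0_def)
  have \<gamma>: "\<alpha> / (p - 1) = 1 / (2 * p)" using par by (simp add: \<alpha>_def)
  define F0 where "F0 = (INF v\<in>{R0..}. f v)"
  have F0: "0 < F0" "\<And>v. v \<ge> R0 \<Longrightarrow> F0 \<le> f v"
    using admissible_INF[OF f R0] by (simp_all add: F0_def)
  define D where "D = 1 - exp ((1 - p) * a)"
  have D: "D > 0" using par by (simp add: D_def mult_neg_pos)
  show ?thesis
  proof (rule exI[of _ \<alpha>], rule exI[of _ R0], intro conjI allI impI \<alpha> R0, goal_cases)
    case (1 vb)
    then have vb: "R0 < vb" .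
    show ?case
    proof (rule rd_apriori[OF \<Omega>(1,2,3,4) f par(1,3,4) \<alpha> R0_def vb])
      fix \<epsilon> :: real
      assume \<epsilon>: "\<epsilon> > 0" and apriori: "\<And>a u0 v0 T u v t1. \<lbrakk>rd_ode_solution \<Omega> f p a b \<kappa> u0 v0 T u v; \<And>x. x \<in> \<Omega> \<Longrightarrow> v0 x = vb;
        0 < t1; ereal t1 < T; t1 \<le> 1;
        \<And>x t. x \<in> closure \<Omega> \<Longrightarrow> t \<in> {0..<t1} \<Longrightarrow> u x t * norm x powr (1 / (2 * p)) \<le> \<epsilon>\<rbrakk> \<Longrightarrow>
        (\<forall>x\<in>closure \<Omega>. \<forall>t\<in>{0..<t1}. v x t \<ge> R0) \<and>
        (\<forall>x\<in>\<Omega>. \<forall>t\<in>{0..<t1}. (p - 1) * \<bar>f (v 0 t) - f (v x t)\<bar> \<le> 1 / 2 * \<epsilon> powr (- (p - 1)) * norm x powr \<alpha>)"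
      show ?thesis
      proof (intro exI[of _ \<epsilon>] conjI allI ballI impI \<epsilon>; elim conjE)
        fix u0 v0 :: "'a \<Rightarrow> real" and T u v
        assume u0: "\<forall>x\<in>\<Omega> - {0}. 0 < u0 x \<and>
            u0 x < (u0 0 powr (1 - p) + 2 * \<epsilon> powr (- (p - 1)) * norm x powr \<alpha>) powr (- (1 / (p - 1)))"
          and "u0 0 \<ge> (a / ((1 - exp ((1 - p) * a)) * (INF v\<in>{R0..}. f v))) powr (1 / (p - 1))"
          and v0: "\<forall>x\<in>\<Omega>. v0 x = vb" and "maximal_rd_ode_solution \<Omega> f p a b \<kappa> u0 v0 T u v"
        then have sol: "rd_ode_solution \<Omega> f p a b \<kappa> u0 v0 T u v"
          and u00: "u0 0 \<ge> (a / (D * F0)) powr (1 / (p - 1))"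
          by (simp_all add: maximal_rd_ode_solution_def D_def F0_def)
        have p0: "p > 0" using par by simp
        note facts = rd_ode_solution_facts[OF sol \<Omega>(1) p0 admissible_continuous[OF f]]
        have u00p: "u0 0 > 0"
          using u00 D F0 par by (intro less_le_trans[OF _ u00]) simp
        have cl: "y \<in> closure \<Omega>" if "y \<in> \<Omega>" for y using that closure_subset by blast
        \<comment> \<open>The contraction factor from \<open>powr_lower_imp_upper\<close>; that it
          is below one excludes a first time at which the bound with \<epsilon> is reached.\<close>
        define \<theta> where "\<theta> = (3 / 2 :: real) powr (- (1 / (p - 1)))"
        have \<theta>: "\<theta> * \<epsilon> < \<epsilon>"
        proof -
          have "\<theta> < 1" unfolding \<theta>_def using par by (intro powr_less_one) auto
          then show ?thesis using \<epsilon> by simp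
        qed
        let ?q = "\<lambda>z. u (fst z) (snd z) * norm (fst z) powr (1 / (2 * p))"
        have Q: "u x t * norm x powr (1 / (2 * p)) < \<epsilon>"
          if t2: "0 < t2" "ereal t2 < T" "t2 \<le> 1" and x: "x \<in> closure \<Omega>" and t: "t \<in> {0..t2}" for t2 x t
        proof (rule ccontr)
          assume "\<not> u x t * norm x powr (1 / (2 * p)) < \<epsilon>"
          let ?K = "closure \<Omega> \<times> {0..t2}"
          have cq: "continuous_on ?K ?q"
            using facts(1)[OF t2(1,2)] p0
            by (auto simp: split_def intro!: continuous_intros continuous_on_powr')
          have comp: "compact ?K" using \<Omega>(2) by (intro compact_Times) auto
          \<comment> \<open>By compactness there is a first bad time \<open>t3\<close>. Before it
            the a priori estimate applies, and the improved bound passes to \<open>t3\<close> by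
            continuity.\<close>
          define Bad where "Bad = {z \<in> ?K. ?q z \<ge> \<epsilon>}"
          have "closed ?K" using comp compact_imp_closed by blast
          note compact_Int_closed[OF comp continuous_closed_preimage[OF cq this closed_atLeast[of \<epsilon>]]]
          also have "?K \<inter> (?K \<inter> ?q -` {\<epsilon>..}) = Bad" by (auto simp: Bad_def)
          finally have "compact Bad" .
          moreover have "(x, t) \<in> Bad"
            using x t \<open>\<not> u x t * norm x powr (1 / (2 * p)) < \<epsilon>\<close> by (simp add: Bad_def)
          moreover have "continuous_on Bad snd" by (intro continuous_intros)
          ultimately obtain z3 where z3: "z3 \<in> Bad" "\<And>z. z \<in> Bad \<Longrightarrow> snd z3 \<le> snd z"
            using continuous_attains_inf[of Bad snd] by blast
          obtain x3 t3 where z3_eq: "z3 = (x3, t3)" by (cases z3)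
          have x3: "x3 \<in> closure \<Omega>" "0 \<le> t3" "t3 \<le> t2" "?q (x3, t3) \<ge> \<epsilon>"
            using z3(1) by (auto simp: Bad_def z3_eq)
          have before: "?q (y, s) < \<epsilon>" if "y \<in> closure \<Omega>" "0 \<le> s" "s < t3" for y s
          proof (rule ccontr)
            assume "\<not> ?q (y, s) < \<epsilon>"
            then have "(y, s) \<in> Bad" using that x3 by (simp add: Bad_def)
            from z3(2)[OF this] that show False by (simp add: z3_eq)
          qed
          have improve: "?q (y, t3) \<le> \<theta> * \<epsilon>" if y: "y \<in> \<Omega>" for y
          proof (cases "t3 = 0")
            \<comment> \<open>At time 0 no evolution has taken place: the condition on
              \<open>u0\<close> already gives more than 2 c in the Bernoulli variable, hence at
              least 3/2 c.\<close>
            case True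
            show ?thesis
            proof (cases "y = 0")
              case False
              define c where "c = \<epsilon> powr (- (p - 1)) * norm y powr \<alpha>"
              have c: "c > 0" using False \<epsilon> by (simp add: c_def)
              have uy: "0 < u0 y" "u0 y < (u0 0 powr (1 - p) + 2 * c) powr (- (1 / (p - 1)))"
                using u0 y False by (auto simp: c_def mult.assoc)
              have "u0 0 powr (1 - p) + 2 * c < u0 y powr (1 - p)"
                using c by (intro less_powr_imp_powr_less[OF par(1) uy(1) _ uy(2)]) (simp add: add_nonneg_pos)
              moreover have "u0 0 powr (1 - p) \<ge> 0" by simp
              ultimately have "3 / 2 * c \<le> u0 y powr (1 - p)" using c by linarith
              then show ?thesis
                using powr_lower_imp_upper[OF par(1) \<epsilon>, of "norm y" "u0 y"] uy(1) False True
                  facts(8)[OF t2(1,2) y] by (simp add: c_def \<alpha>_def \<theta>_def mult.assoc)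
            qed (use \<epsilon> in \<open>simp add: \<theta>_def\<close>)
          next
            case False
            then have t3: "0 < t3" "ereal t3 < T" "t3 \<le> 1"
              using x3 t2 by (auto intro: le_less_trans[of _ "ereal t2"])
            from apriori[OF sol v0[rule_format] t3] before
            have "\<forall>x\<in>\<Omega>. \<forall>t\<in>{0..<t3}. (p - 1) * \<bar>f (v 0 t) - f (v x t)\<bar> \<le> 1 / 2 * \<epsilon> powr (- (p - 1)) * norm x powr \<alpha>"
              by (fastforce intro: less_imp_le)
            then have st: "?q (y, s) \<le> \<theta> * \<epsilon>" if "s \<in> {0..<t3}" for s
              using rd_bootstrap_step[OF sol \<Omega>(1,4) f par(1,2) \<epsilon> t3 u00p, of y s] u0 y that
              by (simp add: \<alpha>_def \<theta>_def)
            have "continuous_on (closure {0..<t3}) (\<lambda>s. ?q (y, s))"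
              using t3 x3 cl[OF y] by (intro continuous_on_compose2[OF cq] continuous_intros) auto
            then show ?thesis
              by (rule continuous_le_on_closure) (use st t3 in auto)
          qed
          \<comment> \<open>The improvement is known inside \<Omega>, while the bad point may lie on
            the boundary.\<close>
          have "continuous_on (closure \<Omega>) (\<lambda>y. ?q (y, t3))"
            using x3 by (intro continuous_on_compose2[OF cq] continuous_intros) auto
          then have "?q (x3, t3) \<le> \<theta> * \<epsilon>"
            by (rule continuous_le_on_closure[OF _ x3(1)]) (rule improve)
          then show False using x3(4) \<theta> by linarith
        qed
        have vR: "v x t \<ge> R0" if "0 < t2" "ereal t2 < T" "t2 \<le> 1" "x \<in> \<Omega>" "0 \<le> t" "t < t2" for t2 x t
        proof -
          have "\<And>x t. x \<in> closure \<Omega> \<Longrightarrow> t \<in> {0..<t2} \<Longrightarrow> u x t * norm x powr (1 / (2 * p)) \<le> \<epsilon>"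
            using Q[OF that(1-3)] by (intro less_imp_le) auto
          from apriori[OF sol v0[rule_format] that(1-3) this] cl[OF that(4)] that(5,6)
          show ?thesis by auto
        qed
        have upos: "u x t > 0" if x: "x \<in> \<Omega>" and t: "0 \<le> t" "ereal t < T" for x t
        proof (cases "t = 0")
          case True
          \<comment> \<open>The initial values are read off from \<open>facts\<close>, which
            requires some positive time below \<open>T\<close>.\<close>
          obtain t2 where "0 < ereal t2" "ereal t2 < T"
            using sol ereal_dense2[of 0 T] by (auto simp: rd_ode_solution_def Let_def)
          then show ?thesis
            using facts(8)[of t2 x] x u0 u00p True by (cases "x = 0") auto
        next
          case False
          then have t0: "0 < t" using t by simp
          show ?thesis
          proof (rule rd_ode_positive[where u = "u x" and t = t and k = "\<lambda>s. f (v x s)" and a = a and p = p])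
            show "u x 0 > 0" using facts(8)[OF t0 t(2) x] u0 u00p x by (cases "x = 0") auto
            show "(u x has_real_derivative - a * u x s + u x s powr p * f (v x s)) (at s within {0..t})"
              if "s \<in> {0..t}" for s
              by (rule facts(7)[OF t0 t(2) cl[OF x] that])
            show "f (v x s) \<ge> 0" if "s \<in> {0..t}" for s
              using facts(6)[OF t0 t(2) cl[OF x] that] admissible_nonneg[OF f] by simp
          qed (rule t(1))
        qed
        have T1: "T \<le> 1"
        proof (rule ccontr)
          assume "\<not> T \<le> 1"
          then have one: "ereal 1 < T" by (simp add: one_ereal_def)
          note facts1 = facts[OF zero_less_one one]
          define c where "c = (p - 1) * a"
          have c: "c > 0" using par by (simp add: c_def)
          define Y where "Y s = u 0 s powr (1 - p) * exp (- (p - 1) * a * s)" for s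
          have up: "u 0 s > 0" if "s \<in> {0..1}" for s
            using upos[OF \<Omega>(4), of s] that le_less_trans[OF _ one, of "ereal s"] by simp
          \<comment> \<open>Since v(0,s) \<ge> R0, \<open>Y\<close> decreases at least as fast as
            (F0/a) exp(-c s), which loses D F0/a on [0,1]. The threshold for \<open>u0 0\<close>
            says exactly that \<open>Y 0\<close> is at most D F0/a, so \<open>Y 1\<close> could not
            be positive.\<close>
          have "Y 1 - Y 0 \<le> (F0 / a) * exp (- c * 1) - (F0 / a) * exp (- c * 0)"
          proof (rule derivative_le_imp_increment_le[where t = 1 and y = Y and
                z = "\<lambda>s. (F0 / a) * exp (- c * s)" and y' = "\<lambda>s. - (p - 1) * f (v 0 s) * exp (- (p - 1) * a * s)" and
                z' = "\<lambda>s. - (p - 1) * F0 * exp (- (p - 1) * a * s)"])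
            show "(Y has_real_derivative - (p - 1) * f (v 0 s) * exp (- (p - 1) * a * s)) (at s within {0..1})"
              if "s \<in> {0..1}" for s
              unfolding Y_def[abs_def] using facts1(7)[OF cl[OF \<Omega>(4)] that] up[OF that]
              by (rule rd_ode_bernoulli)
            show "((\<lambda>s. (F0 / a) * exp (- c * s)) has_real_derivative
                - (p - 1) * F0 * exp (- (p - 1) * a * s)) (at s within {0..1})" for s
            proof -
              have "((\<lambda>s. exp (- c * s)) has_real_derivative exp (- c * s) * (- c)) (at s within {0..1})"
                by (auto intro!: derivative_eq_intros)
              from DERIV_cmult[OF this, of "F0 / a"]
              have "((\<lambda>s. (F0 / a) * exp (- c * s)) has_real_derivative
                  (F0 / a) * (exp (- c * s) * (- c))) (at s within {0..1})" .
              moreover have "(F0 / a) * (exp (- c * s) * (- c)) = - (p - 1) * F0 * exp (- c * s)"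
              proof -
                have "(F0 / a) * c = (p - 1) * F0" using par(2) by (simp add: c_def)
                then have "(F0 / a) * c * exp (- c * s) = (p - 1) * F0 * exp (- c * s)" by simp
                then show ?thesis by (simp only: mult_minus_left mult_minus_right mult_ac)
              qed
              moreover have "- c * s = - (p - 1) * a * s" by (simp add: c_def algebra_simps)
              ultimately show ?thesis by (simp only:)
            qed
            show "- (p - 1) * f (v 0 s) * exp (- (p - 1) * a * s) \<le> - (p - 1) * F0 * exp (- (p - 1) * a * s)"
              if "0 < s" "s < 1" for s
            proof -
              have "F0 \<le> f (v 0 s)"
                using vR[OF zero_less_one one order_refl \<Omega>(4), of s] that F0(2) by simp
              then show ?thesis
                using par by (intro mult_right_mono mult_left_mono_neg) auto
            qed
          qed simp
          moreover have "(F0 / a) * exp (- c * 1) - (F0 / a) * exp (- c * 0) = - (D * F0 / a)"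
          proof -
            have "(1 - p) * a = - c" by (simp add: c_def algebra_simps)
            then have "D = 1 - exp (- c)" by (simp only: D_def)
            then show ?thesis by (simp add: left_diff_distrib diff_divide_distrib)
          qed
          moreover have "Y 0 \<le> D * F0 / a"
          proof -
            have e: "1 / (p - 1) * (1 - p) = - 1" using par by (simp add: field_simps)
            have "u0 0 powr (1 - p) \<le> ((a / (D * F0)) powr (1 / (p - 1))) powr (1 - p)"
              using D F0 par by (intro powr_mono2'[OF _ _ u00]) auto
            also have "\<dots> = D * F0 / a"
              unfolding powr_powr e using D F0 par by (simp add: powr_minus)
            finally show ?thesis using facts1(8)[OF \<Omega>(4)] by (simp add: Y_def)
          qed
          moreover have "Y 1 > 0" using up[of 1] by (simp add: Y_def)
          ultimately show False by linarith
        qed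
        then show "T < \<infinity>" "T \<le> 1" by (auto simp: one_ereal_def intro: le_less_trans)
        fix x t assume x: "x \<in> \<Omega>" and t: "0 \<le> t" "ereal t < T"
        \<comment> \<open>The bounds are available on intervals reaching strictly beyond
          \<open>t\<close>; such a \<open>t2\<close> is below one because T \<le> 1.\<close>
        obtain t2 where t2': "ereal t < ereal t2" "ereal t2 < T"
          using ereal_dense2[OF t(2)] by blast
        have t2: "0 < t2" "ereal t2 < T" "t2 \<le> 1" "t < t2"
          using t2' t less_le_trans[OF t2'(2) T1] by (auto simp: one_ereal_def)
        have "u x t < \<epsilon> * norm x powr (- (\<alpha> / (p - 1)))" if "x \<noteq> 0"
        proof -
          have "u x t * norm x powr (1 / (2 * p)) < \<epsilon>"
            using Q[OF t2(1-3) cl[OF x], of t] t t2 by simp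
          then show ?thesis
            using that unfolding \<gamma> by (simp add: powr_minus field_simps)
        qed
        then show "0 < u x t" "x \<noteq> 0 \<Longrightarrow> u x t < \<epsilon> * norm x powr (- (\<alpha> / (p - 1)))" "v x t \<ge> R0"
          using upos[OF x t] vR[OF t2(1-3) x t(1) t2(4)] by auto
      qed
    qed
  qed
qed

end
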